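(* Let $\mathcal{C}$ be a localizing subcategory of an abelian category $\mathcal{A}$, with canonical functor $\mathscr{Q}:\mathcal{A}\to\mathcal{A}/\mathcal{C}$ and section functor $\mathscr{S}:\mathcal{A}/\mathcal{C}\to\mathcal{A}$. Then the restricted canonical functor $\mathscr{Q}:\operatorname{Sat}_{\mathcal{C}}(\mathcal{A})\to\mathcal{A}/\mathcal{C}$ and the corestricted section functor $\mathscr{S}:\mathcal{A}/\mathcal{C}\to\operatorname{Sat}_{\mathcal{C}}(\mathcal{A})$ are quasi-inverse equivalences of categories. In particular, $\operatorname{Sat}_{\mathcal{C}}(\mathcal{A})\simeq\mathscr{S}(\mathcal{A}/\mathcal{C})\simeq\mathcal{A}/\mathcal{C}$ is an abelian category. Let $\widehat{\mathscr{Q}}:\mathcal{A}\to\operatorname{Sat}_{\mathcal{C}}(\mathcal{A})$ be the corestriction of $\mathscr{S}\circ\mathscr{Q}$ to $\operatorname{Sat}_{\mathcal{C}}(\mathcal{A})$, and let $\iota:\operatorname{Sat}_{\mathcal{C}}(\mathcal{A})\hookrightarrow\mathcal{A}$ be the inclusion. Then $\widehat{\mathscr{Q}}$ is left adjoint to $\iota$, and the adjunction $\widehat{\mathscr{Q}}\dashv\iota$ corresponds, under the equivalence $\operatorname{Sat}_{\mathcal{C}}(\mathcal{A})\simeq\mathcal{A}/\mathcal{C}$ given by the restricted canonical functor $\mathscr{Q}:\operatorname{Sat}_{\mathcal{C}}(\mathcal{A})\to\mathcal{A}/\mathcal{C}$ and its quasi-inverse, the corestricted section functor $\mathscr{S}:\mathcal{A}/\mathcal{C}\to\operatorname{Sat}_{\mathcal{C}}(\mathcal{A})$,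 to the adjunction $\mathscr{Q}\dashv\mathscr{S}$. Both adjunctions share the same adjunction monad $\mathscr{S}\circ\mathscr{Q}=\iota\circ\widehat{\mathscr{Q}}:\mathcal{A}\to\mathcal{A}$. In particular, the reflector $\widehat{\mathscr{Q}}$ is exact and $\iota$ is left exact.
   Context: Thick subcategory: a non-empty full subcategory $\mathcal{C}$ of the abelian category $\mathcal{A}$ such that for every short exact sequence $0\to M'\to M\to M''\to 0$ in $\mathcal{A}$ the object $M$ lies in $\mathcal{C}$ if and only if $M'$ and $M''$ lie in $\mathcal{C}$. Serre quotient: for $\mathcal{C}$ thick, $\mathcal{A}/\mathcal{C}$ is the category with the same objects as $\mathcal{A}$ and $\operatorname{Hom}_{\mathcal{A}/\mathcal{C}}(M,N)=\varinjlim_{M',N'}\operatorname{Hom}_{\mathcal{A}}(M',N/N')$, the limit over all subobjects $M'\le M$, $N'\le N$ with $M/M'\in\mathcal{C}$, $N'\in\mathcal{C}$. The canonical functor $\mathscr{Q}:\mathcal{A}\to\mathcal{A}/\mathcal{C}$ is the identity on objects and sends a morphism to its class in the direct limit. The category $\mathcal{A}/\mathcal{C}$ is abelian and $\mathscr{Q}$ is exact. Localizing subcategory and section functor: a thick subcategory $\mathcal{C}$ is localizing if $\mathscr{Q}$ admits a right adjoint $\mathscr{S}:\mathcal{A}/\mathcal{C}\to\mathcal{A}$, called the section functor of $\mathscr{Q}$. The monad associated to an adjunction $\mathscr{F}\dashv\mathscr{G}$ with unit $\eta$ and counit $\delta$ is $(\mathscr{G}\circ\mathscr{F},\eta,\mathscr{G}\delta\mathscr{F})$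 (endofunctor, unit, multiplication). $\mathcal{C}$-saturated objects: an object $M$ of $\mathcal{A}$ is $\mathcal{C}$-saturated if it has no non-trivial subobject in $\mathcal{C}$ and every short exact sequence $0\to M\to E\to C\to 0$ in $\mathcal{A}$ with $C\in\mathcal{C}$ splits. $\operatorname{Sat}_{\mathcal{C}}(\mathcal{A})$ denotes the full (replete) subcategory of $\mathcal{A}$ of $\mathcal{C}$-saturated objects. The image $\mathscr{S}(\mathcal{A}/\mathcal{C})$ is a subcategory of $\operatorname{Sat}_{\mathcal{C}}(\mathcal{A})$, so the corestrictions of $\mathscr{S}$ and $\mathscr{S}\circ\mathscr{Q}$ to $\operatorname{Sat}_{\mathcal{C}}(\mathcal{A})$ make sense. Exactness of $\widehat{\mathscr{Q}}$ and left exactness of $\iota$ refer to the intrinsic abelian structure of $\operatorname{Sat}_{\mathcal{C}}(\mathcal{A})$ (a short exact sequence in it need not be exact in $\mathcal{A}$). *)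

theory Defs
  imports "HOL-Algebra.Group"
begin

section \<open>Categories, functors, natural transformations\<close>

record ('o, 'm) cat =
  Obj :: "'o set"
  Arr :: "'m set"
  Dom :: "'m \<Rightarrow> 'o"
  Cod :: "'m \<Rightarrow> 'o"
  Idn :: "'o \<Rightarrow> 'm"
  Comp :: "'m \<Rightarrow> 'm \<Rightarrow> 'm"  (infixr "\<cdot>\<index>" 70)

text \<open>Composition is written in the applicative order: \<open>g \<cdot>\<^bsub>A\<^esub> f\<close> is \<open>f\<close> followed by \<open>g\<close>, and is only
  meaningful if \<open>Cod A f = Dom A g\<close>.\<close>

definition Hom :: "('o, 'm) cat \<Rightarrow> 'o \<Rightarrow> 'o \<Rightarrow> 'm set" where
  "Hom A X Y = {f \<in> Arr A. Dom A f = X \<and> Cod A f = Y}"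

definition category :: "('o, 'm) cat \<Rightarrow> bool" where
  "category A \<longleftrightarrow>
     (\<forall>f \<in> Arr A. Dom A f \<in> Obj A \<and> Cod A f \<in> Obj A) \<and>
     (\<forall>X \<in> Obj A. Idn A X \<in> Hom A X X) \<and>
     (\<forall>f \<in> Arr A. \<forall>g \<in> Arr A. Cod A f = Dom A g \<longrightarrow> g \<cdot>\<^bsub>A\<^esub> f \<in> Hom A (Dom A f) (Cod A g)) \<and>
     (\<forall>f \<in> Arr A. f \<cdot>\<^bsub>A\<^esub> Idn A (Dom A f) = f \<and> Idn A (Cod A f) \<cdot>\<^bsub>A\<^esub> f = f) \<and>
     (\<forall>f \<in> Arr A. \<forall>g \<in> Arr A. \<forall>h \<in> Arr A. Cod A f = Dom A g \<longrightarrow> Cod A g = Dom A h \<longrightarrow>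
        h \<cdot>\<^bsub>A\<^esub> (g \<cdot>\<^bsub>A\<^esub> f) = (h \<cdot>\<^bsub>A\<^esub> g) \<cdot>\<^bsub>A\<^esub> f)"

definition iso_arr :: "('o, 'm) cat \<Rightarrow> 'm \<Rightarrow> bool" where
  "iso_arr A f \<longleftrightarrow> f \<in> Arr A \<and>
     (\<exists>g \<in> Hom A (Cod A f) (Dom A f).
        g \<cdot>\<^bsub>A\<^esub> f = Idn A (Dom A f) \<and> f \<cdot>\<^bsub>A\<^esub> g = Idn A (Cod A f))"

record ('o, 'm, 'p, 'n) func =
  FObj :: "'o \<Rightarrow> 'p"
  FArr :: "'m \<Rightarrow> 'n"

text \<open>The data of a functor carry no source and target category, so a restriction to a full
  subcategory or a corestriction of a functor has the same data as the functor itself; that the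
  (co)restriction makes sense is the assertion \<open>is_functor\<close> for the smaller category. Likewise
  \<open>id_func\<close> serves as the inclusion of any subcategory. Values outside the source category are
  irrelevant.\<close>

definition is_functor :: "('o, 'm) cat \<Rightarrow> ('p, 'n) cat \<Rightarrow> ('o, 'm, 'p, 'n) func \<Rightarrow> bool" where
  "is_functor A B F \<longleftrightarrow> category A \<and> category B \<and>
     (\<forall>X \<in> Obj A. FObj F X \<in> Obj B) \<and>
     (\<forall>f \<in> Arr A. FArr F f \<in> Hom B (FObj F (Dom A f)) (FObj F (Cod A f))) \<and>
     (\<forall>X \<in> Obj A. FArr F (Idn A X) = Idn B (FObj F X)) \<and>
     (\<forall>f \<in> Arr A. \<forall>g \<in> Arr A. Cod A f = Dom A g \<longrightarrow>
        FArr F (g \<cdot>\<^bsub>A\<^esub> f) = FArr F g \<cdot>\<^bsub>B\<^esub> FArr F f)"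

definition id_func :: "('o, 'm, 'o, 'm) func" where
  "id_func = \<lparr>FObj = id, FArr = id\<rparr>"

definition func_comp ::
  "('p, 'n, 'q, 'k) func \<Rightarrow> ('o, 'm, 'p, 'n) func \<Rightarrow> ('o, 'm, 'q, 'k) func"  (infixl "\<circ>\<^sub>F" 55) where
  "G \<circ>\<^sub>F F = \<lparr>FObj = FObj G \<circ> FObj F, FArr = FArr G \<circ> FArr F\<rparr>"

definition nat_trans :: "('o, 'm) cat \<Rightarrow> ('p, 'n) cat \<Rightarrow> ('o, 'm, 'p, 'n) func \<Rightarrow>
    ('o, 'm, 'p, 'n) func \<Rightarrow> ('o \<Rightarrow> 'n) \<Rightarrow> bool" where
  "nat_trans A B F G t \<longleftrightarrow> is_functor A B F \<and> is_functor A B G \<and>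
     (\<forall>X \<in> Obj A. t X \<in> Hom B (FObj F X) (FObj G X)) \<and>
     (\<forall>f \<in> Arr A. t (Cod A f) \<cdot>\<^bsub>B\<^esub> FArr F f = FArr G f \<cdot>\<^bsub>B\<^esub> t (Dom A f))"

definition nat_iso :: "('o, 'm) cat \<Rightarrow> ('p, 'n) cat \<Rightarrow> ('o, 'm, 'p, 'n) func \<Rightarrow>
    ('o, 'm, 'p, 'n) func \<Rightarrow> ('o \<Rightarrow> 'n) \<Rightarrow> bool" where
  "nat_iso A B F G t \<longleftrightarrow> nat_trans A B F G t \<and> (\<forall>X \<in> Obj A. iso_arr B (t X))"

definition quasi_inverse_equivalences :: "('o, 'm) cat \<Rightarrow> ('p, 'n) cat \<Rightarrow>
    ('o, 'm, 'p, 'n) func \<Rightarrow> ('p, 'n, 'o, 'm) func \<Rightarrow> bool" where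
  "quasi_inverse_equivalences A B F G \<longleftrightarrow> is_functor A B F \<and> is_functor B A G \<and>
     (\<exists>t. nat_iso A A (G \<circ>\<^sub>F F) id_func t) \<and> (\<exists>t. nat_iso B B (F \<circ>\<^sub>F G) id_func t)"

definition equivalent_categories :: "('o, 'm) cat \<Rightarrow> ('p, 'n) cat \<Rightarrow> bool" where
  "equivalent_categories A B \<longleftrightarrow> (\<exists>F G. quasi_inverse_equivalences A B F G)"

definition full_subcategory :: "('o, 'm) cat \<Rightarrow> 'o set \<Rightarrow> ('o, 'm) cat" where
  "full_subcategory A U =
     A\<lparr>Obj := U, Arr := {f \<in> Arr A. Dom A f \<in> U \<and> Cod A f \<in> U}\<rparr>"

text \<open>The literal image \<open>F(A)\<close> inside \<open>B\<close> of a functor from \<open>A\<close> to \<open>B\<close>. In general it need not be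
  closed under composition; that it is a category is part of any statement about it.\<close>

definition image_category ::
  "('o, 'm) cat \<Rightarrow> ('p, 'n) cat \<Rightarrow> ('o, 'm, 'p, 'n) func \<Rightarrow> ('p, 'n) cat" where
  "image_category A B F = B\<lparr>Obj := FObj F ` Obj A, Arr := FArr F ` Arr A\<rparr>"


section \<open>Adjunctions and their monads\<close>

text \<open>\<open>F \<stileturn> G\<close> with unit \<open>\<eta>\<close> and counit \<open>\<delta>\<close>.\<close>

definition adjunction :: "('o, 'm) cat \<Rightarrow> ('p, 'n) cat \<Rightarrow> ('o, 'm, 'p, 'n) func \<Rightarrow>
    ('p, 'n, 'o, 'm) func \<Rightarrow> ('o \<Rightarrow> 'm) \<Rightarrow> ('p \<Rightarrow> 'n) \<Rightarrow> bool" where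
  "adjunction A B F G \<eta> \<delta> \<longleftrightarrow> is_functor A B F \<and> is_functor B A G \<and>
     nat_trans A A id_func (G \<circ>\<^sub>F F) \<eta> \<and> nat_trans B B (F \<circ>\<^sub>F G) id_func \<delta> \<and>
     (\<forall>X \<in> Obj A. \<delta> (FObj F X) \<cdot>\<^bsub>B\<^esub> FArr F (\<eta> X) = Idn B (FObj F X)) \<and>
     (\<forall>Y \<in> Obj B. FArr G (\<delta> Y) \<cdot>\<^bsub>A\<^esub> \<eta> (FObj G Y) = Idn A (FObj G Y))"

type_synonym ('o, 'm) monad_data = "('o, 'm, 'o, 'm) func \<times> ('o \<Rightarrow> 'm) \<times> ('o \<Rightarrow> 'm)"

definition adjunction_monad :: "('o, 'm, 'p, 'n) func \<Rightarrow> ('p, 'n, 'o, 'm) func \<Rightarrow>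
    ('o \<Rightarrow> 'm) \<Rightarrow> ('p \<Rightarrow> 'n) \<Rightarrow> ('o, 'm) monad_data" where
  "adjunction_monad F G \<eta> \<delta> = (G \<circ>\<^sub>F F, \<eta>, \<lambda>X. FArr G (\<delta> (FObj F X)))"

text \<open>Equality of endofunctors, units and multiplications on \<open>A\<close>, i.e. disregarding the values
  outside the carrier of \<open>A\<close>.\<close>

definition same_monad :: "('o, 'm) cat \<Rightarrow> ('o, 'm) monad_data \<Rightarrow> ('o, 'm) monad_data \<Rightarrow> bool" where
  "same_monad A = (\<lambda>(T, \<eta>, \<mu>) (T', \<eta>', \<mu>').
     (\<forall>X \<in> Obj A. FObj T X = FObj T' X) \<and> (\<forall>f \<in> Arr A. FArr T f = FArr T' f) \<and>
     (\<forall>X \<in> Obj A. \<eta> X = \<eta>' X) \<and> (\<forall>X \<in> Obj A. \<mu> X = \<mu>' X))"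

text \<open>The adjunction \<open>(F, G, \<eta>, \<delta>)\<close> between \<open>A\<close> and \<open>B\<close> corresponds, under an equivalence
  \<open>H\<close> from \<open>B\<close> to \<open>B'\<close>, to the adjunction \<open>(F', G', \<eta>', \<delta>')\<close> between \<open>A\<close> and \<open>B'\<close>: there are
  natural isomorphisms \<open>\<alpha> : H F \<cong> F'\<close> and \<open>\<beta> : G \<cong> G' H\<close> carrying \<open>\<eta>\<close> to \<open>\<eta>'\<close> and \<open>\<delta>\<close> to \<open>\<delta>'\<close>.\<close>

definition adjunctions_correspond :: "('o, 'm) cat \<Rightarrow> ('p, 'n) cat \<Rightarrow> ('q, 'k) cat \<Rightarrow>
    ('p, 'n, 'q, 'k) func \<Rightarrow>
    ('o, 'm, 'p, 'n) func \<Rightarrow> ('p, 'n, 'o, 'm) func \<Rightarrow> ('o \<Rightarrow> 'm) \<Rightarrow> ('p \<Rightarrow> 'n) \<Rightarrow>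
    ('o, 'm, 'q, 'k) func \<Rightarrow> ('q, 'k, 'o, 'm) func \<Rightarrow> ('o \<Rightarrow> 'm) \<Rightarrow> ('q \<Rightarrow> 'k) \<Rightarrow> bool" where
  "adjunctions_correspond A B B' H F G \<eta> \<delta> F' G' \<eta>' \<delta>' \<longleftrightarrow>
     (\<exists>\<alpha> \<beta>. nat_iso A B' (H \<circ>\<^sub>F F) F' \<alpha> \<and> nat_iso B A G (G' \<circ>\<^sub>F H) \<beta> \<and>
        (\<forall>X \<in> Obj A. FArr G' (\<alpha> X) \<cdot>\<^bsub>A\<^esub> (\<beta> (FObj F X) \<cdot>\<^bsub>A\<^esub> \<eta> X) = \<eta>' X) \<and>
        (\<forall>Y \<in> Obj B. \<delta>' (FObj H Y) \<cdot>\<^bsub>B'\<^esub> (FArr F' (\<beta> Y) \<cdot>\<^bsub>B'\<^esub> \<alpha> (FObj G Y)) = FArr H (\<delta> Y)))"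


section \<open>Abelian categories and exactness\<close>

definition mono_arr :: "('o, 'm) cat \<Rightarrow> 'm \<Rightarrow> bool" where
  "mono_arr A f \<longleftrightarrow> f \<in> Arr A \<and>
     (\<forall>g \<in> Arr A. \<forall>h \<in> Arr A. Dom A g = Dom A h \<longrightarrow> Cod A g = Dom A f \<longrightarrow> Cod A h = Dom A f \<longrightarrow>
        f \<cdot>\<^bsub>A\<^esub> g = f \<cdot>\<^bsub>A\<^esub> h \<longrightarrow> g = h)"

definition epi_arr :: "('o, 'm) cat \<Rightarrow> 'm \<Rightarrow> bool" where
  "epi_arr A f \<longleftrightarrow> f \<in> Arr A \<and>
     (\<forall>g \<in> Arr A. \<forall>h \<in> Arr A. Cod A g = Cod A h \<longrightarrow> Dom A g = Cod A f \<longrightarrow> Dom A h = Cod A f \<longrightarrow>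
        g \<cdot>\<^bsub>A\<^esub> f = h \<cdot>\<^bsub>A\<^esub> f \<longrightarrow> g = h)"

definition zero_obj :: "('o, 'm) cat \<Rightarrow> 'o \<Rightarrow> bool" where
  "zero_obj A Z \<longleftrightarrow> Z \<in> Obj A \<and>
     (\<forall>X \<in> Obj A. (\<exists>!f. f \<in> Hom A X Z) \<and> (\<exists>!f. f \<in> Hom A Z X))"

definition zero_arr :: "('o, 'm) cat \<Rightarrow> 'm \<Rightarrow> bool" where
  "zero_arr A f \<longleftrightarrow>
     (\<exists>Z. zero_obj A Z \<and> (\<exists>g \<in> Hom A (Dom A f) Z. \<exists>h \<in> Hom A Z (Cod A f). f = h \<cdot>\<^bsub>A\<^esub> g))"

text \<open>\<open>is_kernel A f k\<close>: the arrow \<open>k\<close> is a kernel of \<open>f\<close>; \<open>is_cokernel A f c\<close>: the arrow \<open>c\<close>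
  is a cokernel of \<open>f\<close>.\<close>

definition is_kernel :: "('o, 'm) cat \<Rightarrow> 'm \<Rightarrow> 'm \<Rightarrow> bool" where
  "is_kernel A f k \<longleftrightarrow> f \<in> Arr A \<and> k \<in> Arr A \<and> Cod A k = Dom A f \<and> zero_arr A (f \<cdot>\<^bsub>A\<^esub> k) \<and>
     (\<forall>h \<in> Arr A. Cod A h = Dom A f \<longrightarrow> zero_arr A (f \<cdot>\<^bsub>A\<^esub> h) \<longrightarrow>
        (\<exists>!u. u \<in> Hom A (Dom A h) (Dom A k) \<and> k \<cdot>\<^bsub>A\<^esub> u = h))"

definition is_cokernel :: "('o, 'm) cat \<Rightarrow> 'm \<Rightarrow> 'm \<Rightarrow> bool" where
  "is_cokernel A f c \<longleftrightarrow> f \<in> Arr A \<and> c \<in> Arr A \<and> Dom A c = Cod A f \<and> zero_arr A (c \<cdot>\<^bsub>A\<^esub> f) \<and>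
     (\<forall>h \<in> Arr A. Dom A h = Cod A f \<longrightarrow> zero_arr A (h \<cdot>\<^bsub>A\<^esub> f) \<longrightarrow>
        (\<exists>!u. u \<in> Hom A (Cod A c) (Cod A h) \<and> u \<cdot>\<^bsub>A\<^esub> c = h))"

definition preadditive :: "('o, 'm) cat \<Rightarrow> ('m \<Rightarrow> 'm \<Rightarrow> 'm) \<Rightarrow> bool" where
  "preadditive A add \<longleftrightarrow> category A \<and>
     (\<forall>X \<in> Obj A. \<forall>Y \<in> Obj A. \<exists>z. comm_group \<lparr>carrier = Hom A X Y, mult = add, one = z\<rparr>) \<and>
     (\<forall>X \<in> Obj A. \<forall>Y \<in> Obj A. \<forall>Z \<in> Obj A.
        (\<forall>f \<in> Hom A X Y. \<forall>f' \<in> Hom A X Y. \<forall>g \<in> Hom A Y Z. \<forall>g' \<in> Hom A Y Z.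
           g \<cdot>\<^bsub>A\<^esub> add f f' = add (g \<cdot>\<^bsub>A\<^esub> f) (g \<cdot>\<^bsub>A\<^esub> f') \<and>
           add g g' \<cdot>\<^bsub>A\<^esub> f = add (g \<cdot>\<^bsub>A\<^esub> f) (g' \<cdot>\<^bsub>A\<^esub> f)))"

definition has_biproducts :: "('o, 'm) cat \<Rightarrow> ('m \<Rightarrow> 'm \<Rightarrow> 'm) \<Rightarrow> bool" where
  "has_biproducts A add \<longleftrightarrow>
     (\<forall>X \<in> Obj A. \<forall>Y \<in> Obj A. \<exists>W \<in> Obj A.
        \<exists>i \<in> Hom A X W. \<exists>j \<in> Hom A Y W. \<exists>p \<in> Hom A W X. \<exists>q \<in> Hom A W Y.
          p \<cdot>\<^bsub>A\<^esub> i = Idn A X \<and> q \<cdot>\<^bsub>A\<^esub> j = Idn A Y \<and>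
          add (i \<cdot>\<^bsub>A\<^esub> p) (j \<cdot>\<^bsub>A\<^esub> q) = Idn A W)"

text \<open>Being abelian is a property of a category, since the additive structure is unique.\<close>

definition abelian_category :: "('o, 'm) cat \<Rightarrow> bool" where
  "abelian_category A \<longleftrightarrow> category A \<and>
     (\<exists>add. preadditive A add \<and> has_biproducts A add) \<and>
     (\<exists>Z. zero_obj A Z) \<and>
     (\<forall>f \<in> Arr A. \<exists>k. is_kernel A f k) \<and>
     (\<forall>f \<in> Arr A. \<exists>c. is_cokernel A f c) \<and>
     (\<forall>f. mono_arr A f \<longrightarrow> (\<exists>g. is_kernel A g f)) \<and>
     (\<forall>f. epi_arr A f \<longrightarrow> (\<exists>g. is_cokernel A g f))"

text \<open>\<open>0 \<rightarrow> M' \<rightarrow> M \<rightarrow> M'' \<rightarrow> 0\<close> with arrows \<open>f\<close> and \<open>g\<close>.\<close>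

definition short_exact :: "('o, 'm) cat \<Rightarrow> 'm \<Rightarrow> 'm \<Rightarrow> bool" where
  "short_exact A f g \<longleftrightarrow> is_kernel A g f \<and> is_cokernel A f g"

definition splits :: "('o, 'm) cat \<Rightarrow> 'm \<Rightarrow> bool" where
  "splits A g \<longleftrightarrow> (\<exists>s \<in> Hom A (Cod A g) (Dom A g). g \<cdot>\<^bsub>A\<^esub> s = Idn A (Cod A g))"

definition exact_functor :: "('o, 'm) cat \<Rightarrow> ('p, 'n) cat \<Rightarrow> ('o, 'm, 'p, 'n) func \<Rightarrow> bool" where
  "exact_functor A B F \<longleftrightarrow> is_functor A B F \<and>
     (\<forall>f g. short_exact A f g \<longrightarrow> short_exact B (FArr F f) (FArr F g))"

text \<open>Exactness of \<open>0 \<rightarrow> M' \<rightarrow> M \<rightarrow> M''\<close> says that the first map is a kernel of the second one.\<close>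

definition left_exact_functor ::
  "('o, 'm) cat \<Rightarrow> ('p, 'n) cat \<Rightarrow> ('o, 'm, 'p, 'n) func \<Rightarrow> bool" where
  "left_exact_functor A B F \<longleftrightarrow> is_functor A B F \<and>
     (\<forall>f g. is_kernel A g f \<longrightarrow> is_kernel B (FArr F g) (FArr F f))"


section \<open>Thick subcategories and Serre quotients\<close>

text \<open>A full subcategory is given by its set of objects.\<close>

definition thick :: "('o, 'm) cat \<Rightarrow> 'o set \<Rightarrow> bool" where
  "thick A C \<longleftrightarrow> C \<subseteq> Obj A \<and> C \<noteq> {} \<and>
     (\<forall>f g. short_exact A f g \<longrightarrow> (Cod A f \<in> C \<longleftrightarrow> Dom A f \<in> C \<and> Cod A g \<in> C))"

text \<open>The index category of the direct limit defining \<open>Hom(M, N)\<close> in the quotient: a subobject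
  \<open>M' \<le> M\<close> is represented by a mono \<open>i\<close> with codomain \<open>M\<close>, and a quotient \<open>N/N'\<close> by a cokernel \<open>p\<close>
  of a mono representing \<open>N' \<le> N\<close>.\<close>

definition sub_with_quot_in :: "('o, 'm) cat \<Rightarrow> 'o set \<Rightarrow> 'o \<Rightarrow> 'm \<Rightarrow> bool" where
  "sub_with_quot_in A C M i \<longleftrightarrow> mono_arr A i \<and> Cod A i = M \<and> (\<exists>c. is_cokernel A i c \<and> Cod A c \<in> C)"

definition quot_by_sub :: "('o, 'm) cat \<Rightarrow> 'o set \<Rightarrow> 'o \<Rightarrow> 'm \<Rightarrow> bool" where
  "quot_by_sub A C N p \<longleftrightarrow> Dom A p = N \<and> (\<exists>j. mono_arr A j \<and> Dom A j \<in> C \<and> is_cokernel A j p)"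

text \<open>A germ \<open>(i, p, f)\<close> is an element \<open>f\<close> of \<open>Hom(M', N/N')\<close> at the index \<open>(i, p)\<close>.\<close>

type_synonym 'm germ = "'m \<times> 'm \<times> 'm"

definition germs :: "('o, 'm) cat \<Rightarrow> 'o set \<Rightarrow> 'o \<Rightarrow> 'o \<Rightarrow> 'm germ set" where
  "germs A C M N = {(i, p, f).
     sub_with_quot_in A C M i \<and> quot_by_sub A C N p \<and> f \<in> Hom A (Dom A i) (Cod A p)}"

text \<open>Two germs represent the same element of the direct limit iff they have the same image at
  some common later index \<open>(i0, p0)\<close>.\<close>

definition germ_rel :: "('o, 'm) cat \<Rightarrow> 'o set \<Rightarrow> 'o \<Rightarrow> 'o \<Rightarrow> ('m germ \<times> 'm germ) set" where
  "germ_rel A C M N = {((i, p, f), (i', p', f')).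
     (i, p, f) \<in> germs A C M N \<and> (i', p', f') \<in> germs A C M N \<and>
     (\<exists>i0 p0. sub_with_quot_in A C M i0 \<and> quot_by_sub A C N p0 \<and>
        (\<exists>a \<in> Hom A (Dom A i0) (Dom A i). \<exists>a' \<in> Hom A (Dom A i0) (Dom A i').
         \<exists>b \<in> Hom A (Cod A p) (Cod A p0). \<exists>b' \<in> Hom A (Cod A p') (Cod A p0).
           i \<cdot>\<^bsub>A\<^esub> a = i0 \<and> i' \<cdot>\<^bsub>A\<^esub> a' = i0 \<and> b \<cdot>\<^bsub>A\<^esub> p = p0 \<and> b' \<cdot>\<^bsub>A\<^esub> p' = p0 \<and>
           b \<cdot>\<^bsub>A\<^esub> (f \<cdot>\<^bsub>A\<^esub> a) = b' \<cdot>\<^bsub>A\<^esub> (f' \<cdot>\<^bsub>A\<^esub> a')))}"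

definition germ_class :: "('o, 'm) cat \<Rightarrow> 'o set \<Rightarrow> 'o \<Rightarrow> 'o \<Rightarrow> 'm germ \<Rightarrow> 'm germ set" where
  "germ_class A C M N x = germ_rel A C M N `` {x}"

text \<open>Composition of classes \<open>K\<close> in \<open>Hom(M, N)\<close> and \<open>K'\<close> in \<open>Hom(N, L)\<close>. Let \<open>f : M' \<rightarrow> N/N'\<close> and
  \<open>g : N'' \<rightarrow> L/L'\<close> be representatives and let \<open>W = (N'' + N')/N' \<cong> N''/(N'' \<inter> N')\<close> be the image of
  \<open>N'' \<rightarrow> N \<rightarrow> N/N'\<close>, with epi \<open>e\<close> and mono \<open>m\<close>. After shrinking \<open>M'\<close> and enlarging \<open>L'\<close> one may
  assume that \<open>f\<close> factors as \<open>m f1\<close> and \<open>g\<close> as \<open>g1 e\<close>; the composite is then the class of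
  \<open>g1 f1 : M' \<rightarrow> L/L'\<close>. The union below ranges over all such choices, all giving the same class.\<close>

definition germ_comp ::
  "('o, 'm) cat \<Rightarrow> 'o set \<Rightarrow> 'o \<Rightarrow> 'o \<Rightarrow> 'm germ set \<Rightarrow> 'm germ set \<Rightarrow> 'm germ set" where
  "germ_comp A C M L K' K = \<Union> {germ_class A C M L (i, q, g1 \<cdot>\<^bsub>A\<^esub> f1) | i p f j q g e m f1 g1.
     (i, p, f) \<in> K \<and> (j, q, g) \<in> K' \<and>
     epi_arr A e \<and> mono_arr A m \<and> Cod A e = Dom A m \<and> Dom A e = Dom A j \<and> Cod A m = Cod A p \<and>
     m \<cdot>\<^bsub>A\<^esub> e = p \<cdot>\<^bsub>A\<^esub> j \<and>
     f1 \<in> Hom A (Dom A i) (Dom A m) \<and> m \<cdot>\<^bsub>A\<^esub> f1 = f \<and>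
     g1 \<in> Hom A (Cod A e) (Cod A q) \<and> g1 \<cdot>\<^bsub>A\<^esub> e = g}"

text \<open>An arrow of the quotient is a class tagged with its source and target.\<close>

type_synonym ('o, 'm) quot_arr = "'o \<times> 'o \<times> 'm germ set"

definition canonical_arr :: "('o, 'm) cat \<Rightarrow> 'o set \<Rightarrow> 'm \<Rightarrow> ('o, 'm) quot_arr" where
  "canonical_arr A C f = (Dom A f, Cod A f,
     germ_class A C (Dom A f) (Cod A f) (Idn A (Dom A f), Idn A (Cod A f), f))"

definition serre_quotient :: "('o, 'm) cat \<Rightarrow> 'o set \<Rightarrow> ('o, ('o, 'm) quot_arr) cat" where
  "serre_quotient A C =
     \<lparr>Obj = Obj A,
      Arr = {(M, N, K). M \<in> Obj A \<and> N \<in> Obj A \<and> K \<in> germs A C M N // germ_rel A C M N},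
      Dom = (\<lambda>(M, N, K). M),
      Cod = (\<lambda>(M, N, K). N),
      Idn = (\<lambda>M. canonical_arr A C (Idn A M)),
      Comp = (\<lambda>(N', L, K') (M, N, K). (M, L, germ_comp A C M L K' K))\<rparr>"

definition canonical_functor ::
  "('o, 'm) cat \<Rightarrow> 'o set \<Rightarrow> ('o, 'm, 'o, ('o, 'm) quot_arr) func" where
  "canonical_functor A C = \<lparr>FObj = id, FArr = canonical_arr A C\<rparr>"

definition localizing :: "('o, 'm) cat \<Rightarrow> 'o set \<Rightarrow> bool" where
  "localizing A C \<longleftrightarrow> thick A C \<and>
     (\<exists>S \<eta> \<delta>. adjunction A (serre_quotient A C) (canonical_functor A C) S \<eta> \<delta>)"

definition saturated :: "('o, 'm) cat \<Rightarrow> 'o set \<Rightarrow> 'o \<Rightarrow> bool" where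
  "saturated A C M \<longleftrightarrow> M \<in> Obj A \<and>
     (\<forall>i. mono_arr A i \<longrightarrow> Cod A i = M \<longrightarrow> Dom A i \<in> C \<longrightarrow> zero_obj A (Dom A i)) \<and>
     (\<forall>f g. short_exact A f g \<longrightarrow> Dom A f = M \<longrightarrow> Cod A g \<in> C \<longrightarrow> splits A g)"

definition Sat :: "('o, 'm) cat \<Rightarrow> 'o set \<Rightarrow> ('o, 'm) cat" where
  "Sat A C = full_subcategory A {M. saturated A C M}"

end

theory Submission
  imports Defs
begin

text \<open>The quotient functor \<open>Q\<close> inverts monomorphisms with cokernel in \<open>C\<close> and epimorphisms with kernel in
  \<open>C\<close>, and every arrow of \<open>A/C\<close> is a right fraction of images of arrows of \<open>A\<close>. Hence \<open>Q \<eta>\<close> is natural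
  on \<open>A/C\<close>, and the triangle identities make it inverse to the counit \<open>\<delta>\<close>; fractions also show that
  \<open>Q\<close> preserves kernels. A category reflected in an abelian category by a kernel-preserving left
  adjoint with invertible counit is abelian; this applies to \<open>A/C\<close> and to every full subcategory
  between the image of \<open>S\<close> and the objects with invertible unit. For saturated \<open>M\<close> the kernel and the
  cokernel of \<open>\<eta> M\<close> lie in \<open>C\<close>; the first vanishes because \<open>M\<close> is torsion-free, the second because
  the splitting of \<open>M \<rightarrow> S M \<rightarrow> Coker\<close> embeds it into the torsion-free object \<open>S M\<close>.\<close>

section \<open>Categories\<close>

text \<open>Composition in the quotient is a union over all admissible choices of representatives,
  so associativity and well-definedness are awkward to reach from germs. Both come with the
  adjunction: \<open>is_functor\<close> contains the category axioms for
  \<open>serre_quotient A C\<close>, and once the union is known to be an arrow, any single choice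
  computes it. The additive structure of A/C is likewise not built from germs: since S is fully
  faithful, it is pulled back from the Hom groups of A, and the same argument serves Sat. The
  exactness property that needs real work with germs is preservation of kernels, because cokernels
  are preserved by every left adjoint. For Sat it is inherited: Q sends kernels of A to kernels of
  A/C, and S, as right adjoint of the restricted Q, sends those to kernels formed in Sat.\<close>

lemma HomD:
  assumes "f \<in> Hom A X Y"
  shows "f \<in> Arr A" "Dom A f = X" "Cod A f = Y"
  using assms by (auto simp: Hom_def)

lemma Hom_self: "f \<in> Arr A \<Longrightarrow> f \<in> Hom A (Dom A f) (Cod A f)"
  by (simp add: Hom_def)

context
  fixes A :: "('o, 'm) cat" (structure)
  assumes cat: "category A"
begin

lemma Dom_in_Obj [simp]: "f \<in> Arr A \<Longrightarrow> Dom A f \<in> Obj A"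
  and Cod_in_Obj [simp]: "f \<in> Arr A \<Longrightarrow> Cod A f \<in> Obj A"
  and Idn_Hom: "X \<in> Obj A \<Longrightarrow> Idn A X \<in> Hom A X X"
  using cat by (auto simp: category_def)

lemma Idn_simps [simp]:
  assumes "X \<in> Obj A"
  shows "Idn A X \<in> Arr A" "Dom A (Idn A X) = X" "Cod A (Idn A X) = X"
  using Idn_Hom[OF assms] by (auto simp: Hom_def)

lemma Comp_simps [simp]:
  assumes "f \<in> Arr A" "g \<in> Arr A" "Cod A f = Dom A g"
  shows "g \<cdot> f \<in> Arr A" "Dom A (g \<cdot> f) = Dom A f" "Cod A (g \<cdot> f) = Cod A g"
  using cat assms by (auto simp: category_def Hom_def)

lemma Comp_Hom: "f \<in> Hom A X Y \<Longrightarrow> g \<in> Hom A Y Z \<Longrightarrow> g \<cdot> f \<in> Hom A X Z"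
  by (auto simp: Hom_def)

lemma Comp_Idn [simp]: "f \<in> Arr A \<Longrightarrow> Dom A f = X \<Longrightarrow> f \<cdot> Idn A X = f"
  and Idn_Comp [simp]: "f \<in> Arr A \<Longrightarrow> Cod A f = X \<Longrightarrow> Idn A X \<cdot> f = f"
  using cat by (auto simp: category_def)

lemma Comp_assoc [simp]:
  assumes "f \<in> Arr A" "g \<in> Arr A" "h \<in> Arr A" "Cod A f = Dom A g" "Cod A g = Dom A h"
  shows "(h \<cdot> g) \<cdot> f = h \<cdot> (g \<cdot> f)"
  using cat assms by (auto simp: category_def)

text \<open>The simplifier nests composites to the right, which hides a factor
  \<open>g \<cdot> f\<close> as soon as something precedes it. This is the form of an equation
  \<open>g \<cdot> f = h\<close> that still matches there.\<close>

lemma Comp_reassoc: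
  assumes "g \<cdot> f = h" "f \<in> Arr A" "g \<in> Arr A" "Cod A f = Dom A g" "x \<in> Arr A" "Cod A x = Dom A f"
  shows "g \<cdot> (f \<cdot> x) = h \<cdot> x"
  using assms by (metis Comp_assoc)

lemma Hom_in_Obj:
  assumes "f \<in> Hom A X Y"
  shows "X \<in> Obj A" "Y \<in> Obj A"
  using assms by (auto simp: Hom_def)

end

text \<open>A total choice function, so that the inverses of a natural isomorphism form a family of
  arrows, such as the counit built later from inverse units.\<close>

definition inv_arr :: "('o, 'm) cat \<Rightarrow> 'm \<Rightarrow> 'm" where
  "inv_arr A f = (SOME g. g \<in> Hom A (Cod A f) (Dom A f) \<and>
     g \<cdot>\<^bsub>A\<^esub> f = Idn A (Dom A f) \<and> f \<cdot>\<^bsub>A\<^esub> g = Idn A (Cod A f))"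

lemma inv_arr:
  assumes "iso_arr A f"
  shows "f \<in> Arr A" "inv_arr A f \<in> Arr A" "Dom A (inv_arr A f) = Cod A f" "Cod A (inv_arr A f) = Dom A f"
    "inv_arr A f \<cdot>\<^bsub>A\<^esub> f = Idn A (Dom A f)" "f \<cdot>\<^bsub>A\<^esub> inv_arr A f = Idn A (Cod A f)"
proof -
  have "\<exists>g. g \<in> Hom A (Cod A f) (Dom A f) \<and>
     g \<cdot>\<^bsub>A\<^esub> f = Idn A (Dom A f) \<and> f \<cdot>\<^bsub>A\<^esub> g = Idn A (Cod A f)"
    using assms by (auto simp: iso_arr_def)
  from someI_ex[OF this] show "inv_arr A f \<in> Arr A" "Dom A (inv_arr A f) = Cod A f" 
    "Cod A (inv_arr A f) = Dom A f"
    "inv_arr A f \<cdot>\<^bsub>A\<^esub> f = Idn A (Dom A f)" "f \<cdot>\<^bsub>A\<^esub> inv_arr A f = Idn A (Cod A f)"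
    unfolding inv_arr_def by (auto simp: Hom_def)
  show "f \<in> Arr A" using assms by (simp add: iso_arr_def)
qed

lemma iso_arrI:
  assumes "f \<in> Hom A X Y" "g \<in> Hom A Y X" "g \<cdot>\<^bsub>A\<^esub> f = Idn A X" "f \<cdot>\<^bsub>A\<^esub> g = Idn A Y"
  shows "iso_arr A f"
  using assms by (auto simp: iso_arr_def Hom_def)

lemma inv_arr_eqI:
  assumes "category A" "f \<in> Hom A X Y" "g \<in> Hom A Y X" "g \<cdot>\<^bsub>A\<^esub> f = Idn A X" "f \<cdot>\<^bsub>A\<^esub> g = Idn A Y"
  shows "inv_arr A f = g"
proof -
  note [simp] = HomD[OF assms(2)] HomD[OF assms(3)] assms(1)
  note i [simp] = inv_arr[OF iso_arrI[OF assms(2-5)]]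
  have "inv_arr A f = (inv_arr A f \<cdot>\<^bsub>A\<^esub> f) \<cdot>\<^bsub>A\<^esub> g"
    using assms(1,5) by (simp del: i(5) add: assms(5))
  then show ?thesis using Hom_in_Obj[OF assms(1,2)] by simp
qed

lemma iso_arr_Idn: "category A \<Longrightarrow> X \<in> Obj A \<Longrightarrow> iso_arr A (Idn A X)"
  by (auto intro!: iso_arrI[where g = "Idn A X"] Idn_Hom)

lemma iso_arr_inv: "category A \<Longrightarrow> iso_arr A f \<Longrightarrow> iso_arr A (inv_arr A f)"
  using inv_arr[of A f] by (intro iso_arrI[of _ _ "Cod A f" "Dom A f" f]) (auto simp: Hom_def)

lemma iso_arr_Comp:
  assumes "category A" "iso_arr A f" "iso_arr A g" "Cod A f = Dom A g"
  shows "iso_arr A (g \<cdot>\<^bsub>A\<^esub> f)"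
proof -
  note [simp] = assms inv_arr[OF assms(2)] inv_arr[OF assms(3)]
  note r [simp] = Comp_reassoc[OF assms(1) inv_arr(5)[OF assms(3)]] Comp_reassoc[OF assms(1) inv_arr(6)[OF assms(2)]]
  show ?thesis
    by (rule iso_arrI[of _ _ "Dom A f" "Cod A g" "inv_arr A f \<cdot>\<^bsub>A\<^esub> inv_arr A g"])
       (simp_all add: Hom_def)
qed

section \<open>Monomorphisms and epimorphisms\<close>

lemma mono_arrD:
  assumes "mono_arr A f" "g \<in> Hom A X (Dom A f)" "h \<in> Hom A X (Dom A f)" "f \<cdot>\<^bsub>A\<^esub> g = f \<cdot>\<^bsub>A\<^esub> h"
  shows "g = h"
  using assms by (auto simp: mono_arr_def Hom_def)

lemma mono_arrI:
  assumes "f \<in> Hom A X Y"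
    "\<And>T g h. g \<in> Hom A T X \<Longrightarrow> h \<in> Hom A T X \<Longrightarrow> f \<cdot>\<^bsub>A\<^esub> g = f \<cdot>\<^bsub>A\<^esub> h \<Longrightarrow> g = h"
  shows "mono_arr A f"
  using assms by (auto simp: mono_arr_def Hom_def)

lemma epi_arrD:
  assumes "epi_arr A f" "g \<in> Hom A (Cod A f) X" "h \<in> Hom A (Cod A f) X" "g \<cdot>\<^bsub>A\<^esub> f = h \<cdot>\<^bsub>A\<^esub> f"
  shows "g = h"
  using assms by (auto simp: epi_arr_def Hom_def)

lemma split_mono:
  assumes "category A" "f \<in> Hom A X Y" "r \<in> Hom A Y X" "r \<cdot>\<^bsub>A\<^esub> f = Idn A X"
  shows "mono_arr A f"
proof (rule mono_arrI[OF assms(2)])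
  fix T g h assume g: "g \<in> Hom A T X" and h: "h \<in> Hom A T X" and e: "f \<cdot>\<^bsub>A\<^esub> g = f \<cdot>\<^bsub>A\<^esub> h"
  have "(r \<cdot>\<^bsub>A\<^esub> f) \<cdot>\<^bsub>A\<^esub> g = (r \<cdot>\<^bsub>A\<^esub> f) \<cdot>\<^bsub>A\<^esub> h"
    using assms(1) HomD[OF g] HomD[OF h] HomD[OF assms(2)] HomD[OF assms(3)] e by simp
  then show "g = h" using assms(1,4) HomD[OF g] HomD[OF h] by simp
qed

lemma iso_mono: "category A \<Longrightarrow> iso_arr A f \<Longrightarrow> mono_arr A f"
  using inv_arr[of A f] by (intro split_mono[of A f "Dom A f" "Cod A f" "inv_arr A f"]) (auto simp: Hom_def)

lemma mono_arr_Comp: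
  assumes "category A" "mono_arr A f" "mono_arr A g" "Cod A f = Dom A g"
  shows "mono_arr A (g \<cdot>\<^bsub>A\<^esub> f)"
  using assms unfolding mono_arr_def by auto

lemma mono_arr_right:
  assumes "category A" "mono_arr A (g \<cdot>\<^bsub>A\<^esub> f)" "f \<in> Hom A X Y" "g \<in> Hom A Y Z"
  shows "mono_arr A f"
proof (rule mono_arrI[OF assms(3)])
  note [simp] = assms(1) HomD[OF assms(3)] HomD[OF assms(4)]
  fix T x y assume x: "x \<in> Hom A T X" and y: "y \<in> Hom A T X" and e: "f \<cdot>\<^bsub>A\<^esub> x = f \<cdot>\<^bsub>A\<^esub> y"
  note [simp] = HomD[OF x] HomD[OF y]
  show "x = y" using x y e by - (rule mono_arrD[OF assms(2), of _ T], auto)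
qed


section \<open>The opposite category\<close>

text \<open>Carries the duality arguments: facts on epis, cokernels and quotients are those on
  monos, kernels and subobjects read here. Functor data name no source or target, so a functor is
  its own opposite.\<close>

definition opcat :: "('o, 'm) cat \<Rightarrow> ('o, 'm) cat" where
  "opcat A = \<lparr>Obj = Obj A, Arr = Arr A, Dom = Cod A, Cod = Dom A, Idn = Idn A, Comp = (\<lambda>g f. f \<cdot>\<^bsub>A\<^esub> g)\<rparr>"

lemma opcat_simps [simp]:
  "Obj (opcat A) = Obj A" "Arr (opcat A) = Arr A" "Dom (opcat A) = Cod A" "Cod (opcat A) = Dom A"
  "Idn (opcat A) = Idn A" "g \<cdot>\<^bsub>opcat A\<^esub> f = f \<cdot>\<^bsub>A\<^esub> g" "Hom (opcat A) X Y = Hom A Y X"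
  by (auto simp: opcat_def Hom_def)

lemma category_opcat [simp]: "category A \<Longrightarrow> category (opcat A)"
  unfolding category_def[of "opcat A"] by (simp add: Hom_def)

lemma mono_arr_opcat [simp]: "mono_arr (opcat A) f \<longleftrightarrow> epi_arr A f"
  and epi_arr_opcat [simp]: "epi_arr (opcat A) f \<longleftrightarrow> mono_arr A f"
  and iso_arr_opcat [simp]: "iso_arr (opcat A) f \<longleftrightarrow> iso_arr A f"
  by (auto simp: mono_arr_def epi_arr_def iso_arr_def)

lemma zero_obj_opcat [simp]: "zero_obj (opcat A) Z \<longleftrightarrow> zero_obj A Z"
  by (auto simp: zero_obj_def)

lemma zero_arr_opcat [simp]: "zero_arr (opcat A) f \<longleftrightarrow> zero_arr A f"
  by (auto simp: zero_arr_def)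

lemma is_kernel_opcat [simp]: "is_kernel (opcat A) f k \<longleftrightarrow> is_cokernel A f k"
  and is_cokernel_opcat [simp]: "is_cokernel (opcat A) f k \<longleftrightarrow> is_kernel A f k"
  by (auto simp: is_kernel_def is_cokernel_def)

lemma iso_epi: "category A \<Longrightarrow> iso_arr A f \<Longrightarrow> epi_arr A f"
  using iso_mono[of "opcat A" f] by simp

section \<open>Zero arrows\<close>

definition pointed :: "('o, 'm) cat \<Rightarrow> bool" where
  "pointed A \<longleftrightarrow> category A \<and> (\<exists>Z. zero_obj A Z)"

lemma pointed_category [simp]: "pointed A \<Longrightarrow> category A"
  by (simp add: pointed_def)

lemma pointed_opcat [simp]: "pointed A \<Longrightarrow> pointed (opcat A)"
  by (auto simp: pointed_def)

lemma zero_obj_ex: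
  assumes "zero_obj A Z" "X \<in> Obj A"
  obtains g h where "g \<in> Hom A X Z" "h \<in> Hom A Z X"
  using assms unfolding zero_obj_def by blast

lemma zero_obj_unique:
  assumes "zero_obj A Z" "X \<in> Obj A"
  shows "f \<in> Hom A X Z \<Longrightarrow> g \<in> Hom A X Z \<Longrightarrow> f = g" "f \<in> Hom A Z X \<Longrightarrow> g \<in> Hom A Z X \<Longrightarrow> f = g"
  using assms unfolding zero_obj_def by blast+

lemma zero_arrE:
  assumes "category A" "zero_arr A f"
  obtains Z g h where "zero_obj A Z" "g \<in> Hom A (Dom A f) Z" "h \<in> Hom A Z (Cod A f)" "f = h \<cdot>\<^bsub>A\<^esub> g"
    "f \<in> Arr A"
proof -
  obtain Z g h where 1: "zero_obj A Z" "g \<in> Hom A (Dom A f) Z" "h \<in> Hom A Z (Cod A f)" "f = h \<cdot>\<^bsub>A\<^esub> g"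
    using assms(2) unfolding zero_arr_def by blast
  have "h \<cdot>\<^bsub>A\<^esub> g \<in> Arr A" using HomD(1)[OF Comp_Hom[OF assms(1) 1(2,3)]] .
  then show thesis using 1 that by metis
qed

text \<open>The two arrows may factor through different zero objects; the arrow \<open>t\<close>
  between these identifies the factorizations.\<close>

lemma zero_arr_unique:
  assumes "category A" "zero_arr A f" "zero_arr A f'" "Dom A f = Dom A f'" "Cod A f = Cod A f'"
  shows "f = f'"
proof -
  obtain Z g h where 1: "zero_obj A Z" "g \<in> Hom A (Dom A f) Z" "h \<in> Hom A Z (Cod A f)" "f = h \<cdot>\<^bsub>A\<^esub> g" "f \<in> Arr A"
    by (rule zero_arrE[OF assms(1,2)])
  obtain Z' g' h' where 2: "zero_obj A Z'" "g' \<in> Hom A (Dom A f') Z'" "h' \<in> Hom A Z' (Cod A f')" "f' = h' \<cdot>\<^bsub>A\<^esub> g'" "f' \<in> Arr A"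
    by (rule zero_arrE[OF assms(1,3)])
  have o: "Dom A f \<in> Obj A" "Cod A f \<in> Obj A" using 1(5) assms(1) by simp_all
  have "Z \<in> Obj A" using 1(1) by (simp add: zero_obj_def)
  then obtain t where t: "t \<in> Hom A Z Z'" by (rule zero_obj_ex[OF 2(1)])
  have a: "t \<cdot>\<^bsub>A\<^esub> g = g'"
    by (rule zero_obj_unique(1)[OF 2(1) _ Comp_Hom[OF assms(1) 1(2) t]]) (use o 2(2) assms(4) in auto)
  have b: "h' \<cdot>\<^bsub>A\<^esub> t = h"
    by (rule zero_obj_unique(2)[OF 1(1) _ Comp_Hom[OF assms(1) t 2(3)]]) (use o 1(3) assms(5) in auto)
  show ?thesis unfolding 1(4) 2(4) a[symmetric] b[symmetric]
    using HomD[OF t] HomD[OF 1(2)] HomD[OF 2(3)] assms(1) by simp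
qed

lemma zero_arr_Comp_left:
  assumes "category A" "zero_arr A f" "g \<in> Arr A" "Cod A f = Dom A g"
  shows "zero_arr A (g \<cdot>\<^bsub>A\<^esub> f)"
proof -
  obtain Z u h where 1: "zero_obj A Z" "u \<in> Hom A (Dom A f) Z" "h \<in> Hom A Z (Cod A f)" "f = h \<cdot>\<^bsub>A\<^esub> u" "f \<in> Arr A"
    by (rule zero_arrE[OF assms(1,2)])
  note [simp] = assms HomD[OF 1(2)] HomD[OF 1(3)] 1(5)
  have "g \<cdot>\<^bsub>A\<^esub> h \<in> Hom A Z (Cod A g)" by (simp add: Hom_def)
  moreover have "g \<cdot>\<^bsub>A\<^esub> f = (g \<cdot>\<^bsub>A\<^esub> h) \<cdot>\<^bsub>A\<^esub> u" by (subst 1(4)) simp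
  moreover have "Dom A (g \<cdot>\<^bsub>A\<^esub> f) = Dom A f" "Cod A (g \<cdot>\<^bsub>A\<^esub> f) = Cod A g" by simp_all
  ultimately show ?thesis using 1(1,2) unfolding zero_arr_def by metis
qed

lemma zero_arr_Comp_right:
  assumes "category A" "zero_arr A f" "g \<in> Arr A" "Cod A g = Dom A f"
  shows "zero_arr A (f \<cdot>\<^bsub>A\<^esub> g)"
  using zero_arr_Comp_left[of "opcat A" f g] assms by simp

text \<open>Depends on the category alone and not on an addition, so it is available in the quotient
  before any Hom group is known there.\<close>

definition zr :: "('o, 'm) cat \<Rightarrow> 'o \<Rightarrow> 'o \<Rightarrow> 'm" where
  "zr A X Y = (THE f. f \<in> Hom A X Y \<and> zero_arr A f)"

context
  fixes A :: "('o, 'm) cat" (structure)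
  assumes p: "pointed A"
begin

lemma zr_ex1:
  assumes "X \<in> Obj A" "Y \<in> Obj A"
  shows "\<exists>!f. f \<in> Hom A X Y \<and> zero_arr A f"
proof (rule ex_ex1I)
  note [simp] = p
  obtain Z where Z: "zero_obj A Z" using p by (auto simp: pointed_def)
  then obtain g h where g: "g \<in> Hom A X Z" and h: "h \<in> Hom A Z Y"
    using assms zero_obj_ex by metis
  have e: "h \<cdot> g \<in> Hom A X Y" using g h by (auto intro: Comp_Hom)
  show "\<exists>f. f \<in> Hom A X Y \<and> zero_arr A f"
    using HomD[OF e] Z g h e unfolding zero_arr_def by blast
next
  fix f g assume "f \<in> Hom A X Y \<and> zero_arr A f" "g \<in> Hom A X Y \<and> zero_arr A g"
  then show "f = g" using zero_arr_unique[OF pointed_category[OF p]] by (simp add: Hom_def)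
qed

lemma zr_Hom: "X \<in> Obj A \<Longrightarrow> Y \<in> Obj A \<Longrightarrow> zr A X Y \<in> Hom A X Y"
  and zero_arr_zr [simp]: "X \<in> Obj A \<Longrightarrow> Y \<in> Obj A \<Longrightarrow> zero_arr A (zr A X Y)"
  using theI'[OF zr_ex1] unfolding zr_def by auto

lemma zr_simps [simp]:
  assumes "X \<in> Obj A" "Y \<in> Obj A"
  shows "zr A X Y \<in> Arr A" "Dom A (zr A X Y) = X" "Cod A (zr A X Y) = Y"
  using zr_Hom[OF assms] by (auto simp: Hom_def)

lemma zero_arr_iff: "f \<in> Arr A \<Longrightarrow> zero_arr A f \<longleftrightarrow> f = zr A (Dom A f) (Cod A f)"
  using p by (metis Cod_in_Obj Dom_in_Obj pointed_category zero_arr_unique zero_arr_zr zr_simps(2,3))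

lemma Comp_zr [simp]: "f \<in> Arr A \<Longrightarrow> Dom A f = Y \<Longrightarrow> X \<in> Obj A \<Longrightarrow> f \<cdot> zr A X Y = zr A X (Cod A f)"
  using p zero_arr_iff[of "f \<cdot> zr A X Y"] zero_arr_Comp_left[of A "zr A X Y" f]
  by auto

lemma zr_Comp [simp]: "f \<in> Arr A \<Longrightarrow> Cod A f = X \<Longrightarrow> Y \<in> Obj A \<Longrightarrow> zr A X Y \<cdot> f = zr A (Dom A f) Y"
  using p zero_arr_iff[of "zr A X Y \<cdot> f"] zero_arr_Comp_right[of A "zr A X Y" f]
  by auto

lemma zero_obj_Hom_eq:
  assumes "zero_obj A Z"
  shows "f \<in> Hom A X Z \<Longrightarrow> f = zr A X Z" "f \<in> Hom A Z X \<Longrightarrow> f = zr A Z X"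
  using zero_obj_unique[OF assms] Hom_in_Obj[OF pointed_category[OF p]] zr_Hom by metis+

lemma zero_obj_iff: "zero_obj A X \<longleftrightarrow> X \<in> Obj A \<and> Idn A X = zr A X X"
proof
  assume z: "zero_obj A X"
  then have X: "X \<in> Obj A" by (simp add: zero_obj_def)
  show "X \<in> Obj A \<and> Idn A X = zr A X X"
    using X zero_obj_Hom_eq(1)[OF z Idn_Hom] p by simp
next
  assume a: "X \<in> Obj A \<and> Idn A X = zr A X X"
  have "f = zr A Y X" if "f \<in> Hom A Y X" for f Y
  proof -
    have "f = Idn A X \<cdot> f" using HomD[OF that] p by simp
    also have "\<dots> = zr A Y X" using HomD[OF that] a p by (simp del: Idn_Comp)
    finally show ?thesis .
  qed
  moreover have "f = zr A X Y" if "f \<in> Hom A X Y" for f Y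
  proof -
    have "f = f \<cdot> Idn A X" using HomD[OF that] p by simp
    also have "\<dots> = zr A X Y" using HomD[OF that] a p by (simp del: Comp_Idn)
    finally show ?thesis .
  qed
  ultimately show "zero_obj A X" using a zr_Hom unfolding zero_obj_def by blast
qed

end

lemma zr_opcat [simp]: "zr (opcat A) X Y = zr A Y X"
  by (simp add: zr_def)

text \<open>A single endomorphism forces the identity to be the zero arrow, which characterizes zero
  objects.\<close>

lemma terminal_zero_obj:
  assumes "pointed A" "T \<in> Obj A" "\<And>f g. f \<in> Hom A T T \<Longrightarrow> g \<in> Hom A T T \<Longrightarrow> f = g"
  shows "zero_obj A T"
  unfolding zero_obj_iff[OF assms(1)]
  using assms(2) assms(3)[OF Idn_Hom[OF pointed_category[OF assms(1)]] zr_Hom[OF assms(1)]] by blast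


section \<open>Kernels and cokernels\<close>

lemma kernelD:
  assumes "is_kernel A f k"
  shows "f \<in> Arr A" "k \<in> Arr A" "Cod A k = Dom A f" "zero_arr A (f \<cdot>\<^bsub>A\<^esub> k)"
  using assms by (auto simp: is_kernel_def)

lemma kernel_factor:
  assumes "is_kernel A f k" "h \<in> Hom A X (Dom A f)" "zero_arr A (f \<cdot>\<^bsub>A\<^esub> h)"
  obtains u where "u \<in> Hom A X (Dom A k)" "k \<cdot>\<^bsub>A\<^esub> u = h"
proof -
  have "\<exists>!u. u \<in> Hom A (Dom A h) (Dom A k) \<and> k \<cdot>\<^bsub>A\<^esub> u = h"
    using assms HomD[OF assms(2)] unfolding is_kernel_def by blast
  then show thesis using that HomD[OF assms(2)] by blast
qed

lemma kernel_mono: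
  assumes "category A" "is_kernel A f k"
  shows "mono_arr A k"
proof (rule mono_arrI)
  note k [simp] = kernelD[OF assms(2)] assms(1)
  show "k \<in> Hom A (Dom A k) (Dom A f)" by (simp add: Hom_def)
  fix T g h assume g: "g \<in> Hom A T (Dom A k)" and h: "h \<in> Hom A T (Dom A k)" and e: "k \<cdot>\<^bsub>A\<^esub> g = k \<cdot>\<^bsub>A\<^esub> h"
  note [simp] = HomD[OF g] HomD[OF h]
  have "zero_arr A (f \<cdot>\<^bsub>A\<^esub> (k \<cdot>\<^bsub>A\<^esub> g))"
    using zero_arr_Comp_right[OF assms(1) k(4), of g] by simp
  moreover have "k \<cdot>\<^bsub>A\<^esub> g \<in> Arr A" "Cod A (k \<cdot>\<^bsub>A\<^esub> g) = Dom A f" "Dom A (k \<cdot>\<^bsub>A\<^esub> g) = T" by simp_all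
  ultimately have "\<exists>!u. u \<in> Hom A T (Dom A k) \<and> k \<cdot>\<^bsub>A\<^esub> u = k \<cdot>\<^bsub>A\<^esub> g"
    using assms(2) unfolding is_kernel_def by metis
  then show "g = h" using g h e by auto
qed

lemma is_kernelI:
  assumes "category A" "f \<in> Arr A" "mono_arr A k" "Cod A k = Dom A f" "zero_arr A (f \<cdot>\<^bsub>A\<^esub> k)"
    "\<And>X h. h \<in> Hom A X (Dom A f) \<Longrightarrow> zero_arr A (f \<cdot>\<^bsub>A\<^esub> h) \<Longrightarrow> \<exists>u \<in> Hom A X (Dom A k). k \<cdot>\<^bsub>A\<^esub> u = h"
  shows "is_kernel A f k"
  unfolding is_kernel_def
proof (intro conjI ballI impI)
  show "k \<in> Arr A" using assms(3) by (simp add: mono_arr_def)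
  fix h assume h: "h \<in> Arr A" "Cod A h = Dom A f" "zero_arr A (f \<cdot>\<^bsub>A\<^esub> h)"
  then have "h \<in> Hom A (Dom A h) (Dom A f)" by (simp add: Hom_def)
  from assms(6)[OF this h(3)] obtain u where "u \<in> Hom A (Dom A h) (Dom A k) \<and> k \<cdot>\<^bsub>A\<^esub> u = h" by blast
  then show "\<exists>!u. u \<in> Hom A (Dom A h) (Dom A k) \<and> k \<cdot>\<^bsub>A\<^esub> u = h"
    using mono_arrD[OF assms(3)] by (intro ex1I) auto
qed (use assms in auto)

lemma cokernelD:
  assumes "is_cokernel A f k"
  shows "f \<in> Arr A" "k \<in> Arr A" "Dom A k = Cod A f" "zero_arr A (k \<cdot>\<^bsub>A\<^esub> f)"
  using assms by (auto simp: is_cokernel_def)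

lemma cokernel_epi: "category A \<Longrightarrow> is_cokernel A f k \<Longrightarrow> epi_arr A k"
  using kernel_mono[of "opcat A" f k] by simp

text \<open>The identity is killed by \<open>f\<close>, so it factors through \<open>k\<close>; a
  mono with a right inverse is invertible.\<close>

lemma zero_kernel_iso:
  assumes "category A" "is_kernel A f k" "zero_arr A f"
  shows "iso_arr A k"
proof -
  note [simp] = assms(1) kernelD[OF assms(2)]
  obtain u where u: "u \<in> Hom A (Dom A f) (Dom A k)" "k \<cdot>\<^bsub>A\<^esub> u = Idn A (Dom A f)"
    using kernel_factor[OF assms(2), of "Idn A (Dom A f)" "Dom A f"] assms(3) by (auto simp: Hom_def)
  note [simp] = HomD[OF u(1)] u(2)
  have "u \<cdot>\<^bsub>A\<^esub> k = Idn A (Dom A k)"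
    by (rule mono_arrD[OF kernel_mono[OF assms(1,2)], of _ "Dom A k"])
       (auto simp: Hom_def Comp_reassoc[OF assms(1) u(2)])
  then show ?thesis using u by (intro iso_arrI[of k A "Dom A k" "Dom A f" u]) (auto simp: Hom_def)
qed

text \<open>Moves a kernel along a commuting square. The arrow \<beta> only has to reflect zero, for
  which monicity suffices; \<gamma> allows the source of the kernel to be replaced by an isomorphic
  object.\<close>

lemma kernel_transport:
  assumes "category A" "is_kernel A f k" "f' \<in> Arr A" "iso_arr A \<alpha>" "mono_arr A \<beta>" "iso_arr A \<gamma>"
    "Dom A \<alpha> = Dom A f" "Cod A \<alpha> = Dom A f'" "Dom A \<beta> = Cod A f" "Cod A \<beta> = Cod A f'"
    "Cod A \<gamma> = Dom A k" "f' \<cdot>\<^bsub>A\<^esub> \<alpha> = \<beta> \<cdot>\<^bsub>A\<^esub> f" "k' = \<alpha> \<cdot>\<^bsub>A\<^esub> (k \<cdot>\<^bsub>A\<^esub> \<gamma>)"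
  shows "is_kernel A f' k'"
proof (rule is_kernelI)
  note k [simp] = kernelD[OF assms(2)] assms(1,3) inv_arr[OF assms(4)] inv_arr[OF assms(6)] assms(7-11)
  have b [simp]: "\<beta> \<in> Arr A" using assms(5) by (simp add: mono_arr_def)
  have m: "mono_arr A k" by (rule kernel_mono[OF assms(1,2)])
  have "mono_arr A (k \<cdot>\<^bsub>A\<^esub> \<gamma>)" by (rule mono_arr_Comp) (use m assms(6) in \<open>auto intro: iso_mono\<close>)
  then show "mono_arr A k'" unfolding assms(13) by (rule mono_arr_Comp[OF assms(1)]) (use assms(4) in \<open>auto intro: iso_mono\<close>)
  show "Cod A k' = Dom A f'" by (simp add: assms(13))
  have e: "f' \<cdot>\<^bsub>A\<^esub> k' = \<beta> \<cdot>\<^bsub>A\<^esub> ((f \<cdot>\<^bsub>A\<^esub> k) \<cdot>\<^bsub>A\<^esub> \<gamma>)"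
    unfolding assms(13) using Comp_reassoc[OF assms(1,12)] by simp
  have "zero_arr A ((f \<cdot>\<^bsub>A\<^esub> k) \<cdot>\<^bsub>A\<^esub> \<gamma>)" by (rule zero_arr_Comp_right) (auto simp del: Comp_assoc)
  then show "zero_arr A (f' \<cdot>\<^bsub>A\<^esub> k')" unfolding e by - (rule zero_arr_Comp_left, auto)
  fix X h assume h: "h \<in> Hom A X (Dom A f')" and z: "zero_arr A (f' \<cdot>\<^bsub>A\<^esub> h)"
  note [simp] = HomD[OF h]
  have "f' \<cdot>\<^bsub>A\<^esub> h = f' \<cdot>\<^bsub>A\<^esub> (\<alpha> \<cdot>\<^bsub>A\<^esub> (inv_arr A \<alpha> \<cdot>\<^bsub>A\<^esub> h))"
    by (simp add: Comp_reassoc[OF assms(1) inv_arr(6)[OF assms(4)]])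
  also have "\<dots> = \<beta> \<cdot>\<^bsub>A\<^esub> (f \<cdot>\<^bsub>A\<^esub> (inv_arr A \<alpha> \<cdot>\<^bsub>A\<^esub> h))"
    using Comp_reassoc[OF assms(1,12)] by simp
  finally have z': "zero_arr A (\<beta> \<cdot>\<^bsub>A\<^esub> (f \<cdot>\<^bsub>A\<^esub> (inv_arr A \<alpha> \<cdot>\<^bsub>A\<^esub> h)))" using z by simp
  have d: "Dom A (\<beta> \<cdot>\<^bsub>A\<^esub> (f \<cdot>\<^bsub>A\<^esub> (inv_arr A \<alpha> \<cdot>\<^bsub>A\<^esub> h))) = X" by simp
  \<comment> \<open>No zero object is given beforehand. One is read off the vanishing composite and
    yields a zero arrow \<open>w \<cdot> u\<close> into \<open>Cod A f\<close>, against which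
    \<beta> can be cancelled.\<close>
  obtain Z u where Z: "zero_obj A Z" "u \<in> Hom A X Z"
    using zero_arrE[OF assms(1) z'] unfolding d by metis
  obtain w where w: "w \<in> Hom A Z (Cod A f)" by (rule zero_obj_ex[OF Z(1), of "Cod A f"]) auto
  have z2: "zero_arr A (w \<cdot>\<^bsub>A\<^esub> u)" using Z w Comp_Hom[OF assms(1) Z(2) w] by (auto simp: zero_arr_def Hom_def)
  have "\<beta> \<cdot>\<^bsub>A\<^esub> (f \<cdot>\<^bsub>A\<^esub> (inv_arr A \<alpha> \<cdot>\<^bsub>A\<^esub> h)) = \<beta> \<cdot>\<^bsub>A\<^esub> (w \<cdot>\<^bsub>A\<^esub> u)"
    by (rule zero_arr_unique[OF assms(1) z' zero_arr_Comp_left[OF assms(1) z2]])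
       (use HomD[OF w] HomD[OF Z(2)] in auto)
  then have "f \<cdot>\<^bsub>A\<^esub> (inv_arr A \<alpha> \<cdot>\<^bsub>A\<^esub> h) = w \<cdot>\<^bsub>A\<^esub> u"
    by (rule mono_arrD[OF assms(5), rotated 2]) (use HomD[OF w] HomD[OF Z(2)] in \<open>auto simp: Hom_def\<close>)
  then have "zero_arr A (f \<cdot>\<^bsub>A\<^esub> (inv_arr A \<alpha> \<cdot>\<^bsub>A\<^esub> h))" using z2 by simp
  then obtain t where t: "t \<in> Hom A X (Dom A k)" "k \<cdot>\<^bsub>A\<^esub> t = inv_arr A \<alpha> \<cdot>\<^bsub>A\<^esub> h"
    by (rule kernel_factor[OF assms(2), rotated]) (auto simp: Hom_def)
  note [simp] = HomD[OF t(1)] t(2)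
  have "k' \<cdot>\<^bsub>A\<^esub> (inv_arr A \<gamma> \<cdot>\<^bsub>A\<^esub> t) = h" unfolding assms(13)
    by (simp add: Comp_reassoc[OF assms(1) inv_arr(6)[OF assms(4)]]
        Comp_reassoc[OF assms(1) inv_arr(6)[OF assms(6)]])
  moreover have "inv_arr A \<gamma> \<cdot>\<^bsub>A\<^esub> t \<in> Hom A X (Dom A k')" by (simp add: Hom_def assms(13))
  ultimately show "\<exists>u\<in>Hom A X (Dom A k'). k' \<cdot>\<^bsub>A\<^esub> u = h" by blast
qed (use assms in auto)

lemma cokernel_transport:
  assumes "category A" "is_cokernel A f k" "f' \<in> Arr A" "iso_arr A \<alpha>" "epi_arr A \<beta>" "iso_arr A \<gamma>"
    "Cod A \<alpha> = Cod A f" "Dom A \<alpha> = Cod A f'" "Cod A \<beta> = Dom A f" "Dom A \<beta> = Dom A f'"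
    "Dom A \<gamma> = Cod A k" "\<alpha> \<cdot>\<^bsub>A\<^esub> f' = f \<cdot>\<^bsub>A\<^esub> \<beta>" "k' = \<gamma> \<cdot>\<^bsub>A\<^esub> (k \<cdot>\<^bsub>A\<^esub> \<alpha>)"
  shows "is_cokernel A f' k'"
proof -
  have "k' = (\<gamma> \<cdot>\<^bsub>A\<^esub> k) \<cdot>\<^bsub>A\<^esub> \<alpha>"
    unfolding assms(13) using assms cokernelD[OF assms(2)] inv_arr[OF assms(4)] inv_arr[OF assms(6)] by simp
  then show ?thesis
    using kernel_transport[of "opcat A" f k f' \<alpha> \<beta> \<gamma> k'] assms by simp
qed

section \<open>Additive and abelian categories\<close>

text \<open>\<open>preadditive\<close> merely asserts that a neutral element exists on each Hom set,
  hence the choice.\<close>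

definition hom_group :: "('o, 'm) cat \<Rightarrow> ('m \<Rightarrow> 'm \<Rightarrow> 'm) \<Rightarrow> 'o \<Rightarrow> 'o \<Rightarrow> 'm monoid" where
  "hom_group A add X Y = \<lparr>carrier = Hom A X Y, mult = add,
     one = (SOME z. comm_group \<lparr>carrier = Hom A X Y, mult = add, one = z\<rparr>)\<rparr>"

context
  fixes A :: "('o, 'm) cat" (structure) and add :: "'m \<Rightarrow> 'm \<Rightarrow> 'm"
  assumes pre: "preadditive A add"
begin

lemma preadditive_category [simp]: "category A"
  using pre by (simp add: preadditive_def)

lemma comm_group_Hom: "X \<in> Obj A \<Longrightarrow> Y \<in> Obj A \<Longrightarrow> comm_group (hom_group A add X Y)"
  using pre unfolding preadditive_def hom_group_def by (metis (mono_tags, lifting) someI_ex)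

lemma hom_group_simps [simp]: "carrier (hom_group A add X Y) = Hom A X Y" "mult (hom_group A add X Y) = add"
  by (simp_all add: hom_group_def)

lemma group_Hom: "f \<in> Hom A X Y \<Longrightarrow> group (hom_group A add X Y)"
  using comm_group_Hom[of X Y] Hom_in_Obj[of A f X Y] by (simp add: comm_group.axioms(2))

lemma add_Hom: "f \<in> Hom A X Y \<Longrightarrow> g \<in> Hom A X Y \<Longrightarrow> add f g \<in> Hom A X Y"
  using monoid.m_closed[of "hom_group A add X Y" f g] group_Hom[of f X Y] group.is_monoid by fastforce

lemma Comp_add:
  assumes "f \<in> Hom A X Y" "f' \<in> Hom A X Y" "g \<in> Hom A Y Z"
  shows "g \<cdot> add f f' = add (g \<cdot> f) (g \<cdot> f')"
  using pre assms Hom_in_Obj[of A f X Y] Hom_in_Obj[of A g Y Z] unfolding preadditive_def by metis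

lemma add_Comp:
  assumes "f \<in> Hom A X Y" "g \<in> Hom A Y Z" "g' \<in> Hom A Y Z"
  shows "add g g' \<cdot> f = add (g \<cdot> f) (g' \<cdot> f)"
  using pre assms Hom_in_Obj[of A f X Y] Hom_in_Obj[of A g Y Z] unfolding preadditive_def by metis

lemma add_comm:
  assumes "f \<in> Hom A X Y" "g \<in> Hom A X Y"
  shows "add f g = add g f"
  using comm_monoid.m_comm[of "hom_group A add X Y" f g] comm_group_Hom[of X Y] assms
    Hom_in_Obj[of A f X Y] comm_group.axioms(1) by fastforce

text \<open>In a group only the neutral element is idempotent. This turns distributivity into the
  absorption laws \<open>Comp_hom_one\<close> and \<open>hom_one_Comp\<close>.\<close>

lemma add_idem_one:
  assumes "f \<in> Hom A X Y" "add f f = f"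
  shows "f = \<one>\<^bsub>hom_group A add X Y\<^esub>"
  using group.l_cancel_one[OF group_Hom[OF assms(1)], of f f] assms by simp

lemma hom_one_Hom: "X \<in> Obj A \<Longrightarrow> Y \<in> Obj A \<Longrightarrow> \<one>\<^bsub>hom_group A add X Y\<^esub> \<in> Hom A X Y"
  using monoid.one_closed[of "hom_group A add X Y"] comm_group_Hom[of X Y]
  by (simp add: comm_group_def group_def comm_monoid_def)

lemma add_hom_one: "f \<in> Hom A X Y \<Longrightarrow> add f \<one>\<^bsub>hom_group A add X Y\<^esub> = f"
  using monoid.r_one[OF group.is_monoid[OF group_Hom[of f X Y]], of f] by simp

lemma Comp_hom_one:
  assumes "X \<in> Obj A" "g \<in> Hom A Y Z"
  shows "g \<cdot> \<one>\<^bsub>hom_group A add X Y\<^esub> = \<one>\<^bsub>hom_group A add X Z\<^esub>"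
proof (rule add_idem_one)
  have o: "\<one>\<^bsub>hom_group A add X Y\<^esub> \<in> Hom A X Y"
    using assms Hom_in_Obj[of A g] by (intro hom_one_Hom) auto
  then show "g \<cdot> \<one>\<^bsub>hom_group A add X Y\<^esub> \<in> Hom A X Z" using assms Comp_Hom[of A] by simp
  show "add (g \<cdot> \<one>\<^bsub>hom_group A add X Y\<^esub>) (g \<cdot> \<one>\<^bsub>hom_group A add X Y\<^esub>) = g \<cdot> \<one>\<^bsub>hom_group A add X Y\<^esub>"
    using Comp_add[OF o o assms(2)] add_hom_one[OF o] by simp
qed

lemma hom_one_Comp:
  assumes "Z \<in> Obj A" "f \<in> Hom A X Y"
  shows "\<one>\<^bsub>hom_group A add Y Z\<^esub> \<cdot> f = \<one>\<^bsub>hom_group A add X Z\<^esub>"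
proof (rule add_idem_one)
  have o: "\<one>\<^bsub>hom_group A add Y Z\<^esub> \<in> Hom A Y Z"
    using assms Hom_in_Obj[of A f] by (intro hom_one_Hom) auto
  then show "\<one>\<^bsub>hom_group A add Y Z\<^esub> \<cdot> f \<in> Hom A X Z" using assms Comp_Hom[of A] by simp
  show "add (\<one>\<^bsub>hom_group A add Y Z\<^esub> \<cdot> f) (\<one>\<^bsub>hom_group A add Y Z\<^esub> \<cdot> f) = \<one>\<^bsub>hom_group A add Y Z\<^esub> \<cdot> f"
    using add_Comp[OF assms(2) o o] add_hom_one[OF o] by simp
qed

text \<open>If the identity is the only endomorphism, it is neutral, and composing with it makes
  every arrow into or out of the object neutral. This is how a zero object is found where none is
  known to exist.\<close>

lemma preadditive_zero_obj:
  assumes "Z \<in> Obj A" "\<And>f g. f \<in> Hom A Z Z \<Longrightarrow> g \<in> Hom A Z Z \<Longrightarrow> f = g"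
  shows "zero_obj A Z"
proof -
  have i: "Idn A Z = \<one>\<^bsub>hom_group A add Z Z\<^esub>"
    by (rule assms(2)) (auto simp: Idn_Hom hom_one_Hom assms(1))
  have "f = \<one>\<^bsub>hom_group A add X Z\<^esub>" if "f \<in> Hom A X Z" for X f
    using hom_one_Comp[OF assms(1) that] HomD[OF that] unfolding i[symmetric] by simp
  moreover have "f = \<one>\<^bsub>hom_group A add Z X\<^esub>" if "f \<in> Hom A Z X" for X f
    using Comp_hom_one[OF assms(1) that] HomD[OF that] unfolding i[symmetric] by simp
  ultimately show ?thesis
    using assms(1) hom_one_Hom unfolding zero_obj_def by metis
qed

text \<open>Both are obtained by passing through a zero object, where Hom sets are
  singletons.\<close>

lemma zr_eq_hom_one:
  assumes "pointed A" "X \<in> Obj A" "Y \<in> Obj A"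
  shows "zr A X Y = \<one>\<^bsub>hom_group A add X Y\<^esub>"
proof -
  obtain Z where Z: "zero_obj A Z" using assms by (auto simp: pointed_def)
  then have ZO: "Z \<in> Obj A" by (simp add: zero_obj_def)
  have "\<one>\<^bsub>hom_group A add X Y\<^esub> = zr A Z Y \<cdot> \<one>\<^bsub>hom_group A add X Z\<^esub>"
    using Comp_hom_one[OF assms(2) zr_Hom[OF assms(1) ZO assms(3)]] by simp
  also have "\<one>\<^bsub>hom_group A add X Z\<^esub> = zr A X Z"
    using zero_obj_Hom_eq(1)[OF assms(1) Z hom_one_Hom[OF assms(2) ZO]] .
  finally show ?thesis using assms ZO by simp
qed

context
  assumes pointed: "pointed A"
begin

lemma add_zr:
  assumes "f \<in> Hom A X Y"
  shows "add f (zr A X Y) = f" "add (zr A X Y) f = f"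
proof -
  have o: "X \<in> Obj A" "Y \<in> Obj A" using Hom_in_Obj[of A f X Y] assms by auto
  show 1: "add f (zr A X Y) = f"
    using zr_eq_hom_one[OF pointed o] add_hom_one[OF assms] by simp
  show "add (zr A X Y) f = f"
    using add_comm[OF assms zr_Hom[OF pointed o]] 1 by simp
qed

lemma add_eq_right_iff:
  assumes "f \<in> Hom A X Y" "g \<in> Hom A X Y"
  shows "add f g = g \<longleftrightarrow> f = zr A X Y"
proof
  note o = Hom_in_Obj[OF preadditive_category assms(1)]
  assume "add f g = g"
  then have "add f g = add (zr A X Y) g" using add_zr[OF assms(2)] by simp
  then show "f = zr A X Y"
    using group.right_cancel[OF group_Hom[OF assms(1)], of g f "zr A X Y"] assms zr_Hom[OF pointed o] by simp
qed (use add_zr[OF assms(2)] in simp)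

text \<open>The arrow \<open>d\<close> is f - g. It is used only through \<open>add d g = f\<close>
  and cancellation, which avoids comparing negatives with composition.\<close>

lemma difference:
  assumes "f \<in> Hom A X Y" "g \<in> Hom A X Y"
  obtains d where "d \<in> Hom A X Y" "add d g = f"
    "\<And>h Z. h \<in> Hom A Y Z \<Longrightarrow> h \<cdot> d = zr A X Z \<longleftrightarrow> h \<cdot> f = h \<cdot> g"
    "\<And>h Z. h \<in> Hom A Z X \<Longrightarrow> d \<cdot> h = zr A Z Y \<longleftrightarrow> f \<cdot> h = g \<cdot> h"
proof -
  interpret G: group "hom_group A add X Y" using group_Hom[OF assms(1)] .
  define d where "d = f \<otimes>\<^bsub>hom_group A add X Y\<^esub> inv\<^bsub>hom_group A add X Y\<^esub> g"
  have d: "d \<in> Hom A X Y" using G.m_closed[OF _ G.inv_closed] assms unfolding d_def by simp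
  have e: "add d g = f" using G.inv_solve_right[of d f g] assms d d_def by simp
  show thesis
  proof (rule that[OF d e])
    fix h Z assume h: "h \<in> Hom A Y Z"
    have "h \<cdot> f = add (h \<cdot> d) (h \<cdot> g)" using Comp_add[OF d assms(2) h] e by simp
    then show "h \<cdot> d = zr A X Z \<longleftrightarrow> h \<cdot> f = h \<cdot> g"
      using add_eq_right_iff[of "h \<cdot> d" X Z "h \<cdot> g"] d assms(2) h Comp_Hom[OF preadditive_category] by auto
  next
    fix h Z assume h: "h \<in> Hom A Z X"
    have "f \<cdot> h = add (d \<cdot> h) (g \<cdot> h)" using add_Comp[OF h d assms(2)] e by simp
    then show "d \<cdot> h = zr A Z Y \<longleftrightarrow> f \<cdot> h = g \<cdot> h"
      using add_eq_right_iff[of "d \<cdot> h" Z Y "g \<cdot> h"] d assms(2) h Comp_Hom[OF preadditive_category] by auto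
  qed
qed

lemma mono_arrI_zero:
  assumes "f \<in> Hom A X Y" "\<And>T t. t \<in> Hom A T X \<Longrightarrow> f \<cdot> t = zr A T Y \<Longrightarrow> t = zr A T X"
  shows "mono_arr A f"
proof (rule mono_arrI[OF assms(1)])
  fix T g h assume g: "g \<in> Hom A T X" and h: "h \<in> Hom A T X" and e: "f \<cdot> g = f \<cdot> h"
  obtain d where d: "d \<in> Hom A T X" "\<And>h' Z. h' \<in> Hom A X Z \<Longrightarrow> h' \<cdot> d = zr A T Z \<longleftrightarrow> h' \<cdot> g = h' \<cdot> h"
    using difference[OF g h] by metis
  have "d = zr A T X" using assms(2)[OF d(1)] d(2)[OF assms(1)] e by simp
  then have "Idn A X \<cdot> g = Idn A X \<cdot> h"
    using d(2)[OF Idn_Hom] Hom_in_Obj[OF _ g] HomD[OF d(1)] by simp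
  then show "g = h" using HomD[OF g] HomD[OF h] by simp
qed

end

end

lemma preadditive_opcat:
  assumes "preadditive A add"
  shows "preadditive (opcat A) add"
  using assms unfolding preadditive_def by simp

lemma has_biproducts_opcat:
  assumes "has_biproducts A add"
  shows "has_biproducts (opcat A) add"
  unfolding has_biproducts_def
proof (intro ballI)
  fix X Y assume "X \<in> Obj (opcat A)" "Y \<in> Obj (opcat A)"
  then obtain W i j p q where "W \<in> Obj A" "i \<in> Hom A X W" "j \<in> Hom A Y W" "p \<in> Hom A W X" "q \<in> Hom A W Y"
    "p \<cdot>\<^bsub>A\<^esub> i = Idn A X" "q \<cdot>\<^bsub>A\<^esub> j = Idn A Y" "add (i \<cdot>\<^bsub>A\<^esub> p) (j \<cdot>\<^bsub>A\<^esub> q) = Idn A W"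
    using assms unfolding has_biproducts_def opcat_simps by metis
  then show "\<exists>W\<in>Obj (opcat A). \<exists>i\<in>Hom (opcat A) X W. \<exists>j\<in>Hom (opcat A) Y W.
      \<exists>p\<in>Hom (opcat A) W X. \<exists>q\<in>Hom (opcat A) W Y.
        p \<cdot>\<^bsub>opcat A\<^esub> i = Idn (opcat A) X \<and> q \<cdot>\<^bsub>opcat A\<^esub> j = Idn (opcat A) Y \<and>
        add (i \<cdot>\<^bsub>opcat A\<^esub> p) (j \<cdot>\<^bsub>opcat A\<^esub> q) = Idn (opcat A) W"
    unfolding opcat_simps
    by (intro bexI[of _ W] bexI[of _ p] bexI[of _ q] bexI[of _ i] bexI[of _ j]) auto
qed

lemma abelian_opcat:
  assumes "abelian_category A"
  shows "abelian_category (opcat A)"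
proof -
  obtain add where "preadditive A add" "has_biproducts A add"
    using assms unfolding abelian_category_def by blast
  then have "\<exists>add. preadditive (opcat A) add \<and> has_biproducts (opcat A) add"
    using preadditive_opcat has_biproducts_opcat by blast
  moreover have "zero_obj (opcat A) = zero_obj A" "\<And>f. is_kernel (opcat A) f = is_cokernel A f"
    "\<And>f. is_cokernel (opcat A) f = is_kernel A f"
    by (simp_all add: fun_eq_iff)
  ultimately show ?thesis using assms unfolding abelian_category_def by simp
qed

text \<open>\<open>abelian_category\<close> asserts that some addition exists; fixing one makes all
  differences and biproducts below refer to the same structure.\<close>

locale abelian =
  fixes A :: "('o, 'm) cat" (structure) and add :: "'m \<Rightarrow> 'm \<Rightarrow> 'm"
  assumes abelian: "abelian_category A" and preadditive: "preadditive A add"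
    and biproducts: "has_biproducts A add"
begin

lemma pointed [simp]: "pointed A"
  and category [simp]: "category A"
  using abelian by (auto simp: abelian_category_def pointed_def)

lemma opcat_abelian: "abelian (opcat A) add"
  using abelian_opcat[OF abelian] preadditive_opcat[OF preadditive] has_biproducts_opcat[OF biproducts]
  by unfold_locales

lemmas preadd = preadditive pointed

lemma kernel_ex:
  assumes "f \<in> Arr A"
  obtains k where "is_kernel A f k"
  using assms abelian unfolding abelian_category_def by blast

lemma cokernel_ex:
  assumes "f \<in> Arr A"
  obtains c where "is_cokernel A f c"
  using assms abelian unfolding abelian_category_def by blast

text \<open>A working form of the definition: uniqueness of the factorization becomes monicity, and
  vanishing becomes an equation with \<open>zr\<close> that can be rewritten.\<close>

lemma is_kernel_iff:
  "is_kernel A f k \<longleftrightarrow> f \<in> Arr A \<and> mono_arr A k \<and> Cod A k = Dom A f \<and> f \<cdot> k = zr A (Dom A k) (Cod A f) \<and>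
     (\<forall>X. \<forall>h \<in> Hom A X (Dom A f). f \<cdot> h = zr A X (Cod A f) \<longrightarrow> (\<exists>u \<in> Hom A X (Dom A k). k \<cdot> u = h))"
proof
  assume k: "is_kernel A f k"
  have "\<exists>u \<in> Hom A X (Dom A k). k \<cdot> u = h" if h: "h \<in> Hom A X (Dom A f)" and z: "f \<cdot> h = zr A X (Cod A f)" for X h
  proof -
    have "zero_arr A (f \<cdot> h)" unfolding z using Hom_in_Obj[OF category h] kernelD(1)[OF k] by simp
    from kernel_factor[OF k h this] show ?thesis by blast
  qed
  then show "f \<in> Arr A \<and> mono_arr A k \<and> Cod A k = Dom A f \<and> f \<cdot> k = zr A (Dom A k) (Cod A f) \<and>
     (\<forall>X. \<forall>h \<in> Hom A X (Dom A f). f \<cdot> h = zr A X (Cod A f) \<longrightarrow> (\<exists>u \<in> Hom A X (Dom A k). k \<cdot> u = h))"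
    using kernelD[OF k] kernel_mono[OF category k] zero_arr_iff[of A "f \<cdot> k"] by simp
next
  assume k: "f \<in> Arr A \<and> mono_arr A k \<and> Cod A k = Dom A f \<and> f \<cdot> k = zr A (Dom A k) (Cod A f) \<and>
     (\<forall>X. \<forall>h \<in> Hom A X (Dom A f). f \<cdot> h = zr A X (Cod A f) \<longrightarrow> (\<exists>u \<in> Hom A X (Dom A k). k \<cdot> u = h))"
  then have [simp]: "k \<in> Arr A" by (simp add: mono_arr_def)
  show "is_kernel A f k"
  proof (rule is_kernelI)
    fix X h assume h: "h \<in> Hom A X (Dom A f)" and "zero_arr A (f \<cdot> h)"
    then have "f \<cdot> h = zr A X (Cod A f)" using k zero_arr_iff[of A "f \<cdot> h"] HomD[OF h] by simp
    then show "\<exists>u\<in>Hom A X (Dom A k). k \<cdot> u = h" using k h by blast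
  qed (use k in auto)
qed

lemma is_cokernel_iff:
  "is_cokernel A f c \<longleftrightarrow> f \<in> Arr A \<and> epi_arr A c \<and> Dom A c = Cod A f \<and> c \<cdot> f = zr A (Dom A f) (Cod A c) \<and>
     (\<forall>X. \<forall>h \<in> Hom A (Cod A f) X. h \<cdot> f = zr A (Dom A f) X \<longrightarrow> (\<exists>u \<in> Hom A (Cod A c) X. u \<cdot> c = h))"
  using abelian.is_kernel_iff[OF opcat_abelian, of f c] by simp

lemma kernel_zr: "is_kernel A f k \<Longrightarrow> f \<cdot> k = zr A (Dom A k) (Cod A f)"
  and cokernel_zr: "is_cokernel A f c \<Longrightarrow> c \<cdot> f = zr A (Dom A f) (Cod A c)"
  by (simp_all add: is_kernel_iff is_cokernel_iff)

lemma kernel_lift: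
  assumes "is_kernel A f k" "h \<in> Arr A" "Cod A h = Dom A f" "f \<cdot> h = zr A (Dom A h) (Cod A f)"
  obtains u where "u \<in> Hom A (Dom A h) (Dom A k)" "k \<cdot> u = h"
proof -
  have "h \<in> Hom A (Dom A h) (Dom A f)" using assms by (simp add: Hom_def)
  then show thesis using assms(1,4) that unfolding is_kernel_iff by blast
qed

lemma cokernel_desc:
  assumes "is_cokernel A f c" "h \<in> Arr A" "Dom A h = Cod A f" "h \<cdot> f = zr A (Dom A f) (Cod A h)"
  obtains u where "u \<in> Hom A (Cod A c) (Cod A h)" "u \<cdot> c = h"
  using abelian.kernel_lift[OF opcat_abelian, of f c h] assms by auto

text \<open>The mono \<open>k\<close> is a kernel of some \<open>g\<close>, and \<open>g\<close>
  factors through \<open>c\<close>. Whatever \<open>c\<close> kills is therefore killed by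
  \<open>g\<close> and factors through \<open>k\<close>.\<close>

lemma kernel_cokernel:
  assumes "is_cokernel A k c" "mono_arr A k"
  shows "is_kernel A c k"
proof -
  obtain g where g: "is_kernel A g k" using assms(2) abelian unfolding abelian_category_def by blast
  note k = g[unfolded is_kernel_iff] and c = assms(1)[unfolded is_cokernel_iff]
  have [simp]: "k \<in> Arr A" "c \<in> Arr A" "g \<in> Arr A" using k c by (auto simp: epi_arr_def)
  have "g \<in> Hom A (Cod A k) (Cod A g)" using k by (simp add: Hom_def)
  then obtain u where u: "u \<in> Hom A (Cod A c) (Cod A g)" "u \<cdot> c = g" using k c by metis
  note [simp] = HomD[OF u(1)]
  have [simp]: "Dom A c = Cod A k" "Dom A g = Cod A k" using k c by auto
  show ?thesis unfolding is_kernel_iff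
  proof (intro conjI allI ballI impI)
    fix X h assume h: "h \<in> Hom A X (Dom A c)" and z: "c \<cdot> h = zr A X (Cod A c)"
    note [simp] = HomD[OF h]
    have "g \<cdot> h = u \<cdot> (c \<cdot> h)" using u(2) by (simp flip: Comp_assoc)
    then have "g \<cdot> h = zr A X (Cod A g)" using z Hom_in_Obj[OF category h] by simp
    then show "\<exists>u\<in>Hom A X (Dom A k). k \<cdot> u = h" using k h by simp
  qed (use k c in \<open>auto simp: epi_arr_def\<close>)
qed

lemma cokernel_kernel: "is_kernel A c k \<Longrightarrow> epi_arr A c \<Longrightarrow> is_cokernel A k c"
  using abelian.kernel_cokernel[OF opcat_abelian, of c k] by simp

text \<open>Let \<open>u \<cdot> t\<close> vanish and let \<open>q\<close> be the cokernel of
  \<open>t\<close>, so that \<open>u\<close> factors through \<open>q\<close>. The point is that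
  \<open>q\<close> is split mono: then \<open>q \<cdot> t = 0\<close> gives t = 0. The splitting
  \<open>w\<close> comes from normality of the epi \<open>q \<cdot> e\<close>.\<close>

lemma coimage_mono:
  assumes "is_kernel A f k" "is_cokernel A k e"
  obtains u where "u \<in> Hom A (Cod A e) (Cod A f)" "u \<cdot> e = f" "mono_arr A u"
proof -
  note k = assms(1)[unfolded is_kernel_iff] and e = assms(2)[unfolded is_cokernel_iff]
  have [simp]: "k \<in> Arr A" "e \<in> Arr A" "f \<in> Arr A" using k e by (auto simp: epi_arr_def mono_arr_def)
  have [simp]: "Dom A e = Dom A f" "Cod A k = Dom A f" using k e by auto
  have "f \<in> Hom A (Cod A k) (Cod A f)" by (simp add: Hom_def)
  then obtain u where u: "u \<in> Hom A (Cod A e) (Cod A f)" "u \<cdot> e = f" using k e by metis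
  note [simp] = HomD[OF u(1)]
  have "mono_arr A u"
  proof (rule mono_arrI_zero[OF preadd u(1)])
    fix T t assume t: "t \<in> Hom A T (Cod A e)" and z: "u \<cdot> t = zr A T (Cod A f)"
    note [simp] = HomD[OF t]
    obtain q where q: "is_cokernel A t q" by (rule cokernel_ex[of t]) auto
    note q' [simp] = cokernelD[OF q]
    have qe: "epi_arr A q" by (rule cokernel_epi[OF category q])
    obtain u' where u': "u' \<in> Hom A (Cod A q) (Cod A f)" "u' \<cdot> q = u"
      using q[unfolded is_cokernel_iff] u(1) z by auto
    note [simp] = HomD[OF u'(1)]
    have "epi_arr A (q \<cdot> e)"
      using mono_arr_Comp[of "opcat A" q e] qe e by simp
    \<comment> \<open>Epis are normal, so \<open>q \<cdot> e\<close> is a cokernel of some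
      \<open>g\<close>. As f factors through \<open>q \<cdot> e\<close>, it kills \<open>g\<close>;
      hence \<open>g\<close> factors through \<open>k\<close>, and \<open>e\<close> kills
      \<open>g\<close> as well.\<close>
    then obtain g where g: "is_cokernel A g (q \<cdot> e)" using abelian unfolding abelian_category_def by blast
    note g' = g[unfolded is_cokernel_iff]
    have [simp]: "g \<in> Arr A" "Cod A g = Dom A f" using g' by auto
    have qeg: "q \<cdot> (e \<cdot> g) = zr A (Dom A g) (Cod A q)" using g' by simp
    have "f \<cdot> g = u' \<cdot> (q \<cdot> (e \<cdot> g))" using u(2) u'(2) by (simp flip: Comp_assoc)
    also have "\<dots> = zr A (Dom A g) (Cod A f)" using qeg by simp
    finally have "f \<cdot> g = zr A (Dom A g) (Cod A f)" .
    moreover have "g \<in> Hom A (Dom A g) (Dom A f)" by (simp add: Hom_def)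
    ultimately obtain v where v: "v \<in> Hom A (Dom A g) (Dom A k)" "k \<cdot> v = g" using k by metis
    note [simp] = HomD[OF v(1)]
    have ek: "e \<cdot> k = zr A (Dom A k) (Cod A e)" using e by simp
    have "e \<cdot> g = (e \<cdot> k) \<cdot> v" using v(2) by simp
    then have "e \<cdot> g = zr A (Dom A g) (Cod A e)" unfolding ek by simp
    moreover have "e \<in> Hom A (Cod A g) (Cod A e)" by (simp add: Hom_def)
    ultimately obtain w where w: "w \<in> Hom A (Cod A (q \<cdot> e)) (Cod A e)" "w \<cdot> (q \<cdot> e) = e" using g' by metis
    note [simp] = HomD[OF w(1)]
    have "(w \<cdot> q) \<cdot> e = Idn A (Cod A e) \<cdot> e" using w(2) by simp
    then have "w \<cdot> q = Idn A (Cod A e)"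
      by (rule epi_arrD[rotated -1]) (use e in \<open>auto simp: Hom_def\<close>)
    then have "t = w \<cdot> (q \<cdot> t)" by (simp flip: Comp_assoc)
    also have "q \<cdot> t = zr A T (Cod A q)" using q[unfolded is_cokernel_iff] by simp
    finally show "t = zr A T (Cod A e)" using Hom_in_Obj[OF category t] by simp
  qed
  then show thesis using that u by blast
qed

lemma image_epi:
  assumes "is_cokernel A f c" "is_kernel A c m"
  obtains u where "u \<in> Hom A (Dom A f) (Dom A m)" "m \<cdot> u = f" "epi_arr A u"
  using abelian.coimage_mono[OF opcat_abelian, of f c m] assms by auto

end

section \<open>Biproducts, pullbacks of epimorphisms and split sequences\<close>

context abelian
begin

lemma Comp_add_Arr:
  assumes "f \<in> Hom A X Y" "f' \<in> Hom A X Y" "g \<in> Arr A" "Dom A g = Y"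
  shows "g \<cdot> add f f' = add (g \<cdot> f) (g \<cdot> f')"
  using Comp_add[OF preadditive assms(1,2), of g "Cod A g"] assms(3,4) by (simp add: Hom_def)

lemma epi_arrI_zero:
  assumes "f \<in> Hom A X Y" "\<And>T t. t \<in> Hom A Y T \<Longrightarrow> t \<cdot> f = zr A X T \<Longrightarrow> t = zr A Y T"
  shows "epi_arr A f"
  using mono_arrI_zero[OF preadditive_opcat[OF preadditive] pointed_opcat[OF pointed], of f Y X] assms by simp

text \<open>\<open>has_biproducts\<close> leaves out the mixed composites. Composing the
  decomposition of the identity with \<open>q\<close> gives q i p + q = q, so q i p = 0, and
  precomposing with \<open>i\<close> gives q i = 0; similarly for p j.\<close>

lemma biproduct_ex:
  assumes "X \<in> Obj A" "Y \<in> Obj A"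
  obtains W i j p q where "W \<in> Obj A" "i \<in> Hom A X W" "j \<in> Hom A Y W" "p \<in> Hom A W X" "q \<in> Hom A W Y"
    "p \<cdot> i = Idn A X" "q \<cdot> j = Idn A Y" "q \<cdot> i = zr A X Y" "p \<cdot> j = zr A Y X"
    "add (i \<cdot> p) (j \<cdot> q) = Idn A W"
proof -
  obtain W i j p q where W: "W \<in> Obj A" and i: "i \<in> Hom A X W" and j: "j \<in> Hom A Y W"
    and p: "p \<in> Hom A W X" and q: "q \<in> Hom A W Y"
    and e: "p \<cdot> i = Idn A X" "q \<cdot> j = Idn A Y" "add (i \<cdot> p) (j \<cdot> q) = Idn A W"
    using biproducts assms unfolding has_biproducts_def by metis
  note [simp] = HomD[OF i] HomD[OF j] HomD[OF p] HomD[OF q] W assms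
  have ip: "i \<cdot> p \<in> Hom A W W" and jq: "j \<cdot> q \<in> Hom A W W" by (simp_all add: Hom_def)
  have "add (q \<cdot> (i \<cdot> p)) (q \<cdot> (j \<cdot> q)) = q \<cdot> Idn A W"
    unfolding e(3)[symmetric] using Comp_add[OF preadditive ip jq q] by simp
  then have "q \<cdot> (i \<cdot> p) = zr A W Y"
    using add_eq_right_iff[OF preadd, of "q \<cdot> (i \<cdot> p)" W Y q]
    by (simp add: Comp_reassoc[OF category e(2)] Hom_def)
  then have "(q \<cdot> (i \<cdot> p)) \<cdot> i = zr A X Y" by (simp del: Comp_assoc)
  then have qi: "q \<cdot> i = zr A X Y" by (simp add: e(1))
  have "add (p \<cdot> (i \<cdot> p)) (p \<cdot> (j \<cdot> q)) = p \<cdot> Idn A W"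
    unfolding e(3)[symmetric] using Comp_add[OF preadditive ip jq p] by simp
  then have "add (p \<cdot> (j \<cdot> q)) p = p"
    using add_comm[OF preadditive, of p W X "p \<cdot> (j \<cdot> q)"]
    by (simp add: Comp_reassoc[OF category e(1)] Hom_def)
  then have "p \<cdot> (j \<cdot> q) = zr A W X"
    using add_eq_right_iff[OF preadd, of "p \<cdot> (j \<cdot> q)" W X p] by (simp add: Hom_def)
  then have "(p \<cdot> (j \<cdot> q)) \<cdot> j = zr A Y X" by (simp del: Comp_assoc)
  then have pj: "p \<cdot> j = zr A Y X" by (simp add: e(2))
  show thesis using that W i j p q e qi pj by blast
qed

lemma biproduct_pairing:
  assumes "i \<in> Hom A X W" "j \<in> Hom A Y W" "p \<in> Hom A W X" "q \<in> Hom A W Y"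
    "p \<cdot> i = Idn A X" "q \<cdot> j = Idn A Y" "q \<cdot> i = zr A X Y" "p \<cdot> j = zr A Y X"
    "f \<in> Hom A T X" "g \<in> Hom A T Y"
  obtains w where "w \<in> Hom A T W" "p \<cdot> w = f" "q \<cdot> w = g"
proof
  note [simp] = HomD[OF assms(1)] HomD[OF assms(2)] HomD[OF assms(3)] HomD[OF assms(4)]
    HomD[OF assms(9)] HomD[OF assms(10)]
  have [simp]: "X \<in> Obj A" "Y \<in> Obj A" "T \<in> Obj A" "W \<in> Obj A"
    using assms by (auto dest: Hom_in_Obj[OF category])
  have i: "i \<cdot> f \<in> Hom A T W" and j: "j \<cdot> g \<in> Hom A T W" by (simp_all add: Hom_def)
  show "add (i \<cdot> f) (j \<cdot> g) \<in> Hom A T W" by (rule add_Hom[OF preadditive i j])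
  show "p \<cdot> add (i \<cdot> f) (j \<cdot> g) = f"
    using Comp_add[OF preadditive i j assms(3)] add_zr[OF preadd assms(9)]
    by (simp add: Comp_reassoc[OF category assms(5)] Comp_reassoc[OF category assms(8)])
  show "q \<cdot> add (i \<cdot> f) (j \<cdot> g) = g"
    using Comp_add[OF preadditive i j assms(4)] add_zr[OF preadd assms(10)]
    by (simp add: Comp_reassoc[OF category assms(6)] Comp_reassoc[OF category assms(7)])
qed

lemma biproduct_joint_mono:
  assumes "i \<in> Hom A X W" "j \<in> Hom A Y W" "p \<in> Hom A W X" "q \<in> Hom A W Y"
    "add (i \<cdot> p) (j \<cdot> q) = Idn A W" "w \<in> Hom A T W" "w' \<in> Hom A T W" "p \<cdot> w = p \<cdot> w'" "q \<cdot> w = q \<cdot> w'"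
  shows "w = w'"
proof -
  note [simp] = HomD[OF assms(1)] HomD[OF assms(2)] HomD[OF assms(3)] HomD[OF assms(4)]
  have i: "i \<cdot> p \<in> Hom A W W" and j: "j \<cdot> q \<in> Hom A W W" by (simp_all add: Hom_def)
  have *: "v = add (i \<cdot> (p \<cdot> v)) (j \<cdot> (q \<cdot> v))" if v: "v \<in> Hom A T W" for v
    using add_Comp[OF preadditive v i j] HomD[OF v] by (simp add: assms(5))
  show ?thesis using *[OF assms(6)] *[OF assms(7)] assms(8,9) by simp
qed

text \<open>The pullback is the kernel of d = h a - p b on the biproduct of X and M. Since d j = -p,
  the arrow \<open>d\<close> is epi and hence the cokernel of its kernel \<open>k\<close>. An arrow
  \<open>t\<close> killing \<open>a \<cdot> k\<close> thus yields t a = u d; restricting to the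
  summand M gives u = 0, so t = 0.\<close>

lemma pullback_epi:
  assumes p: "p \<in> Hom A M N" "epi_arr A p" and h: "h \<in> Hom A X N"
  obtains P s h' where "s \<in> Hom A P X" "h' \<in> Hom A P M" "p \<cdot> h' = h \<cdot> s" "epi_arr A s"
    "\<And>T u u'. u \<in> Hom A T P \<Longrightarrow> u' \<in> Hom A T P \<Longrightarrow> s \<cdot> u = s \<cdot> u' \<Longrightarrow> h' \<cdot> u = h' \<cdot> u' \<Longrightarrow> u = u'"
proof -
  note [simp] = HomD[OF p(1)] HomD[OF h]
  have [simp]: "X \<in> Obj A" "M \<in> Obj A" "N \<in> Obj A"
    using p h by (auto dest: Hom_in_Obj[OF category])
  obtain W i j a b where W: "W \<in> Obj A" and i: "i \<in> Hom A X W" and j: "j \<in> Hom A M W"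
    and a: "a \<in> Hom A W X" and b: "b \<in> Hom A W M"
    and e: "a \<cdot> i = Idn A X" "b \<cdot> j = Idn A M" "b \<cdot> i = zr A X M" "a \<cdot> j = zr A M X"
    "add (i \<cdot> a) (j \<cdot> b) = Idn A W"
    by (rule biproduct_ex[of X M]) auto
  note [simp] = HomD[OF i] HomD[OF j] HomD[OF a] HomD[OF b] W e(1-4)
  have ha: "h \<cdot> a \<in> Hom A W N" and pb: "p \<cdot> b \<in> Hom A W N" by (simp_all add: Hom_def)
  obtain d where d: "d \<in> Hom A W N" and dpb: "add d (p \<cdot> b) = h \<cdot> a"
    and dr: "\<And>t Z. t \<in> Hom A Z W \<Longrightarrow> d \<cdot> t = zr A Z N \<longleftrightarrow> (h \<cdot> a) \<cdot> t = (p \<cdot> b) \<cdot> t"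
    using difference[OF preadd ha pb] by metis
  note [simp] = HomD[OF d]
  \<comment> \<open>This is d j = -p. Together with \<open>p\<close> being epi it shows that only
    zero kills \<open>d \<cdot> j\<close>, which is \<open>tdj\<close>.\<close>
  have djp: "add (d \<cdot> j) p = zr A M N"
    using add_Comp[OF preadditive j d pb] dpb by simp
  have tdj: "t = zr A N Z" if t: "t \<in> Hom A N Z" and z: "t \<cdot> (d \<cdot> j) = zr A M Z" for t Z
  proof -
    note [simp] = HomD[OF t]
    have [simp]: "Z \<in> Obj A" using Hom_in_Obj[OF category t] by simp
    have dj: "d \<cdot> j \<in> Hom A M N" by (simp add: Hom_def)
    have "add (t \<cdot> (d \<cdot> j)) (t \<cdot> p) = zr A M Z"
      using Comp_add[OF preadditive dj p(1) t] djp by simp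
    then have "t \<cdot> p = zr A N Z \<cdot> p"
      unfolding z using add_zr[OF preadd, of "t \<cdot> p" M Z] by (simp add: Hom_def)
    then show ?thesis by (rule epi_arrD[OF p(2), rotated 2]) (simp_all add: Hom_def)
  qed
  have "epi_arr A d"
  proof (rule epi_arrI_zero[OF d])
    fix Z t assume t: "t \<in> Hom A N Z" and z: "t \<cdot> d = zr A W Z"
    note [simp] = HomD[OF t]
    have "t \<cdot> (d \<cdot> j) = (t \<cdot> d) \<cdot> j" by simp
    then show "t = zr A N Z" using tdj[OF t] z Hom_in_Obj[OF category t] by simp
  qed
  moreover obtain k where k: "is_kernel A d k" by (rule kernel_ex[of d]) auto
  ultimately have c: "is_cokernel A k d" by (intro cokernel_kernel)
  note [simp] = kernelD[OF k]
  have dk: "d \<cdot> k = zr A (Dom A k) N" using kernel_zr[OF k] by simp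
  have comm: "p \<cdot> (b \<cdot> k) = h \<cdot> (a \<cdot> k)" using dr[of k "Dom A k"] dk by (simp add: Hom_def)
  show thesis
  proof
    show ak: "a \<cdot> k \<in> Hom A (Dom A k) X" and "b \<cdot> k \<in> Hom A (Dom A k) M" by (simp_all add: Hom_def)
    show "p \<cdot> (b \<cdot> k) = h \<cdot> (a \<cdot> k)" by (rule comm)
    show "epi_arr A (a \<cdot> k)"
    proof (rule epi_arrI_zero[OF ak])
      fix Z t assume t: "t \<in> Hom A X Z" and z: "t \<cdot> (a \<cdot> k) = zr A (Dom A k) Z"
      note [simp] = HomD[OF t]
      have [simp]: "Z \<in> Obj A" using Hom_in_Obj[OF category t] by simp
      have "t \<cdot> a \<in> Hom A (Cod A k) Z" by (simp add: Hom_def)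
      then obtain u where u: "u \<in> Hom A N Z" "u \<cdot> d = t \<cdot> a"
        using cokernel_desc[OF c, of "t \<cdot> a"] z by auto
      note [simp] = HomD[OF u(1)]
      have "u \<cdot> (d \<cdot> j) = (t \<cdot> a) \<cdot> j" using u(2) by (simp flip: Comp_assoc)
      then have "u = zr A N Z" using tdj[OF u(1)] by simp
      then have "(t \<cdot> a) \<cdot> i = zr A W Z \<cdot> i" using u(2) by (simp del: Comp_assoc)
      then show "t = zr A X Z" by simp
    qed
    fix T u u' assume u: "u \<in> Hom A T (Dom A k)" "u' \<in> Hom A T (Dom A k)"
      and e: "(a \<cdot> k) \<cdot> u = (a \<cdot> k) \<cdot> u'" "(b \<cdot> k) \<cdot> u = (b \<cdot> k) \<cdot> u'"
    note [simp] = HomD[OF u(1)] HomD[OF u(2)]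
    have "k \<cdot> u = k \<cdot> u'"
      by (rule biproduct_joint_mono[OF i j a b \<open>add (i \<cdot> a) (j \<cdot> b) = Idn A W\<close>, of _ T])
         (use e in \<open>simp_all add: Hom_def\<close>)
    then show "u = u'" using mono_arrD[OF kernel_mono[OF category k]] u by blast
  qed
qed

lemma zero_mono_zero_obj:
  assumes "mono_arr A f" "zero_arr A f"
  shows "zero_obj A (Dom A f)"
proof -
  have [simp]: "f \<in> Arr A" using assms by (simp add: mono_arr_def)
  have f: "f = zr A (Dom A f) (Cod A f)" using assms(2) zero_arr_iff[OF pointed] by simp
  have "f \<cdot> zr A (Dom A f) (Dom A f) = zr A (Dom A f) (Cod A f)" by simp
  then have "f \<cdot> Idn A (Dom A f) = f \<cdot> zr A (Dom A f) (Dom A f)" using f by simp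
  then have "Idn A (Dom A f) = zr A (Dom A f) (Dom A f)"
    by (rule mono_arrD[OF assms(1), rotated 2]) (auto simp: Hom_def)
  then show ?thesis using zero_obj_iff[OF pointed] by simp
qed

text \<open>The arrow 1 - f r kills f and so equals s g for some s. Then g s g = g - g f r = g, and
  g cancels because it is epi.\<close>

lemma split_mono_splits:
  assumes "short_exact A f g" "r \<in> Hom A (Cod A f) (Dom A f)" "r \<cdot> f = Idn A (Dom A f)"
  shows "splits A g"
proof -
  have k: "is_kernel A g f" and c: "is_cokernel A f g" using assms(1) by (auto simp: short_exact_def)
  note [simp] = kernelD[OF k] HomD[OF assms(2)] assms(3)
  let ?M = "Dom A g"
  have fr: "f \<cdot> r \<in> Hom A ?M ?M" and f: "f \<in> Hom A (Dom A f) ?M" by (simp_all add: Hom_def)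
  obtain d where d: "d \<in> Hom A ?M ?M" "add d (f \<cdot> r) = Idn A ?M"
    "d \<cdot> f = zr A (Dom A f) ?M \<longleftrightarrow> Idn A ?M \<cdot> f = (f \<cdot> r) \<cdot> f"
    using difference[OF preadd Idn_Hom[OF category, of ?M] fr] f by (metis Dom_in_Obj category kernelD(1) k)
  note [simp] = HomD[OF d(1)]
  have "d \<cdot> f = zr A (Dom A f) ?M" using d(3) by simp
  then obtain s where s: "s \<in> Hom A (Cod A g) ?M" "s \<cdot> g = d"
    using cokernel_desc[OF c, of d] d(1) by auto
  note [simp] = HomD[OF s(1)]
  have gf: "g \<cdot> f = zr A (Dom A f) (Cod A g)" using kernel_zr[OF k] by simp
  have gd: "g \<cdot> d \<in> Hom A ?M (Cod A g)" by (simp add: Hom_def)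
  have "add (g \<cdot> d) (g \<cdot> (f \<cdot> r)) = g"
    using Comp_add_Arr[OF d(1) fr, of g] d(2) by simp
  then have "(g \<cdot> s) \<cdot> g = Idn A (Cod A g) \<cdot> g"
    using add_zr[OF preadd gd] s(2) by (simp add: Comp_reassoc[OF category gf])
  then have "g \<cdot> s = Idn A (Cod A g)"
    by (rule epi_arrD[OF cokernel_epi[OF category c], rotated 2]) (auto simp: Hom_def)
  then show ?thesis unfolding splits_def using s(1) by blast
qed

end

section \<open>Thick subcategories\<close>

lemma short_exact_opcat: "short_exact (opcat A) f g \<longleftrightarrow> short_exact A g f"
  by (auto simp: short_exact_def)

lemma thick_opcat: "thick A C \<Longrightarrow> thick (opcat A) C"
  unfolding thick_def short_exact_opcat opcat_simps
  using kernelD(3) unfolding short_exact_def by metis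

locale thick_subcategory = abelian +
  fixes C :: "'a set"
  assumes thick: "thick A C"
begin

lemma opcat_thick: "thick_subcategory (opcat A) add C"
  using opcat_abelian thick_opcat[OF thick]
  by (simp add: thick_subcategory_def thick_subcategory_axioms_def)

lemma thick_iff: "short_exact A f g \<Longrightarrow> Cod A f \<in> C \<longleftrightarrow> Dom A f \<in> C \<and> Cod A g \<in> C"
  using thick by (simp add: thick_def)

lemma thick_Obj: "X \<in> C \<Longrightarrow> X \<in> Obj A"
  using thick by (auto simp: thick_def)

lemma thick_mono:
  assumes "mono_arr A f" "Cod A f \<in> C"
  shows "Dom A f \<in> C"
proof -
  obtain c where c: "is_cokernel A f c" by (rule cokernel_ex[of f]) (use assms in \<open>auto simp: mono_arr_def\<close>)
  then show ?thesis using kernel_cokernel[OF c assms(1)] thick_iff[of f c] assms by (auto simp: short_exact_def)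
qed

text \<open>A thick subcategory is nonempty, and a zero object embeds into any of its
  members.\<close>

lemma thick_zero:
  assumes "zero_obj A Z"
  shows "Z \<in> C"
proof -
  obtain X where X: "X \<in> C" using thick by (auto simp: thick_def)
  have Z: "Z \<in> Obj A" using assms by (simp add: zero_obj_def)
  note [simp] = thick_Obj[OF X] Z
  have "mono_arr A (zr A Z X)"
  proof (rule mono_arrI)
    show "zr A Z X \<in> Hom A Z X" by (simp add: Hom_def)
    fix T g h assume "g \<in> Hom A T Z" "h \<in> Hom A T Z"
    then show "g = h" using zero_obj_Hom_eq(1)[OF pointed assms] by metis
  qed
  then show ?thesis using thick_mono[of "zr A Z X"] X by simp
qed

section \<open>The index sets of the direct limit\<close>

lemma sub_with_quot_inD:
  assumes "sub_with_quot_in A C M i"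
  shows "i \<in> Arr A" "Cod A i = M" "mono_arr A i"
  using assms by (auto simp: sub_with_quot_in_def mono_arr_def)

text \<open>The main source of indices: M modulo the kernel of c embeds into D, hence lies in
  C.\<close>

lemma sub_kernel_ex:
  assumes "c \<in> Hom A M D" "D \<in> C"
  obtains i where "is_kernel A c i" "sub_with_quot_in A C M i"
proof -
  note [simp] = HomD[OF assms(1)]
  obtain i where i: "is_kernel A c i" by (rule kernel_ex[of c]) auto
  note [simp] = kernelD[OF i]
  obtain e where e: "is_cokernel A i e" by (rule cokernel_ex[of i]) auto
  obtain u where u: "u \<in> Hom A (Cod A e) (Cod A c)" "mono_arr A u" by (rule coimage_mono[OF i e])
  have "Cod A e \<in> C" using thick_mono[OF u(2)] HomD[OF u(1)] assms by simp
  then show thesis using that[OF i] e kernel_mono[OF category i] by (auto simp: sub_with_quot_in_def)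
qed

text \<open>The two index conditions are dual although stated differently, because every epi is the
  cokernel of its kernel and every mono the kernel of its cokernel.\<close>

lemma quot_by_sub_opcat: "sub_with_quot_in (opcat A) C N p \<longleftrightarrow> quot_by_sub A C N p"
proof
  assume "sub_with_quot_in (opcat A) C N p"
  then obtain c where c: "epi_arr A p" "Dom A p = N" "is_kernel A p c" "Dom A c \<in> C"
    by (auto simp: sub_with_quot_in_def)
  then show "quot_by_sub A C N p"
    using kernel_mono[OF category c(3)] cokernel_kernel[OF c(3,1)] by (auto simp: quot_by_sub_def)
next
  assume "quot_by_sub A C N p"
  then obtain j where j: "Dom A p = N" "mono_arr A j" "Dom A j \<in> C" "is_cokernel A j p"
    by (auto simp: quot_by_sub_def)
  then show "sub_with_quot_in (opcat A) C N p"
    using kernel_cokernel[OF j(4,2)] cokernel_epi[OF category j(4)] by (auto simp: sub_with_quot_in_def)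
qed

lemma quot_by_subD:
  assumes "quot_by_sub A C N p"
  shows "p \<in> Arr A" "Dom A p = N" "epi_arr A p"
  using assms cokernel_epi[OF category] by (auto simp: quot_by_sub_def dest: cokernelD)

text \<open>The intersection is the kernel of the arrow from \<open>M\<close> to the direct sum of the two cokernels.\<close>

lemma sub_inter:
  assumes "sub_with_quot_in A C M i" "sub_with_quot_in A C M i'"
  obtains i0 a a' where "sub_with_quot_in A C M i0" "a \<in> Hom A (Dom A i0) (Dom A i)"
    "a' \<in> Hom A (Dom A i0) (Dom A i')" "i \<cdot> a = i0" "i' \<cdot> a' = i0"
proof -
  note [simp] = sub_with_quot_inD[OF assms(1)] sub_with_quot_inD[OF assms(2)]
  obtain c where c: "is_cokernel A i c" "Cod A c \<in> C" using assms(1) by (auto simp: sub_with_quot_in_def)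
  obtain c' where c': "is_cokernel A i' c'" "Cod A c' \<in> C" using assms(2) by (auto simp: sub_with_quot_in_def)
  note [simp] = cokernelD[OF c(1)] cokernelD[OF c'(1)]
  obtain W k j p q where W: "W \<in> Obj A" and k: "k \<in> Hom A (Cod A c) W" and j: "j \<in> Hom A (Cod A c') W"
    and p: "p \<in> Hom A W (Cod A c)" and q: "q \<in> Hom A W (Cod A c')"
    and e: "p \<cdot> k = Idn A (Cod A c)" "q \<cdot> j = Idn A (Cod A c')" "q \<cdot> k = zr A (Cod A c) (Cod A c')"
      "p \<cdot> j = zr A (Cod A c') (Cod A c)" "add (k \<cdot> p) (j \<cdot> q) = Idn A W"
    by (rule biproduct_ex[of "Cod A c" "Cod A c'"]) auto
  note [simp] = HomD[OF k] HomD[OF j] HomD[OF p] HomD[OF q] W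
  have kp: "k \<cdot> p \<in> Hom A W W" and jq: "j \<cdot> q \<in> Hom A W W" by (simp_all add: Hom_def)
  \<comment> \<open>The arrows \<open>k\<close> and \<open>q\<close> form a short exact sequence,
    exhibiting W as an extension of one cokernel by the other.\<close>
  have "W \<in> C"
  proof -
    have "is_kernel A q k" unfolding is_kernel_iff
    proof (intro conjI allI ballI impI)
      show "mono_arr A k" by (rule split_mono[OF category k p e(1)])
      fix X h assume h: "h \<in> Hom A X (Dom A q)" and z: "q \<cdot> h = zr A X (Cod A q)"
      note [simp] = HomD[OF h] Hom_in_Obj[OF category h]
      have "k \<cdot> (p \<cdot> h) = h"
        by (rule biproduct_joint_mono[OF k j p q e(5)])
           (use z in \<open>auto simp: Hom_def Comp_reassoc[OF category e(1)] Comp_reassoc[OF category e(3)]\<close>)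
      then show "\<exists>u\<in>Hom A X (Dom A k). k \<cdot> u = h" by (intro bexI[of _ "p \<cdot> h"]) (auto simp: Hom_def)
    qed (use e in auto)
    moreover have "epi_arr A q"
      using split_mono[of "opcat A" q "Cod A c'" W j] q j e by simp
    ultimately have "short_exact A k q" using cokernel_kernel by (simp add: short_exact_def)
    then show ?thesis using thick_iff c(2) c'(2) by fastforce
  qed
  have cM: "c \<in> Hom A M (Cod A c)" "c' \<in> Hom A M (Cod A c')" by (simp_all add: Hom_def)
  obtain w where w: "w \<in> Hom A M W" "p \<cdot> w = c" "q \<cdot> w = c'"
    by (rule biproduct_pairing[OF k j p q e(1-4) cM])
  note [simp] = HomD[OF w(1)]
  obtain i0 where i0: "is_kernel A w i0" "sub_with_quot_in A C M i0"
    by (rule sub_kernel_ex[OF w(1) \<open>W \<in> C\<close>])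
  note [simp] = kernelD[OF i0(1)]
  have w0: "w \<cdot> i0 = zr A (Dom A i0) W" using kernel_zr[OF i0(1)] by simp
  have "c \<cdot> i0 = zr A (Dom A i0) (Cod A c)" "c' \<cdot> i0 = zr A (Dom A i0) (Cod A c')"
    unfolding w(2,3)[symmetric] using w0 by simp_all
  moreover have "i0 \<in> Hom A (Dom A i0) M" by (simp add: Hom_def)
  moreover have "is_kernel A c i" "is_kernel A c' i'" using kernel_cokernel c c' by auto
  ultimately obtain a a' where "a \<in> Hom A (Dom A i0) (Dom A i)" "i \<cdot> a = i0"
    "a' \<in> Hom A (Dom A i0) (Dom A i')" "i' \<cdot> a' = i0"
    unfolding is_kernel_iff by (metis \<open>Dom A c = Cod A i\<close> \<open>Dom A c' = Cod A i'\<close> \<open>Cod A i = M\<close> \<open>Cod A i' = M\<close>)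
  then show thesis using that i0(2) by blast
qed

lemma quot_join:
  assumes "quot_by_sub A C N p" "quot_by_sub A C N p'"
  obtains p0 b b' where "quot_by_sub A C N p0" "b \<in> Hom A (Cod A p) (Cod A p0)"
    "b' \<in> Hom A (Cod A p') (Cod A p0)" "b \<cdot> p = p0" "b' \<cdot> p' = p0"
  using thick_subcategory.sub_inter[OF opcat_thick, of N p p'] assms quot_by_sub_opcat by auto

text \<open>An index needs an actual cokernel with target in C. The kernel of M -> 0 is an index by
  \<open>sub_kernel_ex\<close> and is invertible, so its cokernel can be transported to the
  identity.\<close>

lemma sub_Idn:
  assumes "M \<in> Obj A"
  shows "sub_with_quot_in A C M (Idn A M)"
proof -
  note [simp] = assms
  obtain Z where Z: "zero_obj A Z" using pointed by (auto simp: pointed_def)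
  then have [simp]: "Z \<in> Obj A" by (simp add: zero_obj_def)
  obtain i where i: "is_kernel A (zr A M Z) i" "sub_with_quot_in A C M i"
    by (rule sub_kernel_ex[OF zr_Hom[OF pointed assms \<open>Z \<in> Obj A\<close>] thick_zero[OF Z]])
  have iso: "iso_arr A i" by (rule zero_kernel_iso[OF category i(1)]) simp
  note [simp] = sub_with_quot_inD[OF i(2)] inv_arr[OF iso]
  obtain c where c: "is_cokernel A i c" "Cod A c \<in> C" using i by (auto simp: sub_with_quot_in_def)
  note [simp] = cokernelD[OF c(1)]
  have "is_cokernel A (Idn A M) c"
    by (rule cokernel_transport[OF category c(1), where \<alpha> = "Idn A M" and \<beta> = "inv_arr A i" and \<gamma> = "Idn A (Cod A c)"])
       (auto intro: iso_arr_Idn iso_epi[OF category iso_arr_inv[OF category iso]])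
  then show ?thesis using c(2) iso_mono[OF category iso_arr_Idn[OF category assms]]
    by (auto simp: sub_with_quot_in_def)
qed

lemma quot_Idn: "N \<in> Obj A \<Longrightarrow> quot_by_sub A C N (Idn A N)"
  using thick_subcategory.sub_Idn[OF opcat_thick, of N] quot_by_sub_opcat by auto

end

section \<open>Functors and adjunctions\<close>

lemma functor_simps:
  assumes "is_functor A B F"
  shows "category A" "category B"
    "\<And>X. X \<in> Obj A \<Longrightarrow> FObj F X \<in> Obj B"
    "\<And>f. f \<in> Arr A \<Longrightarrow> FArr F f \<in> Arr B"
    "\<And>f. f \<in> Arr A \<Longrightarrow> Dom B (FArr F f) = FObj F (Dom A f)"
    "\<And>f. f \<in> Arr A \<Longrightarrow> Cod B (FArr F f) = FObj F (Cod A f)"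
    "\<And>X. X \<in> Obj A \<Longrightarrow> FArr F (Idn A X) = Idn B (FObj F X)"
    "\<And>f g. f \<in> Arr A \<Longrightarrow> g \<in> Arr A \<Longrightarrow> Cod A f = Dom A g \<Longrightarrow> FArr F (g \<cdot>\<^bsub>A\<^esub> f) = FArr F g \<cdot>\<^bsub>B\<^esub> FArr F f"
  using assms by (auto simp: is_functor_def Hom_def)

lemma functor_Hom: "is_functor A B F \<Longrightarrow> f \<in> Hom A X Y \<Longrightarrow> FArr F f \<in> Hom B (FObj F X) (FObj F Y)"
  by (auto simp: is_functor_def Hom_def)

lemma func_comp_simps [simp]:
  "FObj (G \<circ>\<^sub>F F) X = FObj G (FObj F X)" "FArr (G \<circ>\<^sub>F F) f = FArr G (FArr F f)"
  "FObj id_func Y = Y" "FArr id_func g = g"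
  by (simp_all add: func_comp_def id_func_def)

lemma is_functorI:
  assumes "category A" "category B" "\<And>X. X \<in> Obj A \<Longrightarrow> FObj F X \<in> Obj B"
    "\<And>f. f \<in> Arr A \<Longrightarrow> FArr F f \<in> Arr B"
    "\<And>f. f \<in> Arr A \<Longrightarrow> Dom B (FArr F f) = FObj F (Dom A f)"
    "\<And>f. f \<in> Arr A \<Longrightarrow> Cod B (FArr F f) = FObj F (Cod A f)"
    "\<And>X. X \<in> Obj A \<Longrightarrow> FArr F (Idn A X) = Idn B (FObj F X)"
    "\<And>f g. f \<in> Arr A \<Longrightarrow> g \<in> Arr A \<Longrightarrow> Cod A f = Dom A g \<Longrightarrow> FArr F (g \<cdot>\<^bsub>A\<^esub> f) = FArr F g \<cdot>\<^bsub>B\<^esub> FArr F f"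
  shows "is_functor A B F"
  using assms by (auto simp: is_functor_def Hom_def)

lemma functor_comp:
  assumes "is_functor A B F" "is_functor B D G"
  shows "is_functor A D (G \<circ>\<^sub>F F)"
  by (rule is_functorI) (simp_all add: functor_simps[OF assms(1)] functor_simps[OF assms(2)])

lemma functor_iso:
  assumes "is_functor A B F" "iso_arr A f"
  shows "iso_arr B (FArr F f)" "inv_arr B (FArr F f) = FArr F (inv_arr A f)"
proof -
  note F [simp] = functor_simps[OF assms(1)]
  note i [simp] = inv_arr[OF assms(2)]
  have f: "FArr F f \<in> Hom B (FObj F (Dom A f)) (FObj F (Cod A f))"
    and g: "FArr F (inv_arr A f) \<in> Hom B (FObj F (Cod A f)) (FObj F (Dom A f))"
    by (simp_all add: Hom_def)
  have e: "FArr F (inv_arr A f) \<cdot>\<^bsub>B\<^esub> FArr F f = Idn B (FObj F (Dom A f))"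
    "FArr F f \<cdot>\<^bsub>B\<^esub> FArr F (inv_arr A f) = Idn B (FObj F (Cod A f))"
    by (simp_all flip: F(8))
  show "iso_arr B (FArr F f)" by (rule iso_arrI[OF f g e])
  show "inv_arr B (FArr F f) = FArr F (inv_arr A f)" by (rule inv_arr_eqI[OF F(2) f g e])
qed

lemma functor_opcat: "is_functor A B F \<Longrightarrow> is_functor (opcat A) (opcat B) F"
  by (rule is_functorI) (simp_all add: functor_simps)

lemma id_functor: "category A \<Longrightarrow> is_functor A A id_func"
  by (rule is_functorI) simp_all

lemma adjunction_opcat:
  assumes "adjunction A B F G \<eta> \<delta>"
  shows "adjunction (opcat B) (opcat A) G F \<delta> \<eta>"
proof -
  have "is_functor A B F" "is_functor B A G" "category A" "category B"
    using assms by (auto simp: adjunction_def is_functor_def)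
  then have f: "is_functor (opcat A) (opcat B) F" "is_functor (opcat B) (opcat A) G"
    "is_functor (opcat A) (opcat A) id_func" "is_functor (opcat B) (opcat B) id_func"
    "is_functor (opcat A) (opcat A) (G \<circ>\<^sub>F F)" "is_functor (opcat B) (opcat B) (F \<circ>\<^sub>F G)"
    by (auto intro: functor_opcat id_functor functor_comp)
  show ?thesis
    using assms f unfolding adjunction_def nat_trans_def by simp
qed

section \<open>What adjoint functors preserve\<close>

locale adjoint =
  fixes A :: "('o, 'm) cat" and B :: "('p, 'n) cat" and F G \<eta> \<delta>
  assumes adj: "adjunction A B F G \<eta> \<delta>"
begin

lemma F_functor: "is_functor A B F" and G_functor: "is_functor B A G"
  using adj by (auto simp: adjunction_def)

lemmas F_simps [simp] = functor_simps[OF F_functor]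
lemmas G_simps [simp] = functor_simps[OF G_functor]

lemma unit_simps [simp]:
  assumes "X \<in> Obj A"
  shows "\<eta> X \<in> Arr A" "Dom A (\<eta> X) = X" "Cod A (\<eta> X) = FObj G (FObj F X)"
  using adj assms by (auto simp: adjunction_def nat_trans_def Hom_def)

lemma counit_simps [simp]:
  assumes "Y \<in> Obj B"
  shows "\<delta> Y \<in> Arr B" "Dom B (\<delta> Y) = FObj F (FObj G Y)" "Cod B (\<delta> Y) = Y"
  using adj assms by (auto simp: adjunction_def nat_trans_def Hom_def)

lemma unit_nat: "f \<in> Arr A \<Longrightarrow> FArr G (FArr F f) \<cdot>\<^bsub>A\<^esub> \<eta> (Dom A f) = \<eta> (Cod A f) \<cdot>\<^bsub>A\<^esub> f"
  using adj by (simp add: adjunction_def nat_trans_def)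

lemma counit_nat: "f \<in> Arr B \<Longrightarrow> \<delta> (Cod B f) \<cdot>\<^bsub>B\<^esub> FArr F (FArr G f) = f \<cdot>\<^bsub>B\<^esub> \<delta> (Dom B f)"
  using adj by (simp add: adjunction_def nat_trans_def)

lemma triangle_F: "X \<in> Obj A \<Longrightarrow> \<delta> (FObj F X) \<cdot>\<^bsub>B\<^esub> FArr F (\<eta> X) = Idn B (FObj F X)"
  and triangle_G: "Y \<in> Obj B \<Longrightarrow> FArr G (\<delta> Y) \<cdot>\<^bsub>A\<^esub> \<eta> (FObj G Y) = Idn A (FObj G Y)"
  using adj by (auto simp: adjunction_def)

text \<open>With \<open>transpose_left\<close>, this is the Hom bijection of the adjunction in
  equational form.\<close>

lemma transpose_right:
  assumes "\<phi> \<in> Arr B" "Dom B \<phi> = FObj F X" "X \<in> Obj A"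
  shows "\<delta> (Cod B \<phi>) \<cdot>\<^bsub>B\<^esub> FArr F (FArr G \<phi> \<cdot>\<^bsub>A\<^esub> \<eta> X) = \<phi>"
  using assms Comp_reassoc[OF _ counit_nat[OF assms(1)], of "FArr F (\<eta> X)"] triangle_F[OF assms(3)] by simp

lemma transpose_left:
  assumes "f \<in> Arr A" "Cod A f = FObj G Y" "Y \<in> Obj B"
  shows "FArr G (\<delta> Y \<cdot>\<^bsub>B\<^esub> FArr F f) \<cdot>\<^bsub>A\<^esub> \<eta> (Dom A f) = f"
  using assms Comp_reassoc[OF _ triangle_G[OF assms(3)], of f] unit_nat[OF assms(1)] by simp

lemma opcat_adjoint: "adjoint (opcat B) (opcat A) G F \<delta> \<eta>"
  using adjunction_opcat[OF adj] by unfold_locales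

text \<open>Endomorphisms of G Z are determined by their transposes, which are arrows into Z and
  therefore all equal.\<close>

lemma G_zero_obj:
  assumes "pointed A" "zero_obj B Z"
  shows "zero_obj A (FObj G Z)"
proof -
  have [simp]: "Z \<in> Obj B" using assms by (simp add: zero_obj_def)
  show ?thesis
  proof (rule terminal_zero_obj[OF assms(1)])
    fix f g assume f: "f \<in> Hom A (FObj G Z) (FObj G Z)" and g: "g \<in> Hom A (FObj G Z) (FObj G Z)"
    note [simp] = HomD[OF f] HomD[OF g]
    have "\<delta> Z \<cdot>\<^bsub>B\<^esub> FArr F f = \<delta> Z \<cdot>\<^bsub>B\<^esub> FArr F g"
      by (rule zero_obj_unique(1)[OF assms(2), of "FObj F (FObj G Z)"]) (simp_all add: Hom_def)
    then show "f = g" using transpose_left[of f Z] transpose_left[of g Z] by simp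
  qed simp
qed

lemma G_zero_arr:
  assumes "pointed A" "zero_arr B f"
  shows "zero_arr A (FArr G f)"
proof -
  obtain Z g h where z: "zero_obj B Z" and g: "g \<in> Hom B (Dom B f) Z" and h: "h \<in> Hom B Z (Cod B f)"
    and f: "f = h \<cdot>\<^bsub>B\<^esub> g" and [simp]: "f \<in> Arr B"
    by (rule zero_arrE[OF _ assms(2)]) auto
  note [simp] = HomD[OF g] HomD[OF h]
  have "FArr G f = FArr G h \<cdot>\<^bsub>A\<^esub> FArr G g" by (subst f) simp
  then show ?thesis
    unfolding zero_arr_def using G_zero_obj[OF assms(1) z] functor_Hom[OF G_functor g] functor_Hom[OF G_functor h]
    by auto
qed

lemma F_zero_arr:
  assumes "pointed B" "zero_arr A f"
  shows "zero_arr B (FArr F f)"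
  using adjoint.G_zero_arr[OF opcat_adjoint, of f] assms by simp

lemma G_mono:
  assumes "mono_arr B k"
  shows "mono_arr A (FArr G k)"
proof (rule mono_arrI)
  have [simp]: "k \<in> Arr B" using assms by (simp add: mono_arr_def)
  show "FArr G k \<in> Hom A (FObj G (Dom B k)) (FObj G (Cod B k))" by (simp add: Hom_def)
  fix T u v assume u: "u \<in> Hom A T (FObj G (Dom B k))" and v: "v \<in> Hom A T (FObj G (Dom B k))"
    and e: "FArr G k \<cdot>\<^bsub>A\<^esub> u = FArr G k \<cdot>\<^bsub>A\<^esub> v"
  note [simp] = HomD[OF u] HomD[OF v]
  have [simp]: "T \<in> Obj A" using Hom_in_Obj[OF _ u] by simp
  have *: "k \<cdot>\<^bsub>B\<^esub> (\<delta> (Dom B k) \<cdot>\<^bsub>B\<^esub> FArr F w) = \<delta> (Cod B k) \<cdot>\<^bsub>B\<^esub> FArr F (FArr G k \<cdot>\<^bsub>A\<^esub> w)"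
    if w: "w \<in> Hom A T (FObj G (Dom B k))" for w
    using Comp_reassoc[OF _ counit_nat[of k], of "FArr F w"] HomD[OF w] by simp
  have "\<delta> (Dom B k) \<cdot>\<^bsub>B\<^esub> FArr F u = \<delta> (Dom B k) \<cdot>\<^bsub>B\<^esub> FArr F v"
    by (rule mono_arrD[OF assms, of _ "FObj F T"]) (use *[OF u] *[OF v] e in \<open>auto simp: Hom_def\<close>)
  then show "u = v" using transpose_left[of u "Dom B k"] transpose_left[of v "Dom B k"] by simp
qed

text \<open>Transpose a test arrow h to F X -> Dom f, factor it there through k and transpose back.
  The transposed arrow is killed by f because F, as a left adjoint, preserves zero arrows
  too.\<close>

lemma G_kernel:
  assumes "pointed A" "pointed B" "is_kernel B f k"
  shows "is_kernel A (FArr G f) (FArr G k)"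
proof (rule is_kernelI)
  note k [simp] = kernelD[OF assms(3)]
  show "mono_arr A (FArr G k)" using G_mono[OF kernel_mono[OF _ assms(3)]] by simp
  show "zero_arr A (FArr G f \<cdot>\<^bsub>A\<^esub> FArr G k)" using G_zero_arr[OF assms(1) k(4)] by simp
  fix X h assume h: "h \<in> Hom A X (Dom A (FArr G f))" and z: "zero_arr A (FArr G f \<cdot>\<^bsub>A\<^esub> h)"
  note [simp] = HomD[OF h]
  have [simp]: "X \<in> Obj A" using Hom_in_Obj[OF _ h] by simp
  let ?t = "\<delta> (Dom B f) \<cdot>\<^bsub>B\<^esub> FArr F h"
  have "f \<cdot>\<^bsub>B\<^esub> ?t = \<delta> (Cod B f) \<cdot>\<^bsub>B\<^esub> FArr F (FArr G f \<cdot>\<^bsub>A\<^esub> h)"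
    using Comp_reassoc[OF _ counit_nat[of f], of "FArr F h"] by simp
  then have z': "zero_arr B (f \<cdot>\<^bsub>B\<^esub> ?t)"
    using F_zero_arr[OF assms(2) z] zero_arr_Comp_left[of B "FArr F (FArr G f \<cdot>\<^bsub>A\<^esub> h)" "\<delta> (Cod B f)"] by simp
  have "?t \<in> Hom B (FObj F X) (Dom B f)" by (simp add: Hom_def)
  then obtain u where u: "u \<in> Hom B (FObj F X) (Dom B k)" "k \<cdot>\<^bsub>B\<^esub> u = ?t"
    using z' by (rule kernel_factor[OF assms(3)])
  note [simp] = HomD[OF u(1)]
  have "FArr G k \<cdot>\<^bsub>A\<^esub> (FArr G u \<cdot>\<^bsub>A\<^esub> \<eta> X) = FArr G (k \<cdot>\<^bsub>B\<^esub> u) \<cdot>\<^bsub>A\<^esub> \<eta> X" by simp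
  also have "\<dots> = h" unfolding u(2) using transpose_left[of h "Dom B f"] by simp
  finally show "\<exists>u\<in>Hom A X (Dom A (FArr G k)). FArr G k \<cdot>\<^bsub>A\<^esub> u = h"
    by (intro bexI[of _ "FArr G u \<cdot>\<^bsub>A\<^esub> \<eta> X"]) (simp_all add: Hom_def)
qed (use kernelD[OF assms(3)] in simp_all)

lemma F_cokernel:
  assumes "pointed A" "pointed B" "is_cokernel A f k"
  shows "is_cokernel B (FArr F f) (FArr F k)"
  using adjoint.G_kernel[OF opcat_adjoint, of f k] assms by simp

end

section \<open>Adjunctions with invertible counit\<close>

locale reflection = adjoint +
  assumes counit_iso: "Y \<in> Obj B \<Longrightarrow> iso_arr B (\<delta> Y)"
begin

lemma inv_counit_simps [simp]:
  assumes "Y \<in> Obj B"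
  shows "inv_arr B (\<delta> Y) \<in> Arr B" "Dom B (inv_arr B (\<delta> Y)) = Y" "Cod B (inv_arr B (\<delta> Y)) = FObj F (FObj G Y)"
    "inv_arr B (\<delta> Y) \<cdot>\<^bsub>B\<^esub> \<delta> Y = Idn B (FObj F (FObj G Y))" "\<delta> Y \<cdot>\<^bsub>B\<^esub> inv_arr B (\<delta> Y) = Idn B Y"
  using inv_arr[OF counit_iso[OF assms]] assms by simp_all

lemma G_inv_counit: "Y \<in> Obj B \<Longrightarrow> FArr G (inv_arr B (\<delta> Y)) = \<eta> (FObj G Y)"
proof -
  assume [simp]: "Y \<in> Obj B"
  have "FArr G (inv_arr B (\<delta> Y)) \<cdot>\<^bsub>A\<^esub> (FArr G (\<delta> Y) \<cdot>\<^bsub>A\<^esub> \<eta> (FObj G Y))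
      = FArr G (inv_arr B (\<delta> Y) \<cdot>\<^bsub>B\<^esub> \<delta> Y) \<cdot>\<^bsub>A\<^esub> \<eta> (FObj G Y)"
    by (simp del: inv_counit_simps(4))
  then show ?thesis by (simp add: triangle_G)
qed

lemma inv_counit_F: "X \<in> Obj A \<Longrightarrow> inv_arr B (\<delta> (FObj F X)) = FArr F (\<eta> X)"
proof -
  assume [simp]: "X \<in> Obj A"
  have "inv_arr B (\<delta> (FObj F X)) \<cdot>\<^bsub>B\<^esub> (\<delta> (FObj F X) \<cdot>\<^bsub>B\<^esub> FArr F (\<eta> X)) =
    (inv_arr B (\<delta> (FObj F X)) \<cdot>\<^bsub>B\<^esub> \<delta> (FObj F X)) \<cdot>\<^bsub>B\<^esub> FArr F (\<eta> X)"
    by (simp del: inv_counit_simps(4))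
  then show ?thesis by (simp add: triangle_F)
qed

text \<open>By the triangle identity the unit at G Y is G of the inverse counit. Its inverse
  G(\<delta> Y) is what later matches the counits and the monad multiplications.\<close>

lemma unit_G_iso:
  assumes "Y \<in> Obj B"
  shows "iso_arr A (\<eta> (FObj G Y))" "inv_arr A (\<eta> (FObj G Y)) = FArr G (\<delta> Y)"
  using functor_iso[OF G_functor iso_arr_inv[OF F_simps(2) counit_iso[OF assms]]]
    inv_arr_eqI[of A "\<eta> (FObj G Y)" "FObj G Y" "FObj G (FObj F (FObj G Y))" "FArr G (\<delta> Y)"]
    G_inv_counit[OF assms] triangle_G[OF assms] G_simps(8)[of "\<delta> Y" "inv_arr B (\<delta> Y)"] assms
  by (simp_all add: Hom_def)

lemma F_unit_iso: "X \<in> Obj A \<Longrightarrow> iso_arr B (FArr F (\<eta> X))"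
  using iso_arr_inv[OF F_simps(2) counit_iso[of "FObj F X"]] inv_counit_F[of X] by simp

text \<open>Naturality of the counit recovers \<phi> \<delta> from G \<phi>, and the invertible
  \<delta> cancels.\<close>

lemma G_faithful:
  assumes "\<phi> \<in> Hom B X Y" "\<psi> \<in> Hom B X Y" "FArr G \<phi> = FArr G \<psi>"
  shows "\<phi> = \<psi>"
proof -
  note [simp] = HomD[OF assms(1)] HomD[OF assms(2)] Hom_in_Obj[OF F_simps(2) assms(1)]
  have "\<phi> \<cdot>\<^bsub>B\<^esub> \<delta> X = \<psi> \<cdot>\<^bsub>B\<^esub> \<delta> X" using counit_nat[of \<phi>] counit_nat[of \<psi>] assms(3) by simp
  then show ?thesis by (rule epi_arrD[OF iso_epi[OF _ counit_iso[of X]], rotated -1, of _ _ Y]) (simp_all add: assms)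
qed

lemma G_full:
  assumes "f \<in> Hom A (FObj G X) (FObj G Y)" "X \<in> Obj B" "Y \<in> Obj B"
  shows "\<delta> Y \<cdot>\<^bsub>B\<^esub> (FArr F f \<cdot>\<^bsub>B\<^esub> inv_arr B (\<delta> X)) \<in> Hom B X Y"
    "FArr G (\<delta> Y \<cdot>\<^bsub>B\<^esub> (FArr F f \<cdot>\<^bsub>B\<^esub> inv_arr B (\<delta> X))) = f"
proof -
  note [simp] = HomD[OF assms(1)] assms(2,3)
  show "\<delta> Y \<cdot>\<^bsub>B\<^esub> (FArr F f \<cdot>\<^bsub>B\<^esub> inv_arr B (\<delta> X)) \<in> Hom B X Y" by (simp add: Hom_def)
  show "FArr G (\<delta> Y \<cdot>\<^bsub>B\<^esub> (FArr F f \<cdot>\<^bsub>B\<^esub> inv_arr B (\<delta> X))) = f"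
    using unit_nat[of f] by (simp add: G_inv_counit Comp_reassoc[OF _ triangle_G])
qed

end

section \<open>Reflective subcategories of an abelian category with exact reflector\<close>

text \<open>Assuming preservation of kernels amounts to exactness of F, since a left adjoint
  preserves cokernels by \<open>F_cokernel\<close>.\<close>

locale exact_reflection = reflection A B F G \<eta> \<delta> + abelian A add
  for A :: "('o, 'm) cat" and B :: "('p, 'n) cat" and F G \<eta> \<delta> add +
  assumes F_kernel: "is_kernel A f k \<Longrightarrow> is_kernel B (FArr F f) (FArr F k)"
begin

text \<open>The preimage formula of \<open>G_full\<close> applied to a sum in A: the only addition
  that makes the fully faithful G additive.\<close>

definition add' :: "'n \<Rightarrow> 'n \<Rightarrow> 'n" where
  "add' \<phi> \<psi> = \<delta> (Cod B \<phi>) \<cdot>\<^bsub>B\<^esub> (FArr F (add (FArr G \<phi>) (FArr G \<psi>)) \<cdot>\<^bsub>B\<^esub> inv_arr B (\<delta> (Dom B \<phi>)))"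

lemma add':
  assumes "\<phi> \<in> Hom B X Y" "\<psi> \<in> Hom B X Y"
  shows "add' \<phi> \<psi> \<in> Hom B X Y" "FArr G (add' \<phi> \<psi>) = add (FArr G \<phi>) (FArr G \<psi>)"
  using G_full[OF add_Hom[OF preadditive functor_Hom[OF G_functor assms(1)] functor_Hom[OF G_functor assms(2)]]]
    Hom_in_Obj[OF F_simps(2) assms(1)] HomD[OF assms(1)]
  by (simp_all add: add'_def)

text \<open>Additivity of F, expressed through G. The arrows F f + F g and F (f + g) have the same
  transpose \<eta> (f + g), by naturality of the unit and distributivity in A.\<close>

lemma GF_add:
  assumes "f \<in> Hom A X Y" "g \<in> Hom A X Y"
  shows "add (FArr G (FArr F f)) (FArr G (FArr F g)) = FArr G (FArr F (add f g))"
proof -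
  note [simp] = HomD[OF assms(1)] HomD[OF assms(2)] Hom_in_Obj[OF F_simps(1) assms(1)]
    HomD[OF add_Hom[OF preadditive assms]]
  have m: "add' (FArr F f) (FArr F g) \<in> Hom B (FObj F X) (FObj F Y)"
    "FArr G (add' (FArr F f) (FArr F g)) = add (FArr G (FArr F f)) (FArr G (FArr F g))"
    using add'[OF functor_Hom[OF F_functor assms(1)] functor_Hom[OF F_functor assms(2)]] by auto
  note [simp] = HomD[OF m(1)]
  have "FArr G (add' (FArr F f) (FArr F g)) \<cdot>\<^bsub>A\<^esub> \<eta> X = add (\<eta> Y \<cdot>\<^bsub>A\<^esub> f) (\<eta> Y \<cdot>\<^bsub>A\<^esub> g)"
    unfolding m(2) using unit_nat[of f] unit_nat[of g]
      add_Comp[OF preadditive, of "\<eta> X" X _ "FArr G (FArr F f)" _ "FArr G (FArr F g)"]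
    by (simp add: Hom_def)
  also have "\<dots> = \<eta> Y \<cdot>\<^bsub>A\<^esub> add f g" using Comp_add_Arr[OF assms, of "\<eta> Y"] by simp
  also have "\<dots> = FArr G (FArr F (add f g)) \<cdot>\<^bsub>A\<^esub> \<eta> X" using unit_nat[of "add f g"] by simp
  finally have "add' (FArr F f) (FArr F g) = FArr F (add f g)"
    using transpose_right[of "add' (FArr F f) (FArr F g)" X] transpose_right[of "FArr F (add f g)" X] by simp
  then show ?thesis using m(2) by simp
qed

lemma preadditive': "preadditive B add'"
  unfolding preadditive_def
proof (intro conjI ballI)
  show "category B" by simp
next
  fix X Y assume o: "X \<in> Obj B" "Y \<in> Obj B"
  let ?H = "hom_group A add (FObj G X) (FObj G Y)"
  interpret H: comm_group ?H
    by (rule comm_group_Hom[OF preadditive]) (simp_all add: o)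
  have carrier_H: "carrier ?H = Hom A (FObj G X) (FObj G Y)" and mult_H: "mult ?H = add"
    using hom_group_simps[OF preadditive] by auto
  have G: "FArr G \<phi> \<in> carrier ?H" if "\<phi> \<in> Hom B X Y" for \<phi>
    using functor_Hom[OF G_functor that] carrier_H by simp
  have full: "\<exists>\<phi> \<in> Hom B X Y. FArr G \<phi> = f" if "f \<in> carrier ?H" for f
    using G_full[of f X Y] that o carrier_H by blast
  have add: "add' \<phi> \<psi> \<in> Hom B X Y" "FArr G (add' \<phi> \<psi>) = FArr G \<phi> \<otimes>\<^bsub>?H\<^esub> FArr G \<psi>"
    if "\<phi> \<in> Hom B X Y" "\<psi> \<in> Hom B X Y" for \<phi> \<psi>
    using add'[OF that] mult_H by auto
  obtain z where z: "z \<in> Hom B X Y" "FArr G z = \<one>\<^bsub>?H\<^esub>" using full[OF H.one_closed] by blast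
  have "comm_group \<lparr>carrier = Hom B X Y, mult = add', one = z\<rparr>"
  \<comment> \<open>Cases 3 to 6 are associativity, commutativity, left unit and left inverse. The
    equations are checked after applying the faithful G, and fullness supplies the inverse.\<close>
  proof (rule comm_groupI, goal_cases)
    case (3 x y w)
    then show ?case
      by (auto intro!: G_faithful[of _ X Y] simp: add G H.m_assoc)
  next
    case (4 x y)
    then show ?case
      by (auto intro!: G_faithful[of _ X Y] simp: add G H.m_comm)
  next
    case (5 x)
    then show ?case
      using z by (auto intro!: G_faithful[of _ X Y] simp: add G)
  next
    case (6 x)
    then have x: "x \<in> Hom B X Y" by simp
    obtain y where y: "y \<in> Hom B X Y" "FArr G y = inv\<^bsub>?H\<^esub> (FArr G x)" using full[OF H.inv_closed[OF G[OF x]]] by blast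
    have "add' y x = z"
      by (rule G_faithful[of _ X Y]) (simp_all add: add x y z G)
    then show ?case using y(1) by auto
  qed (use add z in auto)
  then show "\<exists>z. comm_group \<lparr>carrier = Hom B X Y, mult = add', one = z\<rparr>" by blast
next
  fix X Y Z f f' g g' assume f: "f \<in> Hom B X Y" and f': "f' \<in> Hom B X Y" and g: "g \<in> Hom B Y Z" and g': "g' \<in> Hom B Y Z"
  note [simp] = HomD[OF f] HomD[OF f'] HomD[OF g] HomD[OF g']
    HomD[OF add'(1)[OF f f']] HomD[OF add'(1)[OF g g']]
  have gf: "g \<cdot>\<^bsub>B\<^esub> f \<in> Hom B X Z" "g \<cdot>\<^bsub>B\<^esub> f' \<in> Hom B X Z" "g' \<cdot>\<^bsub>B\<^esub> f \<in> Hom B X Z" by (simp_all add: Hom_def)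
  show "g \<cdot>\<^bsub>B\<^esub> add' f f' = add' (g \<cdot>\<^bsub>B\<^esub> f) (g \<cdot>\<^bsub>B\<^esub> f')"
  proof (rule G_faithful[of _ X Z])
    show "FArr G (g \<cdot>\<^bsub>B\<^esub> add' f f') = FArr G (add' (g \<cdot>\<^bsub>B\<^esub> f) (g \<cdot>\<^bsub>B\<^esub> f'))"
      using add'(2)[OF f f'] add'(2)[OF gf(1,2)]
        Comp_add[OF preadditive functor_Hom[OF G_functor f] functor_Hom[OF G_functor f'] functor_Hom[OF G_functor g]]
      by simp
  qed (use add'(1)[OF gf(1,2)] in \<open>simp_all add: Hom_def\<close>)
  show "add' g g' \<cdot>\<^bsub>B\<^esub> f = add' (g \<cdot>\<^bsub>B\<^esub> f) (g' \<cdot>\<^bsub>B\<^esub> f)"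
  proof (rule G_faithful[of _ X Z])
    show "FArr G (add' g g' \<cdot>\<^bsub>B\<^esub> f) = FArr G (add' (g \<cdot>\<^bsub>B\<^esub> f) (g' \<cdot>\<^bsub>B\<^esub> f))"
      using add'(2)[OF g g'] add'(2)[OF gf(1,3)]
        add_Comp[OF preadditive functor_Hom[OF G_functor f] functor_Hom[OF G_functor g] functor_Hom[OF G_functor g']]
      by simp
  qed (use add'(1)[OF gf(1,3)] in \<open>simp_all add: Hom_def\<close>)
qed

text \<open>F of a zero object has one endomorphism, because transposes of such are arrows out of a
  zero object; the Hom groups of B do the rest.\<close>

lemma pointed': "pointed B"
proof -
  obtain Z where z: "zero_obj A Z" using pointed by (auto simp: pointed_def)
  then have [simp]: "Z \<in> Obj A" by (simp add: zero_obj_def)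
  have "zero_obj B (FObj F Z)"
  proof (rule preadditive_zero_obj[OF preadditive'])
    fix f g assume f: "f \<in> Hom B (FObj F Z) (FObj F Z)" and g: "g \<in> Hom B (FObj F Z) (FObj F Z)"
    note [simp] = HomD[OF f] HomD[OF g]
    have "FArr G f \<cdot>\<^bsub>A\<^esub> \<eta> Z = FArr G g \<cdot>\<^bsub>A\<^esub> \<eta> Z"
      by (rule zero_obj_unique(2)[OF z, of "FObj G (FObj F Z)"]) (simp_all add: Hom_def)
    then show "f = g" using transpose_right[of f Z] transpose_right[of g Z] by simp
  qed simp
  then show ?thesis by (auto simp: pointed_def)
qed

text \<open>F is applied to the biproduct of G X and G Y, and the counit replaces F G X and F G Y by
  X and Y. \<open>GF_add\<close> gives the decomposition of the identity.\<close>

lemma biproducts': "has_biproducts B add'"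
  unfolding has_biproducts_def
proof (intro ballI)
  fix X Y assume [simp]: "X \<in> Obj B" "Y \<in> Obj B"
  obtain W i j p q where W: "W \<in> Obj A" and i: "i \<in> Hom A (FObj G X) W" and j: "j \<in> Hom A (FObj G Y) W"
    and p: "p \<in> Hom A W (FObj G X)" and q: "q \<in> Hom A W (FObj G Y)"
    and e: "p \<cdot>\<^bsub>A\<^esub> i = Idn A (FObj G X)" "q \<cdot>\<^bsub>A\<^esub> j = Idn A (FObj G Y)"
      "add (i \<cdot>\<^bsub>A\<^esub> p) (j \<cdot>\<^bsub>A\<^esub> q) = Idn A W"
    by (rule biproduct_ex[of "FObj G X" "FObj G Y"]) auto
  note [simp] = HomD[OF i] HomD[OF j] HomD[OF p] HomD[OF q] W
  let ?i = "FArr F i \<cdot>\<^bsub>B\<^esub> inv_arr B (\<delta> X)" and ?j = "FArr F j \<cdot>\<^bsub>B\<^esub> inv_arr B (\<delta> Y)"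
  let ?p = "\<delta> X \<cdot>\<^bsub>B\<^esub> FArr F p" and ?q = "\<delta> Y \<cdot>\<^bsub>B\<^esub> FArr F q"
  have F: "FArr F p \<cdot>\<^bsub>B\<^esub> FArr F i = Idn B (FObj F (FObj G X))" "FArr F q \<cdot>\<^bsub>B\<^esub> FArr F j = Idn B (FObj F (FObj G Y))"
    using e by (simp_all flip: F_simps(8))
  have ip: "i \<cdot>\<^bsub>A\<^esub> p \<in> Hom A W W" and jq: "j \<cdot>\<^bsub>A\<^esub> q \<in> Hom A W W" by (simp_all add: Hom_def)
  have ip': "?i \<cdot>\<^bsub>B\<^esub> ?p = FArr F (i \<cdot>\<^bsub>A\<^esub> p)" and jq': "?j \<cdot>\<^bsub>B\<^esub> ?q = FArr F (j \<cdot>\<^bsub>A\<^esub> q)"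
    by (simp_all add: Comp_reassoc[OF _ inv_counit_simps(4)])
  have "add' (FArr F (i \<cdot>\<^bsub>A\<^esub> p)) (FArr F (j \<cdot>\<^bsub>A\<^esub> q)) = Idn B (FObj F W)"
  proof (rule G_faithful[of _ "FObj F W" "FObj F W"])
    have F2: "FArr F (i \<cdot>\<^bsub>A\<^esub> p) \<in> Hom B (FObj F W) (FObj F W)" "FArr F (j \<cdot>\<^bsub>A\<^esub> q) \<in> Hom B (FObj F W) (FObj F W)"
      by (rule functor_Hom[OF F_functor ip], rule functor_Hom[OF F_functor jq])
    show "add' (FArr F (i \<cdot>\<^bsub>A\<^esub> p)) (FArr F (j \<cdot>\<^bsub>A\<^esub> q)) \<in> Hom B (FObj F W) (FObj F W)"
      by (rule add'(1)[OF F2])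
    show "FArr G (add' (FArr F (i \<cdot>\<^bsub>A\<^esub> p)) (FArr F (j \<cdot>\<^bsub>A\<^esub> q))) = FArr G (Idn B (FObj F W))"
      unfolding add'(2)[OF F2] GF_add[OF ip jq] e(3) by simp
  qed (simp add: Hom_def)
  then have s: "add' (?i \<cdot>\<^bsub>B\<^esub> ?p) (?j \<cdot>\<^bsub>B\<^esub> ?q) = Idn B (FObj F W)" using ip' jq' by simp
  show "\<exists>W\<in>Obj B. \<exists>i\<in>Hom B X W. \<exists>j\<in>Hom B Y W. \<exists>p\<in>Hom B W X. \<exists>q\<in>Hom B W Y.
       p \<cdot>\<^bsub>B\<^esub> i = Idn B X \<and> q \<cdot>\<^bsub>B\<^esub> j = Idn B Y \<and> add' (i \<cdot>\<^bsub>B\<^esub> p) (j \<cdot>\<^bsub>B\<^esub> q) = Idn B W"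
  proof (intro bexI conjI)
    show "add' (?i \<cdot>\<^bsub>B\<^esub> ?p) (?j \<cdot>\<^bsub>B\<^esub> ?q) = Idn B (FObj F W)" by (rule s)
    show "?p \<cdot>\<^bsub>B\<^esub> ?i = Idn B X" "?q \<cdot>\<^bsub>B\<^esub> ?j = Idn B Y"
      by (simp_all add: Comp_reassoc[OF _ F(1)] Comp_reassoc[OF _ F(2)])
  qed (simp_all add: Hom_def)
qed

text \<open>Along the counit, an arrow \<open>f\<close> of \<open>B\<close> is isomorphic to \<open>F G f\<close>.\<close>

lemma kernel':
  assumes "f \<in> Arr B" "is_kernel B (FArr F (FArr G f)) k"
  shows "is_kernel B f (\<delta> (Dom B f) \<cdot>\<^bsub>B\<^esub> k)"
proof -
  note [simp] = assms(1) kernelD(1-3)[OF assms(2)]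
  show ?thesis
    by (rule kernel_transport[OF _ assms(2), where \<alpha> = "\<delta> (Dom B f)" and \<beta> = "\<delta> (Cod B f)" and \<gamma> = "Idn B (Dom B k)"])
      (simp_all add: iso_arr_Idn counit_iso iso_mono counit_nat)
qed

lemma cokernel':
  assumes "f \<in> Arr B" "is_cokernel B (FArr F (FArr G f)) c"
  shows "is_cokernel B f (c \<cdot>\<^bsub>B\<^esub> inv_arr B (\<delta> (Cod B f)))"
proof -
  note [simp] = assms(1) cokernelD(1-3)[OF assms(2)]
  have e: "inv_arr B (\<delta> (Cod B f)) \<cdot>\<^bsub>B\<^esub> f = FArr F (FArr G f) \<cdot>\<^bsub>B\<^esub> inv_arr B (\<delta> (Dom B f))"
  proof -
    have "inv_arr B (\<delta> (Cod B f)) \<cdot>\<^bsub>B\<^esub> f = inv_arr B (\<delta> (Cod B f)) \<cdot>\<^bsub>B\<^esub> (f \<cdot>\<^bsub>B\<^esub> \<delta> (Dom B f)) \<cdot>\<^bsub>B\<^esub> inv_arr B (\<delta> (Dom B f))"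
      by simp
    also have "\<dots> = FArr F (FArr G f) \<cdot>\<^bsub>B\<^esub> inv_arr B (\<delta> (Dom B f))"
      unfolding counit_nat[OF assms(1), symmetric] by (simp add: Comp_reassoc[OF _ inv_counit_simps(4)])
    finally show ?thesis .
  qed
  show ?thesis
    by (rule cokernel_transport[OF _ assms(2), where \<alpha> = "inv_arr B (\<delta> (Cod B f))" and
          \<beta> = "inv_arr B (\<delta> (Dom B f))" and \<gamma> = "Idn B (Cod B c)"])
      (simp_all add: iso_arr_Idn iso_arr_inv counit_iso iso_epi e)
qed

text \<open>G f is mono, hence the kernel of its cokernel in A. F preserves this kernel, and
  conjugation by the counit turns F G f back into f.\<close>

lemma mono_normal':
  assumes "mono_arr B f"
  shows "\<exists>g. is_kernel B g f"
proof -
  have [simp]: "f \<in> Arr B" using assms by (simp add: mono_arr_def)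
  obtain c where c: "is_cokernel A (FArr G f) c" by (rule cokernel_ex[of "FArr G f"]) auto
  have k: "is_kernel B (FArr F c) (FArr F (FArr G f))"
    by (rule F_kernel[OF kernel_cokernel[OF c G_mono[OF assms]]])
  note [simp] = cokernelD[OF c]
  let ?g = "FArr F c \<cdot>\<^bsub>B\<^esub> inv_arr B (\<delta> (Cod B f))"
  have "f = \<delta> (Cod B f) \<cdot>\<^bsub>B\<^esub> (FArr F (FArr G f) \<cdot>\<^bsub>B\<^esub> inv_arr B (\<delta> (Dom B f)))"
    by (simp add: Comp_reassoc[OF _ counit_nat])
  then have "is_kernel B ?g f"
    by (intro kernel_transport[OF _ k, where \<alpha> = "\<delta> (Cod B f)" and \<beta> = "Idn B (FObj F (Cod A c))" and
          \<gamma> = "inv_arr B (\<delta> (Dom B f))"])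
      (simp_all add: iso_arr_Idn iso_arr_inv counit_iso iso_mono)
  then show ?thesis by blast
qed

text \<open>Factor \<open>G f = m e\<close> with \<open>m\<close> the kernel of the cokernel \<open>c\<close> of \<open>G f\<close>. As \<open>f\<close> is epi, \<open>F c = 0\<close>, so
  \<open>F m\<close>, being a kernel of \<open>F c\<close>, is invertible, and \<open>f\<close> is a cokernel because \<open>F e\<close> is one.\<close>

lemma epi_normal':
  assumes "epi_arr B f"
  shows "\<exists>g. is_cokernel B g f"
proof -
  have [simp]: "f \<in> Arr B" using assms by (simp add: epi_arr_def)
  obtain c where c: "is_cokernel A (FArr G f) c" by (rule cokernel_ex[of "FArr G f"]) auto
  note [simp] = cokernelD(1-3)[OF c]
  obtain m where m: "is_kernel A c m" by (rule kernel_ex[of c]) auto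
  obtain e where e: "e \<in> Hom A (Dom A (FArr G f)) (Dom A m)" "m \<cdot>\<^bsub>A\<^esub> e = FArr G f" "epi_arr A e"
    by (rule image_epi[OF c m])
  note [simp] = kernelD(1-3)[OF m] HomD[OF e(1)]
  obtain k where k: "is_kernel A e k" by (rule kernel_ex[of e]) auto
  note [simp] = kernelD(1-3)[OF k]
  have Fe: "is_cokernel B (FArr F k) (FArr F e)"
    by (rule F_cokernel[OF pointed pointed' cokernel_kernel[OF k e(3)]])
  have Fm: "is_kernel B (FArr F c) (FArr F m)" by (rule F_kernel[OF m])
  have fact: "FArr F m \<cdot>\<^bsub>B\<^esub> FArr F e = FArr F (FArr G f)" using e(2) by (simp flip: F_simps(8))
  let ?c = "FArr F c \<cdot>\<^bsub>B\<^esub> inv_arr B (\<delta> (Cod B f))"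
  have cok: "is_cokernel B f ?c" by (rule cokernel'[OF _ F_cokernel[OF pointed pointed' c]]) simp
  have "?c = zr B (Cod B f) (FObj F (Cod A c))"
  proof (rule epi_arrD[OF assms])
    show "?c \<cdot>\<^bsub>B\<^esub> f = zr B (Cod B f) (FObj F (Cod A c)) \<cdot>\<^bsub>B\<^esub> f"
      using cokernelD(4)[OF cok] zero_arr_iff[OF pointed'] by (simp add: pointed')
  qed (simp_all add: Hom_def pointed')
  then have "?c \<cdot>\<^bsub>B\<^esub> \<delta> (Cod B f) = zr B (FObj F (FObj G (Cod B f))) (FObj F (Cod A c))"
    by (simp add: pointed' del: Comp_assoc)
  then have "zero_arr B (FArr F c)"
    using zero_arr_zr[OF pointed', of "FObj F (FObj G (Cod B f))" "FObj F (Cod A c)"] by simp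
  then have Fm_iso: "iso_arr B (FArr F m)" by (rule zero_kernel_iso[OF _ Fm, rotated]) simp
  let ?g = "\<delta> (Dom B f) \<cdot>\<^bsub>B\<^esub> FArr F k"
  have "is_cokernel B ?g f"
  proof (rule cokernel_transport[OF _ Fe, where \<alpha> = "inv_arr B (\<delta> (Dom B f))" and
        \<beta> = "Idn B (FObj F (Dom A k))" and \<gamma> = "\<delta> (Cod B f) \<cdot>\<^bsub>B\<^esub> FArr F m"])
    show "iso_arr B (\<delta> (Cod B f) \<cdot>\<^bsub>B\<^esub> FArr F m)"
      by (rule iso_arr_Comp) (simp_all add: Fm_iso counit_iso)
    show "f = (\<delta> (Cod B f) \<cdot>\<^bsub>B\<^esub> FArr F m) \<cdot>\<^bsub>B\<^esub> (FArr F e \<cdot>\<^bsub>B\<^esub> inv_arr B (\<delta> (Dom B f)))"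
      by (simp add: Comp_reassoc[OF _ fact] Comp_reassoc[OF _ counit_nat])
  qed (simp_all add: iso_arr_Idn iso_arr_inv counit_iso iso_epi Comp_reassoc[OF _ inv_counit_simps(4)])
  then show ?thesis by blast
qed

theorem abelian': "abelian_category B"
  unfolding abelian_category_def
proof (intro conjI ballI allI impI)
  show "\<exists>add. preadditive B add \<and> has_biproducts B add" using preadditive' biproducts' by blast
  show "\<exists>Z. zero_obj B Z" using pointed' by (simp add: pointed_def)
  fix f assume [simp]: "f \<in> Arr B"
  show "\<exists>k. is_kernel B f k"
    using kernel_ex[of "FArr G f"] kernel'[OF _ F_kernel] by (metis \<open>f \<in> Arr B\<close> G_simps(4))
  show "\<exists>c. is_cokernel B f c"
    using cokernel_ex[of "FArr G f"] cokernel'[OF _ F_cokernel[OF pointed pointed']] by (metis \<open>f \<in> Arr B\<close> G_simps(4))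
qed (simp_all add: mono_normal' epi_normal')

end

section \<open>The Serre quotient\<close>

context thick_subcategory
begin

lemma germsD:
  assumes "(i, p, f) \<in> germs A C M N"
  shows "sub_with_quot_in A C M i" "quot_by_sub A C N p" "f \<in> Hom A (Dom A i) (Cod A p)"
  using assms by (auto simp: germs_def)

lemma germ_relI:
  assumes "(i, p, f) \<in> germs A C M N" "(i', p', f') \<in> germs A C M N"
    "sub_with_quot_in A C M i0" "quot_by_sub A C N p0"
    "a \<in> Hom A (Dom A i0) (Dom A i)" "a' \<in> Hom A (Dom A i0) (Dom A i')"
    "b \<in> Hom A (Cod A p) (Cod A p0)" "b' \<in> Hom A (Cod A p') (Cod A p0)"
    "i \<cdot> a = i0" "i' \<cdot> a' = i0" "b \<cdot> p = p0" "b' \<cdot> p' = p0"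
    "b \<cdot> (f \<cdot> a) = b' \<cdot> (f' \<cdot> a')"
  shows "((i, p, f), (i', p', f')) \<in> germ_rel A C M N"
  using assms unfolding germ_rel_def by blast

lemma germ_relE:
  assumes "((i, p, f), (i', p', f')) \<in> germ_rel A C M N"
  obtains i0 p0 a a' b b' where "(i, p, f) \<in> germs A C M N" "(i', p', f') \<in> germs A C M N"
    "sub_with_quot_in A C M i0" "quot_by_sub A C N p0"
    "a \<in> Hom A (Dom A i0) (Dom A i)" "a' \<in> Hom A (Dom A i0) (Dom A i')"
    "b \<in> Hom A (Cod A p) (Cod A p0)" "b' \<in> Hom A (Cod A p') (Cod A p0)"
    "i \<cdot> a = i0" "i' \<cdot> a' = i0" "b \<cdot> p = p0" "b' \<cdot> p' = p0"
    "b \<cdot> (f \<cdot> a) = b' \<cdot> (f' \<cdot> a')"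
proof -
  have "(i, p, f) \<in> germs A C M N \<and> (i', p', f') \<in> germs A C M N \<and>
     (\<exists>i0 p0. sub_with_quot_in A C M i0 \<and> quot_by_sub A C N p0 \<and>
        (\<exists>a \<in> Hom A (Dom A i0) (Dom A i). \<exists>a' \<in> Hom A (Dom A i0) (Dom A i').
         \<exists>b \<in> Hom A (Cod A p) (Cod A p0). \<exists>b' \<in> Hom A (Cod A p') (Cod A p0).
           i \<cdot> a = i0 \<and> i' \<cdot> a' = i0 \<and> b \<cdot> p = p0 \<and> b' \<cdot> p' = p0 \<and>
           b \<cdot> (f \<cdot> a) = b' \<cdot> (f' \<cdot> a')))"
    using assms unfolding germ_rel_def by simp
  then show thesis using that by blast
qed

lemma germ_rel_sym:
  assumes "(x, y) \<in> germ_rel A C M N"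
  shows "(y, x) \<in> germ_rel A C M N"
proof -
  obtain i p f i' p' f' where [simp]: "x = (i, p, f)" "y = (i', p', f')" by (metis prod_cases3)
  show ?thesis using assms unfolding \<open>x = _\<close> \<open>y = _\<close>
    by (rule germ_relE) (rule germ_relI, assumption+, rule sym)
qed

lemma germ_rel_refl:
  assumes "x \<in> germs A C M N"
  shows "(x, x) \<in> germ_rel A C M N"
proof -
  obtain i p f where x: "x = (i, p, f)" by (metis prod_cases3)
  note g = germsD[OF assms[unfolded x]]
  note [simp] = sub_with_quot_inD[OF g(1)] quot_by_subD[OF g(2)]
  show ?thesis unfolding x
    by (rule germ_relI[OF assms[unfolded x] assms[unfolded x] g(1,2),
          where a = "Idn A (Dom A i)" and a' = "Idn A (Dom A i)" and b = "Idn A (Cod A p)" and b' = "Idn A (Cod A p)"])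
       (simp_all add: Hom_def)
qed

text \<open>Refine the two comparison indices to a common one. The two resulting comparisons with
  the middle germ agree because its subobject arrow is mono and its quotient arrow is epi; these are
  the equations \<open>l\<close> and \<open>r\<close>.\<close>

lemma germ_rel_trans:
  assumes "(x, y) \<in> germ_rel A C M N" "(y, z) \<in> germ_rel A C M N"
  shows "(x, z) \<in> germ_rel A C M N"
proof -
  obtain i p f i' p' f' i'' p'' f'' where xyz: "x = (i, p, f)" "y = (i', p', f')" "z = (i'', p'', f'')"
    by (metis prod_cases3)
  obtain i0 p0 a a' b b' where g: "(i, p, f) \<in> germs A C M N" "(i', p', f') \<in> germs A C M N"
    and i0: "sub_with_quot_in A C M i0" and p0: "quot_by_sub A C N p0"
    and ab: "a \<in> Hom A (Dom A i0) (Dom A i)" "a' \<in> Hom A (Dom A i0) (Dom A i')"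
    "b \<in> Hom A (Cod A p) (Cod A p0)" "b' \<in> Hom A (Cod A p') (Cod A p0)"
    and e: "i \<cdot> a = i0" "i' \<cdot> a' = i0" "b \<cdot> p = p0" "b' \<cdot> p' = p0"
    "b \<cdot> (f \<cdot> a) = b' \<cdot> (f' \<cdot> a')"
    using assms(1)[unfolded xyz] by (rule germ_relE)
  obtain i1 p1 c c' d d' where g'': "(i'', p'', f'') \<in> germs A C M N"
    and i1: "sub_with_quot_in A C M i1" and p1: "quot_by_sub A C N p1"
    and cd: "c \<in> Hom A (Dom A i1) (Dom A i')" "c' \<in> Hom A (Dom A i1) (Dom A i'')"
    "d \<in> Hom A (Cod A p') (Cod A p1)" "d' \<in> Hom A (Cod A p'') (Cod A p1)"
    and e': "i' \<cdot> c = i1" "i'' \<cdot> c' = i1" "d \<cdot> p' = p1" "d' \<cdot> p'' = p1"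
    "d \<cdot> (f' \<cdot> c) = d' \<cdot> (f'' \<cdot> c')"
    using assms(2)[unfolded xyz] by (rule germ_relE)
  obtain i2 u v where i2: "sub_with_quot_in A C M i2" and uv: "u \<in> Hom A (Dom A i2) (Dom A i0)"
    "v \<in> Hom A (Dom A i2) (Dom A i1)" "i0 \<cdot> u = i2" "i1 \<cdot> v = i2"
    by (rule sub_inter[OF i0 i1])
  obtain p2 w x' where p2: "quot_by_sub A C N p2" and wx: "w \<in> Hom A (Cod A p0) (Cod A p2)"
    "x' \<in> Hom A (Cod A p1) (Cod A p2)" "w \<cdot> p0 = p2" "x' \<cdot> p1 = p2"
    by (rule quot_join[OF p0 p1])
  note germ = germsD[OF g(1)] germsD[OF g(2)] germsD[OF g'']
  note [simp] = HomD[OF germ(3)] HomD[OF germ(6)] HomD[OF germ(9)]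
    sub_with_quot_inD[OF germ(1)] sub_with_quot_inD[OF germ(4)] sub_with_quot_inD[OF germ(7)]
    quot_by_subD[OF germ(2)] quot_by_subD[OF germ(5)] quot_by_subD[OF germ(8)]
    sub_with_quot_inD[OF i0] sub_with_quot_inD[OF i1] quot_by_subD[OF p0] quot_by_subD[OF p1]
    HomD[OF ab(1)] HomD[OF ab(2)] HomD[OF ab(3)] HomD[OF ab(4)]
    HomD[OF cd(1)] HomD[OF cd(2)] HomD[OF cd(3)] HomD[OF cd(4)]
    HomD[OF uv(1)] HomD[OF uv(2)] HomD[OF wx(1)] HomD[OF wx(2)]
  have l: "a' \<cdot> u = c \<cdot> v"
  proof (rule mono_arrD[OF sub_with_quot_inD(3)[OF germ(4)]])
    show "i' \<cdot> (a' \<cdot> u) = i' \<cdot> (c \<cdot> v)"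
      using uv(3,4) by (simp add: Comp_reassoc[OF category e(2)] Comp_reassoc[OF category e'(1)])
  qed (simp_all add: Hom_def)
  have r: "w \<cdot> b' = x' \<cdot> d"
    by (rule epi_arrD[OF quot_by_subD(3)[OF germ(5)]]) (use wx(3,4) in \<open>simp_all add: Hom_def e e'\<close>)
  have "(w \<cdot> b) \<cdot> (f \<cdot> (a \<cdot> u)) = w \<cdot> ((b \<cdot> (f \<cdot> a)) \<cdot> u)" by simp
  also have "\<dots> = (w \<cdot> b') \<cdot> (f' \<cdot> (a' \<cdot> u))" unfolding e(5) by simp
  also have "\<dots> = x' \<cdot> ((d \<cdot> (f' \<cdot> c)) \<cdot> v)" unfolding l r by simp
  also have "\<dots> = (x' \<cdot> d') \<cdot> (f'' \<cdot> (c' \<cdot> v))" unfolding e'(5) by simp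
  finally have m: "(w \<cdot> b) \<cdot> (f \<cdot> (a \<cdot> u)) = (x' \<cdot> d') \<cdot> (f'' \<cdot> (c' \<cdot> v))" .
  show ?thesis unfolding xyz
  proof (rule germ_relI[OF g(1) g'' i2 p2 _ _ _ _ _ _ _ _ m])
    show "i \<cdot> (a \<cdot> u) = i2" using uv(3) by (simp add: Comp_reassoc[OF category e(1)])
    show "i'' \<cdot> (c' \<cdot> v) = i2" using uv(4) by (simp add: Comp_reassoc[OF category e'(2)])
    show "(w \<cdot> b) \<cdot> p = p2" using wx(3) by (simp add: e)
    show "(x' \<cdot> d') \<cdot> p'' = p2" using wx(4) by (simp add: e')
  qed (simp_all add: Hom_def)
qed

lemma equiv_germ_rel: "equiv (germs A C M N) (germ_rel A C M N)"
proof (rule equivI)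
  show "germ_rel A C M N \<subseteq> germs A C M N \<times> germs A C M N" by (auto simp: germ_rel_def)
  show "refl_on (germs A C M N) (germ_rel A C M N)"
    using germ_rel_refl by (simp add: refl_on_def)
  show "sym (germ_rel A C M N)" using germ_rel_sym by (auto intro: symI)
  show "trans (germ_rel A C M N)" using germ_rel_trans by (auto intro: transI)
qed

definition germ_arr :: "'a \<Rightarrow> 'a \<Rightarrow> 'b germ \<Rightarrow> ('a, 'b) quot_arr" where
  "germ_arr M N x = (M, N, germ_class A C M N x)"

lemma germ_arr_eq_iff:
  assumes "x \<in> germs A C M N" "y \<in> germs A C M N"
  shows "germ_arr M N x = germ_arr M N y \<longleftrightarrow> (x, y) \<in> germ_rel A C M N"
  using eq_equiv_class_iff[OF equiv_germ_rel assms] by (simp add: germ_arr_def germ_class_def)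

lemma germs_Obj:
  assumes "x \<in> germs A C M N"
  shows "M \<in> Obj A" "N \<in> Obj A"
proof -
  obtain i p f where "sub_with_quot_in A C M i" "quot_by_sub A C N p" using assms by (auto simp: germs_def)
  then show "M \<in> Obj A" "N \<in> Obj A"
    using sub_with_quot_inD(1,2)[of M i] quot_by_subD(1,2)[of N p] Cod_in_Obj[OF category, of i] Dom_in_Obj[OF category, of p]
    by auto
qed

lemma serre_quotient_simps [simp]:
  "Obj (serre_quotient A C) = Obj A"
  "Dom (serre_quotient A C) (M, N, K) = M" "Cod (serre_quotient A C) (M, N, K) = N"
  by (simp_all add: serre_quotient_def)

lemma serre_quotient_Idn: "Idn (serre_quotient A C) X = canonical_arr A C (Idn A X)"
  by (simp add: serre_quotient_def)

lemma germ_arr_Hom: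
  assumes "x \<in> germs A C M N"
  shows "germ_arr M N x \<in> Hom (serre_quotient A C) M N"
  using assms germs_Obj[OF assms] 
  by (auto simp: germ_arr_def Hom_def serre_quotient_def germ_class_def intro: quotientI)

lemma germ_arr_ex:
  assumes "\<phi> \<in> Hom (serre_quotient A C) M N"
  obtains i p f where "(i, p, f) \<in> germs A C M N" "\<phi> = germ_arr M N (i, p, f)"
  using assms by (auto simp: germ_arr_def Hom_def serre_quotient_def germ_class_def elim!: quotientE)

lemma canonical_functor_simps [simp]:
  "FObj (canonical_functor A C) X = X"
  by (simp add: canonical_functor_def)

lemma canonical_arr_eq:
  "f \<in> Hom A M N \<Longrightarrow> FArr (canonical_functor A C) f = germ_arr M N (Idn A M, Idn A N, f)"
  by (simp add: canonical_functor_def canonical_arr_def germ_arr_def Hom_def)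

lemma canonical_germ: "f \<in> Hom A M N \<Longrightarrow> (Idn A M, Idn A N, f) \<in> germs A C M N"
  using sub_Idn quot_Idn Hom_in_Obj[OF category, of f M N] by (simp add: germs_def)

end

section \<open>Calculus of fractions for the quotient functor\<close>

locale serre_functor = thick_subcategory +
  assumes canonical_functor: "is_functor A (serre_quotient A C) (canonical_functor A C)"
begin

abbreviation (input) quot where "quot \<equiv> serre_quotient A C"

abbreviation (input) Q where "Q \<equiv> FArr (canonical_functor A C)"

lemmas Q_simps [simp] = functor_simps[OF canonical_functor, unfolded canonical_functor_simps serre_quotient_simps(1)]

lemma Q_Hom: "f \<in> Hom A X Y \<Longrightarrow> Q f \<in> Hom quot X Y"
  using functor_Hom[OF canonical_functor, of f X Y] by simp

text \<open>The union defining the composite is an arrow of the quotient, hence a single class, so it is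
  computed by any admissible choice of representatives.\<close>

lemma germ_arr_Comp:
  assumes f: "(i, p, f) \<in> germs A C M N" and g: "(j, q, g) \<in> germs A C N L"
    and e: "epi_arr A e" "mono_arr A m" "Cod A e = Dom A m" "Dom A e = Dom A j" "Cod A m = Cod A p"
      "m \<cdot> e = p \<cdot> j" "f1 \<in> Hom A (Dom A i) (Dom A m)" "m \<cdot> f1 = f"
      "g1 \<in> Hom A (Cod A e) (Cod A q)" "g1 \<cdot> e = g"
  shows "germ_arr N L (j, q, g) \<cdot>\<^bsub>quot\<^esub> germ_arr M N (i, p, f) = germ_arr M L (i, q, g1 \<cdot> f1)"
proof -
  let ?K = "germ_class A C M N (i, p, f)" and ?K' = "germ_class A C N L (j, q, g)" and ?y = "(i, q, g1 \<cdot> f1)"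
  let ?U = "germ_comp A C M L ?K' ?K"
  have c: "germ_arr N L (j, q, g) \<cdot>\<^bsub>quot\<^esub> germ_arr M N (i, p, f) = (M, L, ?U)"
    by (simp add: germ_arr_def serre_quotient_def)
  have "germ_arr N L (j, q, g) \<cdot>\<^bsub>quot\<^esub> germ_arr M N (i, p, f) \<in> Hom quot M L"
    using Comp_Hom[OF Q_simps(2) germ_arr_Hom[OF f] germ_arr_Hom[OF g]] .
  then obtain x where x: "x \<in> germs A C M L" "?U = germ_class A C M L x"
    unfolding c by (auto simp: Hom_def serre_quotient_def germ_class_def elim!: quotientE)
  have y: "?y \<in> germs A C M L"
    using germsD(1)[OF f] germsD(2)[OF g] e(3) Comp_Hom[OF category, of f1 "Dom A i" "Dom A m" g1 "Cod A q"] e(7,9)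
    by (simp add: germs_def)
  have KK: "(i, p, f) \<in> ?K" "(j, q, g) \<in> ?K'"
    using germ_rel_refl[OF f] germ_rel_refl[OF g] by (auto simp: germ_class_def)
  have "germ_class A C M L ?y \<subseteq> ?U"
    unfolding germ_comp_def
    by (rule Union_upper, rule CollectI, rule exI[of _ i], rule exI[of _ p], rule exI[of _ f], rule exI[of _ j],
        rule exI[of _ q], rule exI[of _ g], rule exI[of _ e], rule exI[of _ m], rule exI[of _ f1], rule exI[of _ g1])
      (intro conjI refl KK e)
  moreover have "?y \<in> germ_class A C M L ?y" using germ_rel_refl[OF y] by (simp add: germ_class_def)
  ultimately have "?y \<in> germ_class A C M L x" unfolding x(2) by (rule subsetD)
  then have "(x, ?y) \<in> germ_rel A C M L" by (simp add: germ_class_def)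
  then have "germ_arr M L x = germ_arr M L ?y" using germ_arr_eq_iff[OF x(1) y] by simp
  then show ?thesis unfolding c x(2) by (simp add: germ_arr_def)
qed

text \<open>Restriction to its subobject makes the first index trivial.
  \<open>Comp_germ_arr_quot\<close> then removes the second, so that a germ (i, p, f) satisfies Q p
  \<phi> Q i = Q f.\<close>

lemma germ_arr_Comp_sub:
  assumes f: "(i, p, f) \<in> germs A C M N"
  shows "germ_arr M N (i, p, f) \<cdot>\<^bsub>quot\<^esub> Q i = germ_arr (Dom A i) N (Idn A (Dom A i), p, f)"
proof -
  note g = germsD[OF f]
  note [simp] = sub_with_quot_inD[OF g(1)] quot_by_subD[OF g(2)] HomD[OF g(3)] germs_Obj[OF f]
  have i: "i \<in> Hom A (Dom A i) M" by (simp add: Hom_def)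
  show ?thesis unfolding canonical_arr_eq[OF i]
    using germ_arr_Comp[OF canonical_germ[OF i] f, of "Idn A (Dom A i)" i "Idn A (Dom A i)" f]
    by (simp add: Hom_def iso_arr_Idn iso_epi)
qed

lemma Comp_germ_arr_quot:
  assumes f: "(Idn A M, p, f) \<in> germs A C M N"
  shows "Q p \<cdot>\<^bsub>quot\<^esub> germ_arr M N (Idn A M, p, f) = Q f"
proof -
  note g = germsD[OF f]
  note [simp] = quot_by_subD[OF g(2)] HomD[OF g(3)] germs_Obj[OF f]
  have p: "p \<in> Hom A N (Cod A p)" and f': "f \<in> Hom A M (Cod A p)" by (simp_all add: Hom_def)
  show ?thesis unfolding canonical_arr_eq[OF p] canonical_arr_eq[OF f']
    using germ_arr_Comp[OF f canonical_germ[OF p], of p "Idn A (Cod A p)" f "Idn A (Cod A p)"]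
    by (simp add: Hom_def iso_arr_Idn iso_mono)
qed

text \<open>The inverse is the germ of the identity of the subobject, seen as a partial arrow on M.
  The composite on M is the germ of \<open>i\<close>, which agrees with the identity at the index
  \<open>i\<close>.\<close>

lemma Q_sub_iso:
  assumes i: "sub_with_quot_in A C M i"
  shows "iso_arr quot (Q i)"
proof -
  note [simp] = sub_with_quot_inD[OF i]
  have M [simp]: "M \<in> Obj A" by (metis Cod_in_Obj category sub_with_quot_inD(1,2)[OF i])
  let ?D = "Dom A i"
  have g: "(i, Idn A ?D, Idn A ?D) \<in> germs A C M ?D"
    using i quot_Idn[of ?D] by (simp add: germs_def Hom_def)
  have g': "(i, Idn A M, i) \<in> germs A C M M"
    using i quot_Idn[of M] by (simp add: germs_def Hom_def)
  have iH: "i \<in> Hom A ?D M" by (simp add: Hom_def)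
  show ?thesis
  proof (rule iso_arrI[OF Q_Hom[OF iH] germ_arr_Hom[OF g]])
    show "germ_arr M ?D (i, Idn A ?D, Idn A ?D) \<cdot>\<^bsub>quot\<^esub> Q i = Idn quot ?D"
      using germ_arr_Comp_sub[OF g] canonical_arr_eq[OF Idn_Hom[OF category], of ?D]
      by (simp add: canonical_functor_def serre_quotient_Idn)
    have "Q i \<cdot>\<^bsub>quot\<^esub> germ_arr M ?D (i, Idn A ?D, Idn A ?D) = germ_arr M M (i, Idn A M, i)"
      unfolding canonical_arr_eq[OF iH]
      using germ_arr_Comp[OF g canonical_germ[OF iH], of "Idn A ?D" "Idn A ?D" "Idn A ?D" i]
      by (simp add: Hom_def iso_arr_Idn iso_epi iso_mono)
    also have "\<dots> = germ_arr M M (Idn A M, Idn A M, Idn A M)"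
      unfolding germ_arr_eq_iff[OF g' canonical_germ[OF Idn_Hom[OF category M]]]
      by (rule germ_relI[OF g' canonical_germ[OF Idn_Hom[OF category M]] i quot_Idn[OF M],
            where a = "Idn A ?D" and a' = i and b = "Idn A M" and b' = "Idn A M"])
        (simp_all add: Hom_def)
    also have "\<dots> = Idn quot M"
      using canonical_arr_eq[OF Idn_Hom[OF category M]] by (simp add: canonical_functor_def serre_quotient_Idn)
    finally show "Q i \<cdot>\<^bsub>quot\<^esub> germ_arr M ?D (i, Idn A ?D, Idn A ?D) = Idn quot M" .
  qed
qed

text \<open>Here the inverse is the identity of the quotient object, seen as an arrow into N modulo
  a subobject in C. The argument is carried out directly, as passing to \<open>opcat A\<close>
  interchanges the first two components of a germ.\<close>

lemma Q_quot_iso: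
  assumes p: "quot_by_sub A C N p"
  shows "iso_arr quot (Q p)"
proof -
  note [simp] = quot_by_subD[OF p]
  have N [simp]: "N \<in> Obj A" by (metis Dom_in_Obj category quot_by_subD(1,2)[OF p])
  let ?D = "Cod A p"
  have g: "(Idn A ?D, p, Idn A ?D) \<in> germs A C ?D N"
    using p sub_Idn[of ?D] by (simp add: germs_def Hom_def)
  have g': "(Idn A N, p, p) \<in> germs A C N N"
    using p sub_Idn[of N] by (simp add: germs_def Hom_def)
  have pH: "p \<in> Hom A N ?D" by (simp add: Hom_def)
  show ?thesis
  proof (rule iso_arrI[OF Q_Hom[OF pH] germ_arr_Hom[OF g]])
    show "Q p \<cdot>\<^bsub>quot\<^esub> germ_arr ?D N (Idn A ?D, p, Idn A ?D) = Idn quot ?D"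
      using Comp_germ_arr_quot[OF g] by (simp add: canonical_functor_def serre_quotient_Idn)
    have "germ_arr ?D N (Idn A ?D, p, Idn A ?D) \<cdot>\<^bsub>quot\<^esub> Q p = germ_arr N N (Idn A N, p, p)"
      unfolding canonical_arr_eq[OF pH]
      using germ_arr_Comp[OF canonical_germ[OF pH] g, of "Idn A ?D" "Idn A ?D" p "Idn A ?D"]
      by (simp add: Hom_def iso_arr_Idn iso_epi iso_mono)
    also have "\<dots> = germ_arr N N (Idn A N, Idn A N, Idn A N)"
      unfolding germ_arr_eq_iff[OF g' canonical_germ[OF Idn_Hom[OF category N]]]
      by (rule germ_relI[OF g' canonical_germ[OF Idn_Hom[OF category N]] sub_Idn[OF N] p,
            where a = "Idn A N" and a' = "Idn A N" and b = "Idn A ?D" and b' = p])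
        (simp_all add: Hom_def)
    also have "\<dots> = Idn quot N"
      using canonical_arr_eq[OF Idn_Hom[OF category N]] by (simp add: canonical_functor_def serre_quotient_Idn)
    finally show "germ_arr ?D N (Idn A ?D, p, Idn A ?D) \<cdot>\<^bsub>quot\<^esub> Q p = Idn quot N" .
  qed
qed

lemma Q_eqD:
  assumes "f \<in> Hom A M N" "g \<in> Hom A M N" "Q f = Q g"
  obtains i p where "sub_with_quot_in A C M i" "quot_by_sub A C N p" "p \<cdot> (f \<cdot> i) = p \<cdot> (g \<cdot> i)"
proof -
  note [simp] = HomD[OF assms(1)] HomD[OF assms(2)] Hom_in_Obj[OF category assms(1)]
  have "((Idn A M, Idn A N, f), (Idn A M, Idn A N, g)) \<in> germ_rel A C M N"
    using assms(3) canonical_arr_eq[OF assms(1)] canonical_arr_eq[OF assms(2)]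
      germ_arr_eq_iff[OF canonical_germ[OF assms(1)] canonical_germ[OF assms(2)]] by simp
  then show thesis
  proof (rule germ_relE)
    fix i p a a' b b'
    assume ip: "sub_with_quot_in A C M i" "quot_by_sub A C N p"
      and H: "a \<in> Hom A (Dom A i) (Dom A (Idn A M))" "a' \<in> Hom A (Dom A i) (Dom A (Idn A M))"
        "b \<in> Hom A (Cod A (Idn A N)) (Cod A p)" "b' \<in> Hom A (Cod A (Idn A N)) (Cod A p)"
      and e: "Idn A M \<cdot> a = i" "Idn A M \<cdot> a' = i" "b \<cdot> Idn A N = p" "b' \<cdot> Idn A N = p"
        "b \<cdot> (f \<cdot> a) = b' \<cdot> (g \<cdot> a')"
    have "a = i" "a' = i" "b = p" "b' = p" using e(1-4) H by (simp_all add: Hom_def)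
    then show thesis using that[OF ip] e(5) by simp
  qed
qed

text \<open>A converse to \<open>Q_eqD\<close> for arbitrary arrows inverted by Q in place of
  indices, so that it applies to components of the unit as well.\<close>

lemma Q_eqI:
  assumes "f \<in> Hom A M N" "g \<in> Hom A M N" "iso_arr quot (Q i)" "iso_arr quot (Q p)"
    "i \<in> Hom A M' M" "p \<in> Hom A N N'" "p \<cdot> (f \<cdot> i) = p \<cdot> (g \<cdot> i)"
  shows "Q f = Q g"
proof -
  note [simp] = HomD[OF assms(1)] HomD[OF assms(2)] HomD[OF assms(5)] HomD[OF assms(6)]
  have "Q p \<cdot>\<^bsub>quot\<^esub> (Q f \<cdot>\<^bsub>quot\<^esub> Q i) = Q p \<cdot>\<^bsub>quot\<^esub> (Q g \<cdot>\<^bsub>quot\<^esub> Q i)"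
    using assms(7) by (simp flip: Q_simps(8))
  then have "Q f \<cdot>\<^bsub>quot\<^esub> Q i = Q g \<cdot>\<^bsub>quot\<^esub> Q i"
    by (rule mono_arrD[OF iso_mono[OF _ assms(4)], rotated -1, where X = M']) (simp_all add: Hom_def)
  then show ?thesis
    by (rule epi_arrD[OF iso_epi[OF _ assms(3)], rotated -1, where X = N]) (simp_all add: Hom_def)
qed

text \<open>A germ gives \<open>Q p \<phi> Q i = Q f\<close>; pulling \<open>p\<close> back along \<open>f\<close> moves its inverse to the right.\<close>

lemma right_fraction:
  assumes "\<phi> \<in> Hom quot X M"
  obtains P s h where "s \<in> Hom A P X" "h \<in> Hom A P M" "iso_arr quot (Q s)" "\<phi> \<cdot>\<^bsub>quot\<^esub> Q s = Q h"
proof -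
  obtain i p f where g: "(i, p, f) \<in> germs A C X M" and \<phi>: "\<phi> = germ_arr X M (i, p, f)"
    by (rule germ_arr_ex[OF assms])
  note g' = germsD[OF g]
  note [simp] = HomD[OF assms] sub_with_quot_inD[OF g'(1)] quot_by_subD[OF g'(2)] HomD[OF g'(3)] germs_Obj[OF g]
  have g2: "(Idn A (Dom A i), p, f) \<in> germs A C (Dom A i) M"
    using g' sub_Idn[of "Dom A i"] by (simp add: germs_def)
  have pf: "Q p \<cdot>\<^bsub>quot\<^esub> (\<phi> \<cdot>\<^bsub>quot\<^esub> Q i) = Q f"
    using germ_arr_Comp_sub[OF g] Comp_germ_arr_quot[OF g2] \<phi> by simp
  have pH: "p \<in> Hom A M (Cod A p)" by (simp add: Hom_def)
  obtain P s h where s: "s \<in> Hom A P (Dom A i)" and h: "h \<in> Hom A P M" and e: "p \<cdot> h = f \<cdot> s" and epi: "epi_arr A s"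
    and joint: "\<And>T u u'. u \<in> Hom A T P \<Longrightarrow> u' \<in> Hom A T P \<Longrightarrow> s \<cdot> u = s \<cdot> u' \<Longrightarrow> h \<cdot> u = h \<cdot> u' \<Longrightarrow> u = u'"
    using pullback_epi[OF pH quot_by_subD(3)[OF g'(2)] g'(3)] by metis
  note [simp] = HomD[OF s] HomD[OF h] Hom_in_Obj[OF category s]
  obtain k where k: "is_kernel A s k" by (rule kernel_ex[of s]) auto
  note [simp] = kernelD(1-3)[OF k]
  have sk: "s \<cdot> k = zr A (Dom A k) (Dom A i)" using kernel_zr[OF k] by simp
  obtain j where j: "mono_arr A j" "Dom A j \<in> C" "is_cokernel A j p" using g'(2) by (auto simp: quot_by_sub_def)
  have jk: "is_kernel A p j" by (rule kernel_cokernel[OF j(3,1)])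
  note [simp] = kernelD(1-3)[OF jk]
  have "p \<cdot> (h \<cdot> k) = zr A (Dom A k) (Cod A p)"
    using Comp_reassoc[OF category e, of k] sk by simp
  then obtain u where u: "u \<in> Hom A (Dom A k) (Dom A j)" "j \<cdot> u = h \<cdot> k"
    using kernel_lift[OF jk, of "h \<cdot> k"] by auto
  note [simp] = HomD[OF u(1)]
  \<comment> \<open>The kernel of \<open>s\<close> embeds into that of \<open>p\<close>, which lies
    in C: on it \<open>s\<close> vanishes, so \<open>h\<close> alone separates arrows.\<close>
  have "mono_arr A u"
  proof (rule mono_arrI[OF u(1)])
    fix T x y assume x: "x \<in> Hom A T (Dom A k)" and y: "y \<in> Hom A T (Dom A k)" and xy: "u \<cdot> x = u \<cdot> y"
    note [simp] = HomD[OF x] HomD[OF y]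
    have "k \<cdot> x = k \<cdot> y"
    proof (rule joint[of _ T])
      show "s \<cdot> (k \<cdot> x) = s \<cdot> (k \<cdot> y)" using Comp_reassoc[OF category sk] by simp
      have "h \<cdot> (k \<cdot> x) = j \<cdot> (u \<cdot> x)" "h \<cdot> (k \<cdot> y) = j \<cdot> (u \<cdot> y)" using Comp_reassoc[OF category u(2)] by simp_all
      then show "h \<cdot> (k \<cdot> x) = h \<cdot> (k \<cdot> y)" using xy by simp
    qed (simp_all add: Hom_def)
    then show "x = y" using mono_arrD[OF kernel_mono[OF category k] x y] by simp
  qed
  then have "Dom A k \<in> C" using thick_mono[of u] j(2) by simp
  then have "quot_by_sub A C P s"
    using kernel_mono[OF category k] cokernel_kernel[OF k epi] by (auto simp: quot_by_sub_def)
  note s_iso = Q_quot_iso[OF this]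
  have "Q p \<cdot>\<^bsub>quot\<^esub> (\<phi> \<cdot>\<^bsub>quot\<^esub> Q (i \<cdot> s)) = (Q p \<cdot>\<^bsub>quot\<^esub> (\<phi> \<cdot>\<^bsub>quot\<^esub> Q i)) \<cdot>\<^bsub>quot\<^esub> Q s" by simp
  also have "\<dots> = Q p \<cdot>\<^bsub>quot\<^esub> Q h" unfolding pf using e by (simp flip: Q_simps(8))
  finally have "\<phi> \<cdot>\<^bsub>quot\<^esub> Q (i \<cdot> s) = Q h"
    by (rule mono_arrD[OF iso_mono[OF _ Q_quot_iso[OF g'(2)]], rotated -1, where X = P]) (simp_all add: Hom_def)
  moreover have "iso_arr quot (Q (i \<cdot> s))"
    using iso_arr_Comp[OF _ s_iso Q_sub_iso[OF g'(1)]] by simp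
  ultimately show thesis by (intro that[of "i \<cdot> s" P h]) (simp_all add: Hom_def)
qed

text \<open>A common denominator: the second arrow is turned into a fraction only after
  precomposition with the denominator of the first.\<close>

lemma right_fractions:
  assumes "\<phi> \<in> Hom quot X M" "\<psi> \<in> Hom quot X N"
  obtains P s h h' where "s \<in> Hom A P X" "h \<in> Hom A P M" "h' \<in> Hom A P N" "iso_arr quot (Q s)"
    "\<phi> \<cdot>\<^bsub>quot\<^esub> Q s = Q h" "\<psi> \<cdot>\<^bsub>quot\<^esub> Q s = Q h'"
proof -
  note [simp] = HomD[OF assms(1)] HomD[OF assms(2)]
  obtain P s h where s: "s \<in> Hom A P X" and h: "h \<in> Hom A P M" and si: "iso_arr quot (Q s)" and e: "\<phi> \<cdot>\<^bsub>quot\<^esub> Q s = Q h"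
    by (rule right_fraction[OF assms(1)])
  note [simp] = HomD[OF s] HomD[OF h]
  have "\<psi> \<cdot>\<^bsub>quot\<^esub> Q s \<in> Hom quot P N" by (simp add: Hom_def)
  then obtain P' t h' where t: "t \<in> Hom A P' P" and h': "h' \<in> Hom A P' N" and ti: "iso_arr quot (Q t)"
    and e': "(\<psi> \<cdot>\<^bsub>quot\<^esub> Q s) \<cdot>\<^bsub>quot\<^esub> Q t = Q h'"
    by (rule right_fraction)
  note [simp] = HomD[OF t] HomD[OF h']
  have "iso_arr quot (Q (s \<cdot> t))" using iso_arr_Comp[OF _ ti si] by simp
  moreover have "\<phi> \<cdot>\<^bsub>quot\<^esub> Q (s \<cdot> t) = Q (h \<cdot> t)" by (simp add: Comp_reassoc[OF _ e])
  moreover have "\<psi> \<cdot>\<^bsub>quot\<^esub> Q (s \<cdot> t) = Q h'" using e' by simp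
  ultimately show thesis by (intro that[of "s \<cdot> t" P' "h \<cdot> t" h']) (simp_all add: Hom_def)
qed

lemma Q_epiD:
  assumes "iso_arr quot (Q s)" "s \<in> Hom A P X" "\<phi> \<in> Hom quot X M" "\<psi> \<in> Hom quot X M"
    "\<phi> \<cdot>\<^bsub>quot\<^esub> Q s = \<psi> \<cdot>\<^bsub>quot\<^esub> Q s"
  shows "\<phi> = \<psi>"
  by (rule epi_arrD[OF iso_epi[OF _ assms(1)] _ _ assms(5)]) (use assms(3,4) HomD[OF assms(2)] in simp_all)

text \<open>Through fractions it suffices to compare h and h' in A, where p k h i = p k h' i. Write
  p k = u q with \<open>u\<close> mono and \<open>q\<close> the cokernel of the kernel of p k. That
  kernel embeds into the kernel of p, as k is mono, so it lies in C and Q inverts \<open>q\<close>;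
  cancelling \<open>u\<close> leaves q h i = q h' i.\<close>

lemma Q_mono:
  assumes "mono_arr A k"
  shows "mono_arr quot (Q k)"
proof (rule mono_arrI)
  have k [simp]: "k \<in> Arr A" using assms by (simp add: mono_arr_def)
  show "Q k \<in> Hom quot (Dom A k) (Cod A k)" by (simp add: Hom_def)
  fix X \<phi> \<psi> assume \<phi>: "\<phi> \<in> Hom quot X (Dom A k)" and \<psi>: "\<psi> \<in> Hom quot X (Dom A k)"
    and e: "Q k \<cdot>\<^bsub>quot\<^esub> \<phi> = Q k \<cdot>\<^bsub>quot\<^esub> \<psi>"
  obtain P s h h' where s: "s \<in> Hom A P X" and h: "h \<in> Hom A P (Dom A k)" and h': "h' \<in> Hom A P (Dom A k)"
    and si: "iso_arr quot (Q s)" and sh: "\<phi> \<cdot>\<^bsub>quot\<^esub> Q s = Q h" "\<psi> \<cdot>\<^bsub>quot\<^esub> Q s = Q h'"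
    by (rule right_fractions[OF \<phi> \<psi>])
  note [simp] = HomD[OF \<phi>] HomD[OF \<psi>] HomD[OF s] HomD[OF h] HomD[OF h']
  have "Q (k \<cdot> h) = (Q k \<cdot>\<^bsub>quot\<^esub> \<phi>) \<cdot>\<^bsub>quot\<^esub> Q s" using sh(1) by simp
  also have "\<dots> = Q (k \<cdot> h')" unfolding e using sh(2) by simp
  finally obtain i p where i: "sub_with_quot_in A C P i" and p: "quot_by_sub A C (Cod A k) p"
    and ip: "p \<cdot> ((k \<cdot> h) \<cdot> i) = p \<cdot> ((k \<cdot> h') \<cdot> i)"
    by (rule Q_eqD[of "k \<cdot> h" P "Cod A k" "k \<cdot> h'", rotated 2]) (simp_all add: Hom_def)
  note [simp] = sub_with_quot_inD[OF i] quot_by_subD[OF p]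
  obtain l where l: "is_kernel A (p \<cdot> k) l" by (rule kernel_ex[of "p \<cdot> k"]) auto
  note [simp] = kernelD(1,2)[OF l]
  have [simp]: "Cod A l = Dom A k" using kernelD(3)[OF l] by simp
  obtain q where q: "is_cokernel A l q" by (rule cokernel_ex[of l]) auto
  note [simp] = cokernelD(1-3)[OF q]
  obtain u where u: "u \<in> Hom A (Cod A q) (Cod A (p \<cdot> k))" "u \<cdot> q = p \<cdot> k" "mono_arr A u"
    by (rule coimage_mono[OF l q])
  note [simp] = HomD[OF u(1)]
  obtain j where j: "mono_arr A j" "Dom A j \<in> C" "is_cokernel A j p" using p by (auto simp: quot_by_sub_def)
  have jk: "is_kernel A p j" by (rule kernel_cokernel[OF j(3,1)])
  note [simp] = kernelD(1-3)[OF jk]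
  have "p \<cdot> (k \<cdot> l) = zr A (Dom A l) (Cod A p)" using kernel_zr[OF l] by simp
  then obtain v where v: "v \<in> Hom A (Dom A l) (Dom A j)" "j \<cdot> v = k \<cdot> l"
    using kernel_lift[OF jk, of "k \<cdot> l"] by auto
  note [simp] = HomD[OF v(1)]
  have "mono_arr A (j \<cdot> v)" unfolding v(2)
    by (rule mono_arr_Comp[OF category kernel_mono[OF category l] assms]) simp
  then have "mono_arr A v" by (rule mono_arr_right[OF category _ v(1), of j "Cod A j"]) (simp add: Hom_def)
  then have "Dom A l \<in> C" using thick_mono[of v] j(2) by simp
  then have q': "quot_by_sub A C (Dom A k) q"
    using kernel_mono[OF category l] q by (auto simp: quot_by_sub_def)
  have "u \<cdot> (q \<cdot> (h \<cdot> i)) = u \<cdot> (q \<cdot> (h' \<cdot> i))"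
    using ip by (simp add: Comp_reassoc[OF category u(2)])
  then have "q \<cdot> (h \<cdot> i) = q \<cdot> (h' \<cdot> i)"
    by (rule mono_arrD[OF u(3), rotated -1, where X = "Dom A i"]) (simp_all add: Hom_def)
  then have "Q h = Q h'"
    by (intro Q_eqI[OF h h' Q_sub_iso[OF i] Q_quot_iso[OF q']]) (simp_all add: Hom_def)
  then show "\<phi> = \<psi>" using Q_epiD[OF si s \<phi> \<psi>] sh by simp
qed

end

section \<open>Localizing subcategories\<close>

locale localization = thick_subcategory A add C +
  adjoint A "serre_quotient A C" "canonical_functor A C" S \<eta> \<delta>
  for A :: "('o, 'm) cat" and add C and S :: "('o, ('o, 'm) quot_arr, 'o, 'm) func" and \<eta> \<delta>
begin

sublocale serre_functor A add C
  using F_functor by unfold_locales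

text \<open>Every arrow of the quotient is a right fraction, so \<open>Q \<circ> \<eta>\<close> is natural on the quotient and
  not only on the image of \<open>Q\<close>.\<close>

lemma Q_unit_nat:
  assumes "\<phi> \<in> Hom quot X Y"
  shows "Q (\<eta> Y) \<cdot>\<^bsub>quot\<^esub> \<phi> = Q (FArr S \<phi>) \<cdot>\<^bsub>quot\<^esub> Q (\<eta> X)"
proof -
  obtain P s h where s: "s \<in> Hom A P X" and h: "h \<in> Hom A P Y" and si: "iso_arr quot (Q s)"
    and e: "\<phi> \<cdot>\<^bsub>quot\<^esub> Q s = Q h"
    by (rule right_fraction[OF assms])
  note [simp] = HomD[OF assms] HomD[OF s] HomD[OF h] Hom_in_Obj[OF category s] Hom_in_Obj[OF category h]
  show ?thesis
  proof (rule Q_epiD[OF si s])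
    have "(Q (\<eta> Y) \<cdot>\<^bsub>quot\<^esub> \<phi>) \<cdot>\<^bsub>quot\<^esub> Q s = Q (\<eta> Y \<cdot>\<^bsub>A\<^esub> h)" using e by simp
    also have "\<eta> Y \<cdot>\<^bsub>A\<^esub> h = FArr S (\<phi> \<cdot>\<^bsub>quot\<^esub> Q s) \<cdot>\<^bsub>A\<^esub> \<eta> P" unfolding e using unit_nat[of h] by simp
    also have "\<dots> = FArr S \<phi> \<cdot>\<^bsub>A\<^esub> (\<eta> X \<cdot>\<^bsub>A\<^esub> s)" using unit_nat[of s] by simp
    finally show "(Q (\<eta> Y) \<cdot>\<^bsub>quot\<^esub> \<phi>) \<cdot>\<^bsub>quot\<^esub> Q s = (Q (FArr S \<phi>) \<cdot>\<^bsub>quot\<^esub> Q (\<eta> X)) \<cdot>\<^bsub>quot\<^esub> Q s"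
      by simp
  qed (simp_all add: Hom_def)
qed

lemma quot_counit_iso:
  assumes "Y \<in> Obj quot"
  shows "iso_arr quot (\<delta> Y)"
proof -
  have [simp]: "Y \<in> Obj A" using assms by simp
  have d: "\<delta> Y \<in> Hom quot (FObj S Y) Y" by (simp add: Hom_def)
  show ?thesis
  proof (rule iso_arrI[OF d])
    show "Q (\<eta> Y) \<in> Hom quot Y (FObj S Y)" by (simp add: Hom_def)
    have "Q (\<eta> Y) \<cdot>\<^bsub>quot\<^esub> \<delta> Y = Q (FArr S (\<delta> Y) \<cdot>\<^bsub>A\<^esub> \<eta> (FObj S Y))" unfolding Q_unit_nat[OF d] by simp
    also have "\<dots> = Idn quot (FObj S Y)" using triangle_G[of Y] by simp
    finally show "Q (\<eta> Y) \<cdot>\<^bsub>quot\<^esub> \<delta> Y = Idn quot (FObj S Y)" .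
    show "\<delta> Y \<cdot>\<^bsub>quot\<^esub> Q (\<eta> Y) = Idn quot Y" using triangle_F[of Y] by simp
  qed
qed

sublocale reflection A quot "canonical_functor A C" S \<eta> \<delta>
  by unfold_locales (rule quot_counit_iso)

lemma S_Hom_eqI:
  assumes "f \<in> Hom A X (FObj S Y)" "g \<in> Hom A X (FObj S Y)" "Y \<in> Obj A"
    "\<delta> Y \<cdot>\<^bsub>quot\<^esub> Q f = \<delta> Y \<cdot>\<^bsub>quot\<^esub> Q g"
  shows "f = g"
  using transpose_left[of f Y] transpose_left[of g Y] HomD[OF assms(1)] HomD[OF assms(2)] assms(3,4) by simp

text \<open>Arrows into Z agree because their numerators over a common denominator do; arrows out of
  Z agree because their transposes into S X do.\<close>

lemma Q_zero_object:
  assumes "zero_obj A Z"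
  shows "zero_obj quot Z"
proof -
  have [simp]: "Z \<in> Obj A" using assms by (simp add: zero_obj_def)
  have "\<exists>!f. f \<in> Hom quot X Z" if X [simp]: "X \<in> Obj A" for X
  proof (rule ex_ex1I)
    show "\<exists>f. f \<in> Hom quot X Z" using Q_Hom[OF zr_Hom[OF pointed, of X Z]] X \<open>Z \<in> Obj A\<close> by blast
    fix \<phi> \<psi> assume \<phi>: "\<phi> \<in> Hom quot X Z" and \<psi>: "\<psi> \<in> Hom quot X Z"
    obtain P s h h' where s: "s \<in> Hom A P X" and h: "h \<in> Hom A P Z" and h': "h' \<in> Hom A P Z"
      and si: "iso_arr quot (Q s)" and sh: "\<phi> \<cdot>\<^bsub>quot\<^esub> Q s = Q h" "\<psi> \<cdot>\<^bsub>quot\<^esub> Q s = Q h'"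
      by (rule right_fractions[OF \<phi> \<psi>])
    have "h = h'" using zero_obj_Hom_eq(1)[OF pointed assms] h h' by metis
    then show "\<phi> = \<psi>" using Q_epiD[OF si s \<phi> \<psi>] sh by simp
  qed
  moreover have "\<exists>!f. f \<in> Hom quot Z X" if X [simp]: "X \<in> Obj A" for X
  proof (rule ex_ex1I)
    show "\<exists>f. f \<in> Hom quot Z X" using Q_Hom[OF zr_Hom[OF pointed, of Z X]] X \<open>Z \<in> Obj A\<close> by blast
    fix \<phi> \<psi> assume \<phi>: "\<phi> \<in> Hom quot Z X" and \<psi>: "\<psi> \<in> Hom quot Z X"
    note [simp] = HomD[OF \<phi>] HomD[OF \<psi>]
    have "FArr S \<phi> \<cdot>\<^bsub>A\<^esub> \<eta> Z = FArr S \<psi> \<cdot>\<^bsub>A\<^esub> \<eta> Z"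
      by (rule zero_obj_unique(2)[OF assms, of "FObj S X"]) (simp_all add: Hom_def)
    then show "\<phi> = \<psi>" using transpose_right[of \<phi> Z] transpose_right[of \<psi> Z] by simp
  qed
  ultimately show ?thesis by (simp add: zero_obj_def)
qed


lemma pointed_quot [simp]: "pointed quot"
  using pointed Q_zero_object unfolding pointed_def by (metis Q_simps(2))

text \<open>Puts vanishing into the form of an equality of two images under Q, to which
  \<open>Q_eqD\<close> applies.\<close>

lemma zero_arr_quot_iff:
  assumes "f \<in> Hom A X Y"
  shows "zero_arr quot (Q f) \<longleftrightarrow> Q f = Q (zr A X Y)"
proof -
  note [simp] = HomD[OF assms] Hom_in_Obj[OF category assms]
  have z: "zero_arr quot (Q (zr A X Y))" by (rule F_zero_arr) simp_all
  show ?thesis using zero_arr_unique[OF _ _ z, of "Q f"] z by auto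
qed

text \<open>Write \<phi> as h over s. Vanishing of Q (f h) means that f h, restricted along an index
  \<open>i\<close>, lands in an object of C. Restricting once more to the kernel \<open>i1\<close>
  of that arrow makes it zero in A, so the kernel of f lifts h i i1; the lift over s i i1 is the
  required factorization.\<close>

lemma Q_kernel:
  assumes "is_kernel A f k"
  shows "is_kernel quot (Q f) (Q k)"
proof (rule is_kernelI)
  note k [simp] = kernelD[OF assms]
  show "mono_arr quot (Q k)" by (rule Q_mono[OF kernel_mono[OF category assms]])
  have "zero_arr quot (Q (f \<cdot>\<^bsub>A\<^esub> k))" by (rule F_zero_arr) simp_all
  then show "zero_arr quot (Q f \<cdot>\<^bsub>quot\<^esub> Q k)" by simp
  fix X \<phi> assume "\<phi> \<in> Hom quot X (Dom quot (Q f))" and z: "zero_arr quot (Q f \<cdot>\<^bsub>quot\<^esub> \<phi>)"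
  then have \<phi>: "\<phi> \<in> Hom quot X (Dom A f)" by simp
  obtain P s h where s: "s \<in> Hom A P X" and h: "h \<in> Hom A P (Dom A f)" and si: "iso_arr quot (Q s)"
    and e: "\<phi> \<cdot>\<^bsub>quot\<^esub> Q s = Q h"
    by (rule right_fraction[OF \<phi>])
  note [simp] = HomD[OF \<phi>] HomD[OF s] HomD[OF h] Hom_in_Obj[OF category h]
  have fh: "f \<cdot>\<^bsub>A\<^esub> h \<in> Hom A P (Cod A f)" by (simp add: Hom_def)
  have "zero_arr quot ((Q f \<cdot>\<^bsub>quot\<^esub> \<phi>) \<cdot>\<^bsub>quot\<^esub> Q s)" by (rule zero_arr_Comp_right[OF _ z]) simp_all
  then have "zero_arr quot (Q (f \<cdot>\<^bsub>A\<^esub> h))" using e by simp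
  then have "Q (f \<cdot>\<^bsub>A\<^esub> h) = Q (zr A P (Cod A f))" using zero_arr_quot_iff[OF fh] by blast
  then obtain i p where i: "sub_with_quot_in A C P i" and p: "quot_by_sub A C (Cod A f) p"
    and ip: "p \<cdot>\<^bsub>A\<^esub> ((f \<cdot>\<^bsub>A\<^esub> h) \<cdot>\<^bsub>A\<^esub> i) = p \<cdot>\<^bsub>A\<^esub> (zr A P (Cod A f) \<cdot>\<^bsub>A\<^esub> i)"
    by (rule Q_eqD[OF fh zr_Hom[OF pointed], rotated 2]) simp_all
  note [simp] = sub_with_quot_inD[OF i] quot_by_subD[OF p]
  obtain j where j: "mono_arr A j" "Dom A j \<in> C" "is_cokernel A j p" using p by (auto simp: quot_by_sub_def)
  have jk: "is_kernel A p j" by (rule kernel_cokernel[OF j(3,1)])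
  note [simp] = kernelD(1-3)[OF jk]
  obtain e' where e': "e' \<in> Hom A (Dom A i) (Dom A j)" "j \<cdot>\<^bsub>A\<^esub> e' = f \<cdot>\<^bsub>A\<^esub> (h \<cdot>\<^bsub>A\<^esub> i)"
    by (rule kernel_lift[OF jk, of "f \<cdot>\<^bsub>A\<^esub> (h \<cdot>\<^bsub>A\<^esub> i)"]) (use ip in simp_all)
  note [simp] = HomD[OF e'(1)]
  obtain i1 where i1: "is_kernel A e' i1" "sub_with_quot_in A C (Dom A i) i1"
    by (rule sub_kernel_ex[OF e'(1) j(2)])
  note [simp] = sub_with_quot_inD[OF i1(2)]
  have "f \<cdot>\<^bsub>A\<^esub> (h \<cdot>\<^bsub>A\<^esub> (i \<cdot>\<^bsub>A\<^esub> i1)) = (j \<cdot>\<^bsub>A\<^esub> e') \<cdot>\<^bsub>A\<^esub> i1" unfolding e'(2) by simp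
  also have "\<dots> = zr A (Dom A i1) (Cod A f)" using kernel_zr[OF i1(1)] by simp
  finally obtain t where t: "t \<in> Hom A (Dom A i1) (Dom A k)" "k \<cdot>\<^bsub>A\<^esub> t = h \<cdot>\<^bsub>A\<^esub> (i \<cdot>\<^bsub>A\<^esub> i1)"
    using kernel_lift[OF assms, of "h \<cdot>\<^bsub>A\<^esub> (i \<cdot>\<^bsub>A\<^esub> i1)"] by auto
  note [simp] = HomD[OF t(1)]
  let ?s = "s \<cdot>\<^bsub>A\<^esub> (i \<cdot>\<^bsub>A\<^esub> i1)"
  have si': "iso_arr quot (Q ?s)"
    using iso_arr_Comp[OF _ iso_arr_Comp[OF _ Q_sub_iso[OF i1(2)] Q_sub_iso[OF i]] si] by simp
  note [simp] = inv_arr[OF si']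
  let ?u = "Q t \<cdot>\<^bsub>quot\<^esub> inv_arr quot (Q ?s)"
  have u: "?u \<in> Hom quot X (Dom A k)" by (simp add: Hom_def del: Q_simps(8))
  have "Q k \<cdot>\<^bsub>quot\<^esub> ?u = \<phi>"
  proof (rule Q_epiD[OF si', of "Dom A i1" X])
    have "(Q k \<cdot>\<^bsub>quot\<^esub> ?u) \<cdot>\<^bsub>quot\<^esub> Q ?s = Q (k \<cdot>\<^bsub>A\<^esub> t)"
      using inv_arr[OF si'] by (simp del: Q_simps(8) add: Q_simps(8)[of t k])
    also have "\<dots> = (\<phi> \<cdot>\<^bsub>quot\<^esub> Q s) \<cdot>\<^bsub>quot\<^esub> Q (i \<cdot>\<^bsub>A\<^esub> i1)" unfolding t(2) e by simp
    also have "\<dots> = \<phi> \<cdot>\<^bsub>quot\<^esub> Q ?s" by simp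
    finally show "(Q k \<cdot>\<^bsub>quot\<^esub> ?u) \<cdot>\<^bsub>quot\<^esub> Q ?s = \<phi> \<cdot>\<^bsub>quot\<^esub> Q ?s" .
    show "?s \<in> Hom A (Dom A i1) X" by (simp add: Hom_def)
    show "Q k \<cdot>\<^bsub>quot\<^esub> ?u \<in> Hom quot X (Cod A k)"
      by (rule Comp_Hom[OF _ u]) (simp_all add: Hom_def)
  qed (use \<phi> in simp)
  then show "\<exists>u\<in>Hom quot X (Dom quot (Q k)). Q k \<cdot>\<^bsub>quot\<^esub> u = \<phi>" using u by auto
qed (use kernelD[OF assms] in simp_all)

sublocale exact_reflection A quot "canonical_functor A C" S \<eta> \<delta> add
  by unfold_locales (rule Q_kernel)

section \<open>Torsion and saturated objects\<close>

lemma Q_eq_zero: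
  assumes "D \<in> C"
  shows "Q (Idn A D) = Q (zr A D D)"
proof -
  have D [simp]: "D \<in> Obj A" by (rule thick_Obj[OF assms])
  note I = Idn_Hom[OF category D]
  \<comment> \<open>For D in C the zero subobject is an admissible index: it is the kernel of the
    identity, an arrow into C. On it the identity and zero agree.\<close>
  obtain i where i: "is_kernel A (Idn A D) i" "sub_with_quot_in A C D i"
    by (rule sub_kernel_ex[OF I assms])
  note [simp] = sub_with_quot_inD[OF i(2)]
  have "i = zr A (Dom A i) D" using kernel_zr[OF i(1)] by simp
  then have "Idn A D \<cdot>\<^bsub>A\<^esub> (Idn A D \<cdot>\<^bsub>A\<^esub> i) = Idn A D \<cdot>\<^bsub>A\<^esub> (zr A D D \<cdot>\<^bsub>A\<^esub> i)"
    by simp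
  then show ?thesis
    by (rule Q_eqI[OF I zr_Hom[OF pointed D D] Q_sub_iso[OF i(2)] _ _ I, where M' = "Dom A i", rotated -1])
      (use functor_iso(1)[OF F_functor iso_arr_Idn[OF category D]] in \<open>simp_all add: Hom_def\<close>)
qed

text \<open>A vanishing identity gives p i = 0, so a subobject with quotient in C is contained in
  the kernel of p, itself in C. Hence D is an extension of objects of C.\<close>

lemma Q_eq_zeroD:
  assumes "D \<in> Obj A" "Q (Idn A D) = Q (zr A D D)"
  shows "D \<in> C"
proof -
  note [simp] = assms(1)
  obtain i p where i: "sub_with_quot_in A C D i" and p: "quot_by_sub A C D p"
    and ip: "p \<cdot>\<^bsub>A\<^esub> (Idn A D \<cdot>\<^bsub>A\<^esub> i) = p \<cdot>\<^bsub>A\<^esub> (zr A D D \<cdot>\<^bsub>A\<^esub> i)"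
    by (rule Q_eqD[OF Idn_Hom[OF category assms(1)] zr_Hom[OF pointed assms(1) assms(1)] assms(2)])
  note [simp] = sub_with_quot_inD[OF i] quot_by_subD[OF p]
  obtain j where j: "mono_arr A j" "Dom A j \<in> C" "is_cokernel A j p" using p by (auto simp: quot_by_sub_def)
  have jk: "is_kernel A p j" by (rule kernel_cokernel[OF j(3,1)])
  note [simp] = kernelD(1-3)[OF jk]
  obtain v where v: "v \<in> Hom A (Dom A i) (Dom A j)" "j \<cdot>\<^bsub>A\<^esub> v = i"
    by (rule kernel_lift[OF jk, of i]) (use ip in simp_all)
  have "mono_arr A v"
    by (rule mono_arr_right[OF category _ v(1), of j "Cod A j"]) (simp_all add: v(2) Hom_def)
  then have "Dom A i \<in> C" using thick_mono[of v] HomD[OF v(1)] j(2) by simp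
  moreover obtain c where c: "is_cokernel A i c" "Cod A c \<in> C" using i by (auto simp: sub_with_quot_in_def)
  ultimately show ?thesis
    using thick_iff[of i c] kernel_cokernel[OF c(1)] c by (simp add: short_exact_def)
qed

text \<open>Q annihilates D, and arrows into S Y are determined by their transposes out of Q
  D.\<close>

lemma torsion_to_S:
  assumes "f \<in> Hom A D (FObj S Y)" "D \<in> C" "Y \<in> Obj A"
  shows "f = zr A D (FObj S Y)"
proof (rule S_Hom_eqI[OF assms(1) zr_Hom[OF pointed] assms(3)])
  note [simp] = HomD[OF assms(1)] thick_Obj[OF assms(2)] assms(3)
  have "Q (f \<cdot>\<^bsub>A\<^esub> Idn A D) = Q (f \<cdot>\<^bsub>A\<^esub> zr A D D)"
    using Q_simps(8)[of "Idn A D" f] Q_simps(8)[of "zr A D D" f] Q_eq_zero[OF assms(2)]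
    by (simp del: Comp_Idn Comp_zr)
  then show "\<delta> Y \<cdot>\<^bsub>quot\<^esub> Q f = \<delta> Y \<cdot>\<^bsub>quot\<^esub> Q (zr A D (FObj S Y))" by simp
qed (use assms thick_Obj in simp_all)

text \<open>An arrow from an object of C into S Y vanishes, so such a subobject is zero. For an
  extension by an object of C, Q inverts the inclusion f; the transpose of \<delta> (Q f)^-1 is a
  retraction of f, which splits the sequence.\<close>

lemma saturated_S:
  assumes Y [simp]: "Y \<in> Obj A"
  shows "saturated A C (FObj S Y)"
  unfolding saturated_def
proof (intro conjI allI impI)
  show "FObj S Y \<in> Obj A" by simp
  fix i assume i: "mono_arr A i" "Cod A i = FObj S Y" "Dom A i \<in> C"
  have [simp]: "i \<in> Arr A" using i by (simp add: mono_arr_def)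
  have "i = zr A (Dom A i) (FObj S Y)"
    by (rule torsion_to_S[OF _ i(3) Y]) (simp add: Hom_def i(2))
  then have "zero_arr A i" using zero_arr_iff[OF pointed, of i] i(2) by simp
  then show "zero_obj A (Dom A i)" by (rule zero_mono_zero_obj[OF i(1)])
next
  fix f g assume fg: "short_exact A f g" "Dom A f = FObj S Y" "Cod A g \<in> C"
  have k: "is_kernel A g f" and c: "is_cokernel A f g" using fg by (auto simp: short_exact_def)
  note [simp] = kernelD(1,2)[OF k] fg(2)
  have "sub_with_quot_in A C (Cod A f) f"
    using kernel_mono[OF category k] c fg(3) by (auto simp: sub_with_quot_in_def)
  then have fi: "iso_arr quot (Q f)" by (rule Q_sub_iso)
  note i [simp] = inv_arr[OF fi]
  let ?\<phi> = "\<delta> Y \<cdot>\<^bsub>quot\<^esub> inv_arr quot (Q f)"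
  let ?r = "FArr S ?\<phi> \<cdot>\<^bsub>A\<^esub> \<eta> (Cod A f)"
  have r: "?r \<in> Hom A (Cod A f) (FObj S Y)" by (simp add: Hom_def)
  note [simp] = HomD[OF r]
  have "\<delta> Y \<cdot>\<^bsub>quot\<^esub> Q ?r = ?\<phi>" using transpose_right[of ?\<phi> "Cod A f"] by simp
  then have "(\<delta> Y \<cdot>\<^bsub>quot\<^esub> Q ?r) \<cdot>\<^bsub>quot\<^esub> Q f = \<delta> Y" by simp
  then have "\<delta> Y \<cdot>\<^bsub>quot\<^esub> Q (?r \<cdot>\<^bsub>A\<^esub> f) = \<delta> Y \<cdot>\<^bsub>quot\<^esub> Q (Idn A (FObj S Y))" by simp
  then have "?r \<cdot>\<^bsub>A\<^esub> f = Idn A (FObj S Y)"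
    by (intro S_Hom_eqI[of _ "FObj S Y" Y]) (simp_all add: Hom_def)
  then show "splits A g" using split_mono_splits[OF fg(1)] r by simp
qed

lemma saturated_unit_iso:
  assumes "saturated A C M"
  shows "iso_arr A (\<eta> M)"
proof -
  have M [simp]: "M \<in> Obj A" using assms by (simp add: saturated_def)
  have Qi: "iso_arr quot (Q (\<eta> M))" using F_unit_iso[of M] by simp
  have Id: "iso_arr quot (Q (Idn A X))" if "X \<in> Obj A" for X
    by (rule functor_iso(1)[OF F_functor iso_arr_Idn[OF category that]])
  obtain k where k: "is_kernel A (\<eta> M) k" by (rule kernel_ex[of "\<eta> M"]) simp
  note [simp] = kernelD(1-3)[OF k]
  \<comment> \<open>The unit kills both arrows and Q inverts the unit. As Q k is mono, this makes
    the source of k a torsion object.\<close>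
  have "Q k = Q (zr A (Dom A k) M)"
    by (rule Q_eqI[where M = "Dom A k" and N = M and i = "Idn A (Dom A k)" and p = "\<eta> M"
          and M' = "Dom A k" and N' = "FObj S M"])
      (use kernel_zr[OF k] Id Qi in \<open>simp_all add: Hom_def\<close>)
  then have "Q k \<cdot>\<^bsub>quot\<^esub> Q (Idn A (Dom A k)) = Q k \<cdot>\<^bsub>quot\<^esub> Q (zr A (Dom A k) (Dom A k))"
    using Q_simps(8)[of "zr A (Dom A k) (Dom A k)" k] by simp
  then have "Q (Idn A (Dom A k)) = Q (zr A (Dom A k) (Dom A k))"
    by (rule mono_arrD[OF Q_mono[OF kernel_mono[OF category k]], where X = "Dom A k", rotated -1])
      (simp_all add: Hom_def)
  then have "Dom A k \<in> C" by (intro Q_eq_zeroD) simp_all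
  then have kz: "zero_obj A (Dom A k)"
    using assms kernel_mono[OF category k] unfolding saturated_def by simp
  have mono: "mono_arr A (\<eta> M)"
  proof (rule mono_arrI_zero[OF preadd, where X = M and Y = "FObj S M"])
    fix T t assume t: "t \<in> Hom A T M" and z: "\<eta> M \<cdot>\<^bsub>A\<^esub> t = zr A T (FObj S M)"
    note [simp] = HomD[OF t] Hom_in_Obj[OF category t]
    obtain u where u: "u \<in> Hom A T (Dom A k)" "k \<cdot>\<^bsub>A\<^esub> u = t"
      by (rule kernel_lift[OF k, of t]) (use z in simp_all)
    have "u = zr A T (Dom A k)" by (rule zero_obj_Hom_eq(1)[OF pointed kz u(1)])
    then show "t = zr A T M" using u(2) by simp
  qed (simp add: Hom_def)
  obtain c where c: "is_cokernel A (\<eta> M) c" by (rule cokernel_ex[of "\<eta> M"]) simp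
  note c' [simp] = cokernelD(1,2)[OF c]
  have [simp]: "Dom A c = FObj S M" using cokernelD(3)[OF c] by simp
  let ?D = "Cod A c"
  have "Q c = Q (zr A (FObj S M) ?D)"
    by (rule Q_eqI[where M = "FObj S M" and N = ?D and i = "\<eta> M" and p = "Idn A ?D"
          and M' = M and N' = ?D])
      (use cokernel_zr[OF c] Id Qi in \<open>simp_all add: Hom_def\<close>)
  then have "Q (Idn A ?D) \<cdot>\<^bsub>quot\<^esub> Q c = Q (zr A ?D ?D) \<cdot>\<^bsub>quot\<^esub> Q c"
    using Q_simps(8)[of c "zr A ?D ?D"] by simp
  \<comment> \<open>The left adjoint Q preserves the cokernel \<open>c\<close>, so Q c is epi and
    can be cancelled.\<close>
  then have "Q (Idn A ?D) = Q (zr A ?D ?D)"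
    by (rule epi_arrD[OF cokernel_epi[OF _ F_cokernel[OF pointed pointed_quot c]], where X = ?D, rotated -1])
      (simp_all add: Hom_def)
  then have D: "?D \<in> C" by (intro Q_eq_zeroD) simp_all
  have "short_exact A (\<eta> M) c" using c kernel_cokernel[OF c mono] by (simp add: short_exact_def)
  then have "splits A c" using assms D unfolding saturated_def by simp
  then obtain s where s: "s \<in> Hom A ?D (FObj S M)" "c \<cdot>\<^bsub>A\<^esub> s = Idn A ?D" by (auto simp: splits_def)
  have "s = zr A ?D (FObj S M)" by (rule torsion_to_S[OF s(1) D M])
  then have "Idn A ?D = zr A ?D ?D" using s(2) by simp
  then have "Idn A ?D \<cdot>\<^bsub>A\<^esub> c = zr A (FObj S M) ?D" by (simp del: Idn_Comp)
  then have "zero_arr A c" using zero_arr_iff[OF pointed, of c] by simp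
  then show ?thesis by (rule zero_kernel_iso[OF category kernel_cokernel[OF c mono]])
qed

end

section \<open>Full subcategories between the image of the section functor and the saturated objects\<close>

lemma full_subcategory_simps [simp]:
  "Obj (full_subcategory A U) = U"
  "Arr (full_subcategory A U) = {f \<in> Arr A. Dom A f \<in> U \<and> Cod A f \<in> U}"
  "Dom (full_subcategory A U) = Dom A" "Cod (full_subcategory A U) = Cod A"
  "Idn (full_subcategory A U) = Idn A" "Comp (full_subcategory A U) = Comp A"
  by (simp_all add: full_subcategory_def)

lemma Hom_full_subcategory: "X \<in> U \<Longrightarrow> Y \<in> U \<Longrightarrow> Hom (full_subcategory A U) X Y = Hom A X Y"
  by (auto simp: Hom_def)

lemma category_full_subcategory: "category A \<Longrightarrow> U \<subseteq> Obj A \<Longrightarrow> category (full_subcategory A U)"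
  unfolding category_def[of "full_subcategory A U"] by (auto simp: Hom_def)

lemma full_subcategory_inclusion:
  assumes "category A" "U \<subseteq> V" "V \<subseteq> Obj A"
  shows "is_functor (full_subcategory A U) (full_subcategory A V) id_func"
  using assms category_full_subcategory[of A U] category_full_subcategory[of A V]
  by (intro is_functorI) auto

lemma iso_full_subcategory:
  assumes "iso_arr A f" "Dom A f \<in> U" "Cod A f \<in> U"
  shows "iso_arr (full_subcategory A U) f"
  using inv_arr[OF assms(1)] assms(2,3)
  by (intro iso_arrI[of f "full_subcategory A U" "Dom A f" "Cod A f" "inv_arr A f"]) (simp_all add: Hom_def)

locale intermediate_subcategory = localization +
  fixes U
  assumes S_image_U: "FObj S ` Obj A \<subseteq> U" and U_Obj: "U \<subseteq> Obj A"
    and unit_iso_U: "\<forall>M \<in> U. iso_arr A (\<eta> M)"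
begin

lemma S_in_U: "Y \<in> Obj A \<Longrightarrow> FObj S Y \<in> U" and U_iso: "M \<in> U \<Longrightarrow> iso_arr A (\<eta> M)"
  using S_image_U unit_iso_U by auto

abbreviation (input) "D \<equiv> full_subcategory A U"

text \<open>The counit of the reflection onto U; with \<eta> as unit, its triangle identity forces
  the inverse of \<eta> M.\<close>

abbreviation (input) "\<delta>' M \<equiv> inv_arr A (\<eta> M)"

lemma in_U [simp]: "M \<in> U \<Longrightarrow> M \<in> Obj A"
  using U_Obj by blast

lemma category_D [simp]: "category D"
  by (rule category_full_subcategory[OF category U_Obj])

lemma retract_simps [simp]:
  assumes "M \<in> U"
  shows "\<delta>' M \<in> Arr A" "Dom A (\<delta>' M) = FObj S M" "Cod A (\<delta>' M) = M"
    "\<delta>' M \<cdot>\<^bsub>A\<^esub> \<eta> M = Idn A M" "\<eta> M \<cdot>\<^bsub>A\<^esub> \<delta>' M = Idn A (FObj S M)"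
  using inv_arr[OF U_iso[OF assms]] assms by simp_all

lemma retract_nat:
  assumes "f \<in> Arr A" "Dom A f \<in> U" "Cod A f \<in> U"
  shows "\<delta>' (Cod A f) \<cdot>\<^bsub>A\<^esub> FArr S (Q f) = f \<cdot>\<^bsub>A\<^esub> \<delta>' (Dom A f)"
proof -
  note [simp] = assms
  have "\<delta>' (Cod A f) \<cdot>\<^bsub>A\<^esub> ((FArr S (Q f) \<cdot>\<^bsub>A\<^esub> \<eta> (Dom A f)) \<cdot>\<^bsub>A\<^esub> \<delta>' (Dom A f)) = f \<cdot>\<^bsub>A\<^esub> \<delta>' (Dom A f)"
    using unit_nat[of f] by (simp add: Comp_reassoc[OF category retract_simps(4)])
  then show ?thesis by simp
qed

lemma Q_D_functor: "is_functor D quot (canonical_functor A C)"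
  by (rule is_functorI) simp_all

lemma S_D_functor: "is_functor quot D S"
  using Dom_in_Obj[OF Q_simps(2)] Cod_in_Obj[OF Q_simps(2)]
  by (intro is_functorI) (simp_all add: S_in_U)

lemma inclusion_functor: "is_functor D A id_func"
  by (rule is_functorI) simp_all

lemma reflector_functor: "is_functor A D (S \<circ>\<^sub>F canonical_functor A C)"
  by (rule functor_comp[OF canonical_functor S_D_functor])

lemma retract_nat_iso: "nat_iso D D (S \<circ>\<^sub>F canonical_functor A C) id_func \<delta>'"
  unfolding nat_iso_def nat_trans_def
proof (intro conjI ballI)
  show "is_functor D D (S \<circ>\<^sub>F canonical_functor A C)" by (rule functor_comp[OF Q_D_functor S_D_functor])
  show "is_functor D D id_func" by (rule id_functor) simp
  fix X assume "X \<in> Obj D"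
  then have [simp]: "X \<in> U" by simp
  show "iso_arr D (\<delta>' X)"
    by (rule iso_full_subcategory) (simp_all add: iso_arr_inv U_iso S_in_U)
  show "\<delta>' X \<in> Hom D (FObj (S \<circ>\<^sub>F canonical_functor A C) X) (FObj id_func X)"
    by (simp add: Hom_def S_in_U)
qed (simp add: retract_nat)

lemma counit_nat_iso: "nat_iso quot quot (canonical_functor A C \<circ>\<^sub>F S) id_func \<delta>"
  using adj counit_iso by (simp add: nat_iso_def adjunction_def)

lemma unit_nat_trans: "nat_trans A A id_func (S \<circ>\<^sub>F canonical_functor A C) \<eta>"
  using adj by (simp add: adjunction_def)

lemma Q_S_quasi_inverse: "quasi_inverse_equivalences D quot (canonical_functor A C) S"
  unfolding quasi_inverse_equivalences_def
  using Q_D_functor S_D_functor retract_nat_iso counit_nat_iso by blast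

text \<open>Makes S a right adjoint with values in D, so that \<open>G_kernel\<close> produces
  kernels formed in D rather than in A.\<close>

lemma Q_S_adjunction_D: "adjunction D quot (canonical_functor A C) S \<eta> \<delta>"
proof -
  have "nat_trans D D id_func (S \<circ>\<^sub>F canonical_functor A C) \<eta>"
    unfolding nat_trans_def
  proof (intro conjI ballI)
    show "is_functor D D (S \<circ>\<^sub>F canonical_functor A C)" by (rule functor_comp[OF Q_D_functor S_D_functor])
    show "is_functor D D id_func" by (rule id_functor) simp
  qed (simp_all add: Hom_def S_in_U unit_nat)
  then show ?thesis
    using Q_D_functor S_D_functor counit_nat_iso triangle_F triangle_G
    by (simp add: adjunction_def nat_iso_def)
qed

text \<open>The unit is that of Q and S. At S X the inverse unit is S (\<delta> X), so one triangle
  identity is the image under S of the original one.\<close>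

lemma reflector_adjunction: "adjunction A D (S \<circ>\<^sub>F canonical_functor A C) id_func \<eta> \<delta>'"
  unfolding adjunction_def
proof (intro conjI ballI)
  show "nat_trans A A id_func (id_func \<circ>\<^sub>F (S \<circ>\<^sub>F canonical_functor A C)) \<eta>"
    using unit_nat_trans by (simp add: func_comp_def id_func_def)
  show "nat_trans D D ((S \<circ>\<^sub>F canonical_functor A C) \<circ>\<^sub>F id_func) id_func \<delta>'"
    using retract_nat_iso by (simp add: nat_iso_def func_comp_def id_func_def)
  fix X assume [simp]: "X \<in> Obj A"
  have "FArr S (\<delta> X) \<cdot>\<^bsub>A\<^esub> FArr S (Q (\<eta> X)) = FArr S (\<delta> X \<cdot>\<^bsub>quot\<^esub> Q (\<eta> X))" by simp
  also have "\<dots> = Idn A (FObj S X)" using triangle_F[of X] by simp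
  finally show "\<delta>' (FObj (S \<circ>\<^sub>F canonical_functor A C) X) \<cdot>\<^bsub>D\<^esub> FArr (S \<circ>\<^sub>F canonical_functor A C) (\<eta> X)
      = Idn D (FObj (S \<circ>\<^sub>F canonical_functor A C) X)"
    using unit_G_iso(2)[of X] by simp
qed (use reflector_functor inclusion_functor in simp_all)

lemma pointed_D: "pointed D"
proof -
  obtain Z where "zero_obj A Z" using pointed by (auto simp: pointed_def)
  then have z: "zero_obj A (FObj S Z)" and Z: "FObj S Z \<in> U"
    using G_zero_obj[OF pointed Q_zero_object] S_in_U by (auto simp: zero_obj_def)
  have "zero_obj D (FObj S Z)"
    using z Z in_U unfolding zero_obj_def by (simp add: Hom_full_subcategory)
  then show ?thesis by (auto simp: pointed_def)
qed

lemma reflector_kernel: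
  assumes "is_kernel A f k"
  shows "is_kernel D (FArr (S \<circ>\<^sub>F canonical_functor A C) f) (FArr (S \<circ>\<^sub>F canonical_functor A C) k)"
proof -
  interpret DQ: adjoint D quot "canonical_functor A C" S \<eta> \<delta>
    by unfold_locales (rule Q_S_adjunction_D)
  show ?thesis using DQ.G_kernel[OF pointed_D pointed_quot Q_kernel[OF assms]] by simp
qed

lemma exact_reflection_D:
  "exact_reflection A D (S \<circ>\<^sub>F canonical_functor A C) id_func \<eta> \<delta>' add"
proof unfold_locales
  show "adjunction A D (S \<circ>\<^sub>F canonical_functor A C) id_func \<eta> \<delta>'" by (rule reflector_adjunction)
  show "iso_arr D (\<delta>' Y)" if "Y \<in> Obj D" for Y
    using retract_nat_iso that by (simp add: nat_iso_def)
qed (rule reflector_kernel)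

lemma abelian_D: "abelian_category D"
  by (rule exact_reflection.abelian'[OF exact_reflection_D])

lemma reflector_exact: "exact_functor A D (S \<circ>\<^sub>F canonical_functor A C)"
proof -
  interpret R: exact_reflection A D "S \<circ>\<^sub>F canonical_functor A C" id_func \<eta> \<delta>' add
    by (rule exact_reflection_D)
  show ?thesis
    using R.F_kernel R.F_cokernel[OF pointed pointed_D] reflector_functor
    unfolding exact_functor_def short_exact_def by blast
qed

lemma inclusion_left_exact: "left_exact_functor D A id_func"
proof -
  interpret R: exact_reflection A D "S \<circ>\<^sub>F canonical_functor A C" id_func \<eta> \<delta>' add
    by (rule exact_reflection_D)
  show ?thesis
    using R.G_kernel[OF pointed pointed_D] inclusion_functor
    unfolding left_exact_functor_def by blast
qed

text \<open>The comparisons are \<alpha> = \<delta> and \<beta> = \<eta>. The unit condition is a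
  triangle identity; the counit condition reduces to Q (\<delta>' Y) = \<delta> Y, both sides being
  inverse to Q (\<eta> Y).\<close>

lemma correspond_Q:
  "adjunctions_correspond A D quot (canonical_functor A C) (S \<circ>\<^sub>F canonical_functor A C) id_func \<eta> \<delta>'
     (canonical_functor A C) S \<eta> \<delta>"
  unfolding adjunctions_correspond_def
proof (intro exI conjI ballI)
  show "nat_iso A quot (canonical_functor A C \<circ>\<^sub>F (S \<circ>\<^sub>F canonical_functor A C)) (canonical_functor A C) \<delta>"
    unfolding nat_iso_def nat_trans_def
  proof (intro conjI ballI)
    show "is_functor A quot (canonical_functor A C \<circ>\<^sub>F (S \<circ>\<^sub>F canonical_functor A C))"
      by (rule functor_comp[OF reflector_functor Q_D_functor])
    fix f assume "f \<in> Arr A"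
    then show "\<delta> (Cod A f) \<cdot>\<^bsub>quot\<^esub> FArr (canonical_functor A C \<circ>\<^sub>F (S \<circ>\<^sub>F canonical_functor A C)) f =
        Q f \<cdot>\<^bsub>quot\<^esub> \<delta> (Dom A f)"
      using counit_nat[of "Q f"] by simp
  qed (use canonical_functor counit_iso in \<open>simp_all add: Hom_def\<close>)
  show "nat_iso D A id_func (S \<circ>\<^sub>F canonical_functor A C) \<eta>"
    unfolding nat_iso_def nat_trans_def
  proof (intro conjI ballI)
    show "is_functor D A (S \<circ>\<^sub>F canonical_functor A C)"
      by (rule functor_comp[OF Q_D_functor G_functor])
  qed (use inclusion_functor unit_nat U_iso in \<open>simp_all add: Hom_def\<close>)
  fix X assume [simp]: "X \<in> Obj A"
  show "FArr S (\<delta> X) \<cdot>\<^bsub>A\<^esub> (\<eta> (FObj (S \<circ>\<^sub>F canonical_functor A C) X) \<cdot>\<^bsub>A\<^esub> \<eta> X) = \<eta> X"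
    by (simp add: Comp_reassoc[OF category triangle_G])
next
  fix Y assume "Y \<in> Obj D"
  then have [simp]: "Y \<in> U" by simp
  have "Q (\<delta>' Y) = inv_arr quot (Q (\<eta> Y))" using functor_iso(2)[OF canonical_functor U_iso[of Y]] by simp
  also have "\<dots> = \<delta> Y"
    using triangle_F[of Y] inv_counit_F[of Y] inv_counit_simps(4)[of Y]
    by (intro inv_arr_eqI[of _ _ Y "FObj S Y"]) (simp_all add: Hom_def)
  finally show "\<delta> (FObj (canonical_functor A C) Y) \<cdot>\<^bsub>quot\<^esub> (Q (\<eta> Y) \<cdot>\<^bsub>quot\<^esub> \<delta> (FObj id_func Y)) = Q (\<delta>' Y)"
    using Comp_reassoc[OF _ triangle_F[of Y], of "\<delta> Y"] by simp
qed

text \<open>The functors match on the nose, so identities serve as comparisons. What remains is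
  \<delta>' (S Y) = S (\<delta> Y).\<close>

lemma correspond_S:
  "adjunctions_correspond A quot D S (canonical_functor A C) S \<eta> \<delta>
     (S \<circ>\<^sub>F canonical_functor A C) id_func \<eta> \<delta>'"
  unfolding adjunctions_correspond_def
proof (intro exI conjI ballI)
  show "nat_iso A D (S \<circ>\<^sub>F canonical_functor A C) (S \<circ>\<^sub>F canonical_functor A C) (\<lambda>X. Idn A (FObj S X))"
    unfolding nat_iso_def nat_trans_def
    using reflector_functor iso_full_subcategory[OF iso_arr_Idn[OF category]]
    by (simp add: Hom_def S_in_U)
  show "nat_iso quot A S (id_func \<circ>\<^sub>F S) (\<lambda>Y. Idn A (FObj S Y))"
    unfolding nat_iso_def nat_trans_def
    using G_functor iso_arr_Idn[OF category] functor_comp[OF G_functor id_functor[OF category]]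
    by (simp add: Hom_def)
  fix Y assume "Y \<in> Obj quot"
  then have [simp]: "Y \<in> Obj A" by simp
  show "\<delta>' (FObj S Y) \<cdot>\<^bsub>D\<^esub> (FArr (S \<circ>\<^sub>F canonical_functor A C) (Idn A (FObj S Y)) \<cdot>\<^bsub>D\<^esub> Idn A (FObj S (FObj S Y))) = FArr S (\<delta> Y)"
    using unit_G_iso(2)[of Y] by simp
qed simp

text \<open>Only the multiplications need an argument: the inverse unit at S X equals S (\<delta>
  X).\<close>

lemma same_monads:
  "same_monad A (adjunction_monad (S \<circ>\<^sub>F canonical_functor A C) id_func \<eta> \<delta>') (adjunction_monad (canonical_functor A C) S \<eta> \<delta>)"
  using unit_G_iso(2) by (simp add: same_monad_def adjunction_monad_def)

end

context localization
begin

lemma saturated_intermediate: "intermediate_subcategory A add C S \<eta> \<delta> {M. saturated A C M}"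
proof unfold_locales
  show "{M. saturated A C M} \<subseteq> Obj A" unfolding saturated_def by blast
qed (auto simp: saturated_S saturated_unit_iso)

lemma image_intermediate: "intermediate_subcategory A add C S \<eta> \<delta> (FObj S ` Obj A)"
  by unfold_locales (auto simp: unit_G_iso(1))

text \<open>S is full, so every arrow of A between objects in its image is itself in the image. This
  is also why the literal image is closed under composition.\<close>

lemma image_full_subcategory: "image_category quot A S = full_subcategory A (FObj S ` Obj A)"
proof -
  have "f \<in> FArr S ` Arr quot" if "f \<in> Arr A" "Dom A f = FObj S X" "Cod A f = FObj S Y" "X \<in> Obj A" "Y \<in> Obj A" for f X Y
    using G_full[of f X Y] that HomD(1) by (metis Hom_self image_eqI serre_quotient_simps(1))
  then have "{f \<in> Arr A. Dom A f \<in> FObj S ` Obj A \<and> Cod A f \<in> FObj S ` Obj A} \<subseteq> FArr S ` Arr quot"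
    by blast
  moreover have "FArr S \<phi> \<in> {f \<in> Arr A. Dom A f \<in> FObj S ` Obj A \<and> Cod A f \<in> FObj S ` Obj A}"
    if "\<phi> \<in> Arr quot" for \<phi>
    using that G_simps(4-6)[OF that] Dom_in_Obj[OF Q_simps(2) that] Cod_in_Obj[OF Q_simps(2) that] by simp
  ultimately have "FArr S ` Arr quot = {f \<in> Arr A. Dom A f \<in> FObj S ` Obj A \<and> Cod A f \<in> FObj S ` Obj A}"
    by blast
  then show ?thesis by (simp add: image_category_def full_subcategory_def)
qed

text \<open>The quasi-inverses are the reflector S Q and the inclusion; both natural isomorphisms
  are the inverse unit.\<close>

lemma saturated_image_equivalent:
  "equivalent_categories (full_subcategory A {M. saturated A C M}) (full_subcategory A (FObj S ` Obj A))"
proof -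
  let ?Sat = "full_subcategory A {M. saturated A C M}" and ?I = "full_subcategory A (FObj S ` Obj A)"
  let ?R = "S \<circ>\<^sub>F canonical_functor A C"
  interpret Sat: intermediate_subcategory A add C S \<eta> \<delta> "{M. saturated A C M}"
    by (rule saturated_intermediate)
  interpret Im: intermediate_subcategory A add C S \<eta> \<delta> "FObj S ` Obj A"
    by (rule image_intermediate)
  have "is_functor ?Sat ?I ?R" by (rule functor_comp[OF Sat.Q_D_functor Im.S_D_functor])
  moreover have "is_functor ?I ?Sat id_func"
    by (rule full_subcategory_inclusion[OF category Sat.S_image_U Sat.U_Obj])
  moreover have R: "id_func \<circ>\<^sub>F ?R = ?R" "?R \<circ>\<^sub>F id_func = ?R" by (simp_all add: func_comp_def id_func_def)
  ultimately have "quasi_inverse_equivalences ?Sat ?I ?R id_func"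
    unfolding quasi_inverse_equivalences_def R using Sat.retract_nat_iso Im.retract_nat_iso by blast
  then show ?thesis unfolding equivalent_categories_def by blast
qed

end

theorem corollary3p11:
  fixes A :: "('o, 'm) cat" and C :: "'o set"
    and S :: "('o, ('o, 'm) quot_arr, 'o, 'm) func"
    and \<eta> :: "'o \<Rightarrow> 'm" and \<delta> :: "'o \<Rightarrow> ('o, 'm) quot_arr"
  assumes "abelian_category A"
    and "localizing A C"
    and "adjunction A (serre_quotient A C) (canonical_functor A C) S \<eta> \<delta>"
  shows
    "let Q = canonical_functor A C;
         AC = serre_quotient A C;
         SatC = Sat A C;
         Qhat = S \<circ>\<^sub>F Q;
         \<iota> = id_func
     in quasi_inverse_equivalences SatC AC Q S \<and>
        equivalent_categories SatC (image_category AC A S) \<and>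
        equivalent_categories (image_category AC A S) AC \<and>
        abelian_category SatC \<and>
        abelian_category (image_category AC A S) \<and>
        abelian_category AC \<and>
        (\<exists>\<eta>' \<delta>'.
           adjunction A SatC Qhat \<iota> \<eta>' \<delta>' \<and>
           adjunctions_correspond A SatC AC Q Qhat \<iota> \<eta>' \<delta>' Q S \<eta> \<delta> \<and>
           adjunctions_correspond A AC SatC S Q S \<eta> \<delta> Qhat \<iota> \<eta>' \<delta>' \<and>
           same_monad A (adjunction_monad Qhat \<iota> \<eta>' \<delta>') (adjunction_monad Q S \<eta> \<delta>)) \<and>
        exact_functor A SatC Qhat \<and>
        left_exact_functor SatC A \<iota>"
proof -
  obtain add where "preadditive A add" "has_biproducts A add"
    using assms(1) unfolding abelian_category_def by blast
  then interpret localization A add C S \<eta> \<delta>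
    using assms by unfold_locales (auto simp: localizing_def)
  interpret Sat: intermediate_subcategory A add C S \<eta> \<delta> "{M. saturated A C M}"
    by (rule saturated_intermediate)
  interpret Im: intermediate_subcategory A add C S \<eta> \<delta> "FObj S ` Obj A"
    by (rule image_intermediate)
  have "equivalent_categories (full_subcategory A (FObj S ` Obj A)) (serre_quotient A C)"
    using Im.Q_S_quasi_inverse unfolding equivalent_categories_def by blast
  \<comment> \<open>The witnesses for the adjunction onto Sat are \<eta> itself and the family of
    inverses of its components at saturated objects.\<close>
  then show ?thesis
    unfolding Let_def Sat_def image_full_subcategory
    using Sat.Q_S_quasi_inverse saturated_image_equivalent Sat.abelian_D Im.abelian_D abelian'
      Sat.reflector_adjunction Sat.correspond_Q Sat.correspond_S Sat.same_monads
      Sat.reflector_exact Sat.inclusion_left_exact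
    by blast
qed

end
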